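(* Let $k\geq 4$ be an integer. Then $\mathrm{ex}(n, K_{C_k,1}^{\mathrm{sub}})=\Theta(n^{4/3})$; that is, there exist constants $c,C>0$ (depending only on $k$) such that $c\,n^{4/3}\le \mathrm{ex}(n, K_{C_k,1}^{\mathrm{sub}})\le C\,n^{4/3}$ for all sufficiently large $n$.
   Context: For a graph $F$, $\mathrm{ex}(n,F)$ denotes the maximum number of edges in an $n$-vertex graph containing no (not necessarily induced) subgraph isomorphic to $F$. For a graph $H$, its $1$-subdivision $H^{\mathrm{sub}}$ is the graph obtained by replacing every edge of $H$ by a path of length two (each edge gets its own new middle vertex). $C_k$ denotes the cycle on $k$ vertices, and $K_{C_k,1}$ is the graph obtained from $C_k$ by adding one new vertex adjacent to every vertex of the cycle. *)

theory Defs
  imports Complex_Main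
begin

type_synonym 'a graph = "'a set \<times> 'a set set"

abbreviation verts :: "'a graph \<Rightarrow> 'a set" where
  "verts G \<equiv> fst G"

abbreviation edges :: "'a graph \<Rightarrow> 'a set set" where
  "edges G \<equiv> snd G"

definition finite_simple_graph :: "'a graph \<Rightarrow> bool" where
  "finite_simple_graph G \<longleftrightarrow>
     finite (verts G) \<and> (\<forall>e\<in>edges G. e \<subseteq> verts G \<and> card e = 2)"

definition subgraph :: "'a graph \<Rightarrow> 'a graph \<Rightarrow> bool" where
  "subgraph H G \<longleftrightarrow>
     finite_simple_graph H \<and> verts H \<subseteq> verts G \<and> edges H \<subseteq> edges G"

definition isomorphic :: "'a graph \<Rightarrow> 'b graph \<Rightarrow> bool" where
  "isomorphic G H \<longleftrightarrow>
     (\<exists>f. bij_betw f (verts G) (verts H) \<and> (\<lambda>e. f ` e) ` edges G = edges H)"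

definition contains_copy :: "'a graph \<Rightarrow> 'b graph \<Rightarrow> bool" where
  "contains_copy G F \<longleftrightarrow> (\<exists>H. subgraph H G \<and> isomorphic H F)"

text \<open>
  Every \<open>n\<close>-vertex graph is isomorphic to one with vertices in \<open>nat\<close>, so ranging over
  graphs on finite sets of naturals loses nothing. The set below is finite (each value is at most
  \<open>n choose 2\<close>), and it contains \<open>0\<close> whenever \<open>F\<close> has an edge.
\<close>

definition ex :: "nat \<Rightarrow> 'b graph \<Rightarrow> nat" where
  "ex n F = Max {card (edges G) | G :: nat graph.
     finite_simple_graph G \<and> card (verts G) = n \<and> \<not> contains_copy G F}"

text \<open>The middle vertex of the path replacing the edge \<open>e\<close> is \<open>Inr e\<close>.\<close>

definition subdivision1 :: "'a graph \<Rightarrow> ('a + 'a set) graph" where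
  "subdivision1 H =
     (Inl ` verts H \<union> Inr ` edges H, {{Inl v, Inr e} | v e. e \<in> edges H \<and> v \<in> e})"

text \<open>A cycle only for \<open>k \<ge> 3\<close>.\<close>

definition cycle_graph :: "nat \<Rightarrow> nat graph" where
  "cycle_graph k = ({..<k}, {{i, Suc i mod k} | i. i < k})"

text \<open>The new vertex, adjacent to all old ones, is \<open>None\<close>.\<close>

definition add_apex :: "'a graph \<Rightarrow> 'a option graph" where
  "add_apex G =
     (insert None (Some ` verts G),
      (\<lambda>e. Some ` e) ` edges G \<union> {{None, Some v} | v. v \<in> verts G})"

end

theory Submission
  imports Defs "HOL-Library.Ramsey" "HOL-Algebra.Algebraic_Closure_Type" "HOL-Library.Z2"
begin

text \<open>
  Lower bound: the subdivided wheel contains a hexagon, and the Wenger graph over the field with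
  \<open>q = 2\<^sup>m\<close> elements (points \<open>(a, b, c)\<close>, lines \<open>(x, y, z)\<close>, incidence \<open>b + y = a x\<close>, \<open>c + z = a y\<close>)
  has \<open>2 q\<^sup>3\<close> vertices, \<open>q\<^sup>4\<close> edges and no hexagon, by a Vandermonde argument.

  Upper bound: pass to an almost regular subgraph with degrees about \<open>\<Delta>\<close>, where \<open>\<Delta>\<^sup>3\<close> is much larger than
  the number \<open>n\<close> of vertices. The pairs of vertices with at least \<open>3 k + 1\<close> common neighbours form a graph without \<open>K\<^sub>k\<^sub>+\<^sub>1\<close>,
  as it would extend greedily to the subdivided wheel; so there are of order \<open>n \<Delta>\<^sup>3\<close> paths of length three all
  of whose pairs at distance two are light. For a hub \<open>v\<close> one looks for the rim, a cycle of length \<open>2 k\<close>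
  alternating between the second neighbourhood of \<open>v\<close> (at most \<open>\<Delta>\<^sup>2\<close> vertices \<open>u\<close>, each with a spoke vertex
  \<open>p\<close> between \<open>v\<close> and \<open>u\<close>) and other vertices \<open>b\<close>, with distinct spoke vertices. Exploring from a rim vertex
  \<open>x\<close> through \<open>x, b', u', b, u\<close> gives more than \<open>\<Delta>\<^sup>2\<close> walks, so that some \<open>u\<close> are reached many times. In the
  bipartite graph between the walks \<open>b', u', b\<close> and their ends \<open>u\<close>, both sides then have large minimum degree
  (after cleaning), and a zigzag path of any prescribed length can be chosen greedily; closing it up at the place
  where the first and the last walk branch gives the rim. The exploration uses four levels, which is why
  \<open>k \<ge> 4\<close> is needed. The spoke vertices of branching walks are distinct provided that no pair \<open>(x, p')\<close> is joined
  by too many paths of length three. To guarantee this, count hexagons \<open>v, p, x, b', u', p'\<close> with \<open>Q\<close> to \<open>4 Q\<close>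
  light paths from \<open>x\<close> to \<open>p'\<close>, where \<open>Q\<close> maximises \<open>Q F(Q)\<^sup>2\<close> and \<open>F(Q)\<close> is the number of light paths whose
  ends are joined by at least \<open>Q\<close> of them.
\<close>

section \<open>Counting and greedy choices\<close>

lemma card_le_fibres:
  assumes "finite A" "\<And>y. y \<in> f ` A \<Longrightarrow> card {a \<in> A. f a = y} \<le> m"
  shows "card A \<le> m * card (f ` A)"
proof -
  have "card A = card (\<Union>y\<in>f ` A. {a \<in> A. f a = y})"
    by (rule arg_cong[where f = card]) auto
  also have "\<dots> \<le> (\<Sum>y\<in>f ` A. card {a \<in> A. f a = y})"
    using assms(1) by (intro card_UN_le) auto
  also have "\<dots> \<le> (\<Sum>y\<in>f ` A. m)"
    using assms(2) by (intro sum_mono) auto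
  finally show ?thesis by (simp add: mult.commute)
qed

lemma card_ge_fibres:
  assumes "finite A" "\<And>y. y \<in> f ` A \<Longrightarrow> m \<le> card {a \<in> A. f a = y}"
  shows "m * card (f ` A) \<le> card A"
proof -
  have "m * card (f ` A) = (\<Sum>y\<in>f ` A. m)" by (simp add: mult.commute)
  also have "\<dots> \<le> (\<Sum>y\<in>f ` A. card {a \<in> A. f a = y})"
    using assms(2) by (intro sum_mono) auto
  also have "\<dots> = card (\<Union>y\<in>f ` A. {a \<in> A. f a = y})"
    using assms(1) by (intro card_UN_disjoint[symmetric]) auto
  also have "\<dots> = card A"
    by (rule arg_cong[where f = card]) auto
  finally show ?thesis .
qed

lemma card_le_Sigma:
  assumes "finite J" "card J \<le> m" "\<And>x. x \<in> J \<Longrightarrow> finite (Y x) \<and> card (Y x) \<le> n"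
    and "inj_on f A" "f ` A \<subseteq> Sigma J Y"
  shows "card A \<le> m * n"
proof -
  have fin: "finite (Sigma J Y)" using assms by auto
  have "card A = card (f ` A)" using assms(4) by (simp add: card_image)
  also have "\<dots> \<le> card (Sigma J Y)" using assms(5) fin by (intro card_mono)
  also have "\<dots> = (\<Sum>x\<in>J. card (Y x))" using assms by (intro card_SigmaI) auto
  also have "\<dots> \<le> (\<Sum>x\<in>J. n)" using assms by (intro sum_mono) auto
  also have "\<dots> \<le> m * n" using assms(2) by simp
  finally show ?thesis .
qed

lemma card_partition: "finite A \<Longrightarrow> B \<subseteq> A \<Longrightarrow> card A = card B + card (A - B)"
  using card_Diff_subset[of B A] card_mono[of A B] finite_subset[of B A] by auto

text \<open>Greedy choice: an element of \<open>S\<close> rules out at most \<open>d\<close>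
  elements, itself included by reflexivity, so after \<open>n\<close> choices something is left as
  long as \<open>n * d < card S\<close>.\<close>

lemma exists_pairwise_unrelated:
  assumes "finite S" "\<And>z. z \<in> S \<Longrightarrow> card {w \<in> S. R z w} \<le> d"
    and refl: "\<And>z. z \<in> S \<Longrightarrow> R z z" and sym: "\<And>z w. R z w \<Longrightarrow> R w z"
    and "n * d < card S"
  shows "\<exists>T \<subseteq> S. card T = Suc n \<and> (\<forall>z\<in>T. \<forall>w\<in>T. z \<noteq> w \<longrightarrow> \<not> R z w)"
  using assms(5)
proof (induction n)
  case 0
  then obtain z where "z \<in> S" by fastforce
  then show ?case by (intro exI[of _ "{z}"]) auto
next
  case (Suc n)
  then obtain T where T: "T \<subseteq> S" "card T = Suc n" "\<forall>z\<in>T. \<forall>w\<in>T. z \<noteq> w \<longrightarrow> \<not> R z w"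
    by fastforce
  have finT: "finite T" using T assms(1) finite_subset by blast
  have "card (\<Union>z\<in>T. {w \<in> S. R z w}) \<le> (\<Sum>z\<in>T. card {w \<in> S. R z w})"
    using finT by (rule card_UN_le)
  also have "\<dots> \<le> (\<Sum>z\<in>T. d)" using T assms(2) by (intro sum_mono) auto
  also have "\<dots> < card S" using T Suc.prems by simp
  finally have "\<not> S \<subseteq> (\<Union>z\<in>T. {w \<in> S. R z w})"
    using card_mono[of "\<Union>z\<in>T. {w \<in> S. R z w}" S] assms(1) finT by auto
  then obtain s where s: "s \<in> S" "\<And>z. z \<in> T \<Longrightarrow> \<not> R z s" by blast
  have "s \<notin> T" using s refl by blast
  then show ?case
    using T s finT sym by (intro exI[of _ "insert s T"]) (auto dest: sym)
qed

text \<open>Maximising a linear potential over all subgraphs yields minimum degrees on both sides.\<close>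

lemma bipartite_min_degree_subgraph:
  fixes E :: "('p \<times> 'q) set"
  assumes fin: "finite E" and big: "A * card (fst ` E) + B * card (snd ` E) < card E"
  obtains E' where "E' \<subseteq> E" "E' \<noteq> {}"
    "\<And>p y. (p, y) \<in> E' \<Longrightarrow> A < card {y. (p, y) \<in> E'}"
    "\<And>p y. (p, y) \<in> E' \<Longrightarrow> B < card {p. (p, y) \<in> E'}"
proof -
  define \<phi> :: "('p \<times> 'q) set \<Rightarrow> int"
    where "\<phi> J = int (card J) - int A * int (card (fst ` J)) - int B * int (card (snd ` J))" for J
  define M where "M = Max (\<phi> ` Pow E)"
  define C where "C = {J. J \<subseteq> E \<and> \<phi> J = M}"
  have finP: "finite (\<phi> ` Pow E)" using fin by simp
  have le: "\<phi> J \<le> M" if "J \<subseteq> E" for J unfolding M_def using finP that by (intro Max_ge) auto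
  have "M \<in> \<phi> ` Pow E" unfolding M_def using finP by (intro Max_in) auto
  then have "C \<noteq> {}" unfolding C_def by auto
  \<comment> \<open>Among the maximisers of \<open>\<phi>\<close> one with the fewest edges is
    taken. Then every proper subset has strictly smaller \<open>\<phi>\<close>, which makes the
    degree bounds strict.\<close>
  then obtain J where J: "J \<in> C" "\<And>Y. Y \<in> C \<Longrightarrow> card J \<le> card Y"
    using ex_has_least_nat[of "\<lambda>J. J \<in> C" _ card] by blast
  have XE: "J \<subseteq> E" and XM: "\<phi> J = M" using J by (auto simp: C_def)
  have finX: "finite J" using XE fin finite_subset by blast
  have "\<phi> E > 0" using big by (simp add: \<phi>_def flip: of_nat_mult of_nat_add)
  then have Mpos: "M > 0" using le[of E] by simp
  have "J \<noteq> {}" using XM Mpos by (auto simp: \<phi>_def)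
  have strict: "\<phi> Y < M" if "Y \<subset> J" for Y
  proof -
    have "Y \<subseteq> E" using that XE by auto
    moreover have "card Y < card J" using that finX by (simp add: psubset_card_mono)
    ultimately have "\<phi> Y \<noteq> M" using J(2)[of Y] by (auto simp: C_def)
    then show ?thesis using le[OF \<open>Y \<subseteq> E\<close>] by simp
  qed
  show ?thesis
  proof (rule that[OF XE \<open>J \<noteq> {}\<close>])
    fix p y assume py: "(p, y) \<in> J"
    \<comment> \<open>Deleting all edges at \<open>p\<close> removes one left node, which raises
      \<open>\<phi>\<close> by \<open>A\<close>, and as many edges as \<open>p\<close> has; fewer
      right nodes can only raise \<open>\<phi>\<close> further. Since \<open>\<phi>\<close> drops,
      the degree of \<open>p\<close> exceeds \<open>A\<close>.\<close>
    define Y where "Y = {e \<in> J. fst e \<noteq> p}"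
    have "Y \<subset> J" using py unfolding Y_def by force
    have img: "fst ` Y = fst ` J - {p}" "snd ` Y \<subseteq> snd ` J" by (force simp: Y_def)+
    have "card (J - Y) = card {y. (p, y) \<in> J}"
      by (rule bij_betw_same_card[of snd], rule bij_betwI[where g = "\<lambda>y. (p, y)"]) (auto simp: Y_def)
    then have c1: "int (card J) = int (card Y) + int (card {y. (p, y) \<in> J})"
      using card_Diff_subset[of Y J] card_mono[of J Y] finX \<open>Y \<subset> J\<close> finite_subset[of Y J] by auto
    have c2: "int (card (fst ` J)) = int (card (fst ` Y)) + 1"
      using card.remove[of "fst ` J" p] finX imageI[OF py, of fst] unfolding img(1) by simp
    have c3: "int (card (snd ` Y)) \<le> int (card (snd ` J))"
      using finX img(2) by (simp add: card_mono)
    have "int B * int (card (snd ` Y)) \<le> int B * int (card (snd ` J))"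
      using c3 by (intro mult_left_mono) auto
    moreover have "\<phi> Y < \<phi> J" using strict[OF \<open>Y \<subset> J\<close>] XM by simp
    ultimately show "A < card {y. (p, y) \<in> J}"
      unfolding \<phi>_def c1 c2 by (simp add: algebra_simps)
  next
    fix p y assume py: "(p, y) \<in> J"
    define Y where "Y = {e \<in> J. snd e \<noteq> y}"
    have "Y \<subset> J" using py unfolding Y_def by force
    have img: "snd ` Y = snd ` J - {y}" "fst ` Y \<subseteq> fst ` J" by (force simp: Y_def)+
    have "card (J - Y) = card {p. (p, y) \<in> J}"
      by (rule bij_betw_same_card[of fst], rule bij_betwI[where g = "\<lambda>p. (p, y)"]) (auto simp: Y_def)
    then have c1: "int (card J) = int (card Y) + int (card {p. (p, y) \<in> J})"
      using card_Diff_subset[of Y J] card_mono[of J Y] finX \<open>Y \<subset> J\<close> finite_subset[of Y J] by auto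
    have c2: "int (card (snd ` J)) = int (card (snd ` Y)) + 1"
      using card.remove[of "snd ` J" y] finX imageI[OF py, of snd] unfolding img(1) by simp
    have c3: "int (card (fst ` Y)) \<le> int (card (fst ` J))"
      using finX img(2) by (simp add: card_mono)
    have "int A * int (card (fst ` Y)) \<le> int A * int (card (fst ` J))"
      using c3 by (intro mult_left_mono) auto
    moreover have "\<phi> Y < \<phi> J" using strict[OF \<open>Y \<subset> J\<close>] XM by simp
    ultimately show "B < card {p. (p, y) \<in> J}"
      unfolding \<phi>_def c1 c2 by (simp add: algebra_simps)
  qed
qed

section \<open>Greedy zigzags in a bipartite graph\<close>

lemma exists_avoiding:
  assumes "finite B" "finite U" "\<And>z. card {y \<in> B. z \<in> V y} \<le> a" "card U * a < card B"
  shows "\<exists>y \<in> B. V y \<inter> U = {}"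
proof (rule ccontr)
  assume "\<not> ?thesis"
  then have "B = (\<Union>z\<in>U. {y \<in> B. z \<in> V y})" by blast
  then have "card B \<le> (\<Sum>z\<in>U. card {y \<in> B. z \<in> V y})"
    using assms(2) by (metis card_UN_le)
  also have "\<dots> \<le> (\<Sum>z\<in>U. a)" using assms(3) by (intro sum_mono) auto
  finally show False using assms(4) by simp
qed

text \<open>The nodes of the bipartite graph \<open>E\<close> stand for small vertex sets
  \<open>V p\<close> and \<open>W y\<close> of a host graph.
  \<open>P 0, Y 0, P 1, ..., Y (l - 1), P l\<close> is a path in \<open>E\<close> whose sets are
  pairwise disjoint and avoid \<open>U\<close>. Distinctness within one set is left to the meaning
  of the edges of \<open>E\<close>.\<close>

definition zigzag :: "('p \<times> 'q) set \<Rightarrow> ('p \<Rightarrow> 'v set) \<Rightarrow> ('q \<Rightarrow> 'v set) \<Rightarrow> 'v set \<Rightarrow> nat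
    \<Rightarrow> (nat \<Rightarrow> 'p) \<Rightarrow> (nat \<Rightarrow> 'q) \<Rightarrow> bool" where
  "zigzag E V W U l P Y \<longleftrightarrow>
     (\<forall>i<l. (P i, Y i) \<in> E \<and> (P (Suc i), Y i) \<in> E) \<and>
     (\<forall>i\<le>l. V (P i) \<inter> U = {}) \<and> (\<forall>i<l. W (Y i) \<inter> U = {}) \<and>
     (\<forall>i\<le>l. \<forall>j\<le>l. i \<noteq> j \<longrightarrow> V (P i) \<inter> V (P j) = {}) \<and>
     (\<forall>i<l. \<forall>j<l. i \<noteq> j \<longrightarrow> W (Y i) \<inter> W (Y j) = {}) \<and>
     (\<forall>i\<le>l. \<forall>j<l. V (P i) \<inter> W (Y j) = {})"

lemma zigzagD:
  assumes "zigzag E V W U l P Y"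
  shows "\<And>i. i < l \<Longrightarrow> (P i, Y i) \<in> E" "\<And>i. i < l \<Longrightarrow> (P (Suc i), Y i) \<in> E"
    "\<And>i. i \<le> l \<Longrightarrow> V (P i) \<inter> U = {}" "\<And>i. i < l \<Longrightarrow> W (Y i) \<inter> U = {}"
    "\<And>i j. i \<le> l \<Longrightarrow> j \<le> l \<Longrightarrow> i \<noteq> j \<Longrightarrow> V (P i) \<inter> V (P j) = {}"
    "\<And>i j. i < l \<Longrightarrow> j < l \<Longrightarrow> i \<noteq> j \<Longrightarrow> W (Y i) \<inter> W (Y j) = {}"
    "\<And>i j. i \<le> l \<Longrightarrow> j < l \<Longrightarrow> V (P i) \<inter> W (Y j) = {}"
  using assms unfolding zigzag_def by auto

lemma zigzag_mono: "zigzag E' V W U l P Y \<Longrightarrow> E' \<subseteq> E \<Longrightarrow> zigzag E V W U l P Y"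
  unfolding zigzag_def by (meson subsetD)

lemma zigzag_extend:
  assumes z: "zigzag E V W U l P Y" and e: "(P l, y) \<in> E" "(p, y) \<in> E"
    and dy: "W y \<inter> (U \<union> (\<Union>i\<le>l. V (P i)) \<union> (\<Union>i<l. W (Y i))) = {}"
    and dp: "V p \<inter> (U \<union> (\<Union>i\<le>l. V (P i)) \<union> (\<Union>i<l. W (Y i)) \<union> W y) = {}"
  shows "zigzag E V W U (Suc l) (P(Suc l := p)) (Y(l := y))"
proof -
  have *: "W y \<inter> U = {}" "\<And>i. i \<le> l \<Longrightarrow> V (P i) \<inter> W y = {}" "\<And>i. i < l \<Longrightarrow> W (Y i) \<inter> W y = {}"
    "\<And>i. i < l \<Longrightarrow> W y \<inter> W (Y i) = {}"
    "V p \<inter> U = {}" "\<And>i. i \<le> l \<Longrightarrow> V (P i) \<inter> V p = {}" "\<And>i. i < l \<Longrightarrow> V p \<inter> W (Y i) = {}"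
    "\<And>i. i \<le> l \<Longrightarrow> V p \<inter> V (P i) = {}" "V p \<inter> W y = {}"
    using dy dp by blast+
  show ?thesis
    using z e unfolding zigzag_def by (auto simp: less_Suc_eq le_Suc_eq * )
qed

text \<open>In a subgraph with left degrees above \<open>N * a\<close> and right degrees above
  \<open>N * c\<close>, at most \<open>N\<close> forbidden vertices never block all neighbours of a
  node. A zigzag of \<open>l\<close> steps occupies at most
  \<open>4 * (l + 1) + 2 * l = 6 * l + 4\<close> vertices, which explains the budget. The node
  \<open>y0\<close> is fixed before \<open>U\<close>, since in some applications \<open>U\<close>
  contains a vertex recorded in \<open>y0\<close>.\<close>

lemma exists_zigzag:
  fixes E :: "('p \<times> 'q) set" and V :: "'p \<Rightarrow> 'v set" and W :: "'q \<Rightarrow> 'v set"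
  assumes fin: "finite E"
    and V: "\<And>p. finite (V p) \<and> card (V p) \<le> 4" and W: "\<And>y. finite (W y) \<and> card (W y) \<le> 2"
    and a: "\<And>p z. card {y. (p, y) \<in> E \<and> z \<in> W y} \<le> a"
    and c: "\<And>y z. card {p. (p, y) \<in> E \<and> z \<in> V p} \<le> c"
    and big: "N * a * card (fst ` E) + N * c * card (snd ` E) < card E"
  shows "\<exists>y0. y0 \<in> snd ` E \<and> (\<forall>U l. finite U \<longrightarrow> card U + 6 * l + 4 \<le> N \<longrightarrow>
           (\<exists>P Y. (P 0, y0) \<in> E \<and> zigzag E V W U l P Y))"
proof -
  obtain E' where E': "E' \<subseteq> E" "E' \<noteq> {}"
    "\<And>p y. (p, y) \<in> E' \<Longrightarrow> N * a < card {y. (p, y) \<in> E'}"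
    "\<And>p y. (p, y) \<in> E' \<Longrightarrow> N * c < card {p. (p, y) \<in> E'}"
    by (rule bipartite_min_degree_subgraph[OF fin big]) blast
  have finP: "finite {p. (p, y) \<in> E}" for y
    by (rule finite_subset[of _ "fst ` E"]) (use fin in force)+
  have finY: "finite {y. (p, y) \<in> E}" for p
    by (rule finite_subset[of _ "snd ` E"]) (use fin in force)+
  have stepY: "\<exists>y. (p, y) \<in> E' \<and> W y \<inter> U = {}"
    if "(p, y') \<in> E'" "finite U" "card U \<le> N" for p y' U
  proof -
    have "\<exists>y \<in> {y. (p, y) \<in> E'}. W y \<inter> U = {}"
    proof (rule exists_avoiding[where a = a])
      show "finite {y. (p, y) \<in> E'}" by (rule finite_subset[OF _ finY[of p]]) (use E'(1) in blast)
      show "finite U" by fact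
      show "card {y \<in> {y. (p, y) \<in> E'}. z \<in> W y} \<le> a" for z
      proof -
        have "card {y \<in> {y. (p, y) \<in> E'}. z \<in> W y} \<le> card {y. (p, y) \<in> E \<and> z \<in> W y}"
          using E'(1) by (intro card_mono finite_subset[OF _ finY[of p]]) blast+
        then show ?thesis using a[of p z] by simp
      qed
      show "card U * a < card {y. (p, y) \<in> E'}"
        using E'(3)[OF that(1)] mult_le_mono1[OF that(3), of a] by linarith
    qed
    then show ?thesis by blast
  qed
  have stepP: "\<exists>p. (p, y) \<in> E' \<and> V p \<inter> U = {}"
    if "(p', y) \<in> E'" "finite U" "card U \<le> N" for p' y U
  proof -
    have "\<exists>p \<in> {p. (p, y) \<in> E'}. V p \<inter> U = {}"
    proof (rule exists_avoiding[where a = c])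
      show "finite {p. (p, y) \<in> E'}" by (rule finite_subset[OF _ finP[of y]]) (use E'(1) in blast)
      show "finite U" by fact
      show "card {p \<in> {p. (p, y) \<in> E'}. z \<in> V p} \<le> c" for z
      proof -
        have "card {p \<in> {p. (p, y) \<in> E'}. z \<in> V p} \<le> card {p. (p, y) \<in> E \<and> z \<in> V p}"
          using E'(1) by (intro card_mono finite_subset[OF _ finP[of y]]) blast+
        then show ?thesis using c[of y z] by simp
      qed
      show "card U * c < card {p. (p, y) \<in> E'}"
        using E'(4)[OF that(1)] mult_le_mono1[OF that(3), of c] by linarith
    qed
    then show ?thesis by blast
  qed
  obtain p0 y0 where 0: "(p0, y0) \<in> E'" using E'(2) by auto
  \<comment> \<open>The edge at \<open>P l\<close> is carried along because it shows that
    \<open>P l\<close> is a node of \<open>E'\<close>; so its degree in \<open>E'\<close> is large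
    and the zigzag can be continued.\<close>
  have "\<exists>P Y. (P 0, y0) \<in> E' \<and> zigzag E' V W U l P Y \<and> (\<exists>y. (P l, y) \<in> E')"
    if U: "finite U" "card U + 6 * l + 4 \<le> N" for U l
    using U(2)
  proof (induction l)
    case 0
    obtain p where p: "(p, y0) \<in> E'" "V p \<inter> U = {}"
      using stepP[OF \<open>(p0, y0) \<in> E'\<close> U(1)] 0 by auto
    then show ?case
      by (intro exI[of _ "\<lambda>_. p"]) (auto simp: zigzag_def)
  next
    case (Suc l)
    then obtain P Y y' where PY: "(P 0, y0) \<in> E'" "zigzag E' V W U l P Y" "(P l, y') \<in> E'" by auto
    define U' where "U' = U \<union> (\<Union>i\<le>l. V (P i)) \<union> (\<Union>i<l. W (Y i))"
    have finU': "finite U'" using U V W by (auto simp: U'_def)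
    have "card U' \<le> card U + card (\<Union>i\<le>l. V (P i)) + card (\<Union>i<l. W (Y i))"
      unfolding U'_def using card_Un_le[of "U \<union> (\<Union>i\<le>l. V (P i))" "\<Union>i<l. W (Y i)"]
        card_Un_le[of U "\<Union>i\<le>l. V (P i)"] by linarith
    moreover have "card (\<Union>i\<le>l. V (P i)) \<le> (\<Sum>i\<le>l. 4)"
      using card_UN_le[of "{..l}" "\<lambda>i. V (P i)"] V sum_mono[of "{..l}" "\<lambda>i. card (V (P i))" "\<lambda>_. 4"] by force
    moreover have "card (\<Union>i<l. W (Y i)) \<le> (\<Sum>i<l. 2)"
      using card_UN_le[of "{..<l}" "\<lambda>i. W (Y i)"] W sum_mono[of "{..<l}" "\<lambda>i. card (W (Y i))" "\<lambda>_. 2"] by force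
    ultimately have cU': "card U' \<le> card U + 6 * l + 4" by simp
    obtain y where y: "(P l, y) \<in> E'" "W y \<inter> U' = {}"
      using stepY[OF PY(3) finU'] cU' Suc.prems by auto
    have "card (U' \<union> W y) \<le> card U + 6 * l + 4 + 2"
      using card_Un_le[of U' "W y"] cU' W[of y] by linarith
    then obtain p where p: "(p, y) \<in> E'" "V p \<inter> (U' \<union> W y) = {}"
      using stepP[OF y(1), of "U' \<union> W y"] finU' W[of y] Suc.prems by auto
    have "zigzag E' V W U (Suc l) (P(Suc l := p)) (Y(l := y))"
      by (rule zigzag_extend[OF PY(2) y(1) p(1) y(2)[unfolded U'_def] p(2)[unfolded U'_def]])
    moreover have "((P(Suc l := p)) 0, y0) \<in> E'" "((P(Suc l := p)) (Suc l), y) \<in> E'"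
      using PY(1) p(1) by simp_all
    ultimately show ?case by blast
  qed
  then have "\<exists>P Y. (P 0, y0) \<in> E \<and> zigzag E V W U l P Y"
    if "finite U" "card U + 6 * l + 4 \<le> N" for U l
    using that E'(1) zigzag_mono[OF _ E'(1)] by (metis subsetD)
  moreover have "y0 \<in> snd ` E" using E'(1) 0 by force
  ultimately show ?thesis by blast
qed

section \<open>Subdivided wheels from zigzags\<close>

text \<open>The hub is \<open>v\<close>, the vertices of the rim are \<open>a i\<close>; \<open>p i\<close> and \<open>b i\<close> subdivide the spokes and
  the edges of the rim.\<close>

definition has_wheel :: "('a \<Rightarrow> 'a \<Rightarrow> bool) \<Rightarrow> nat \<Rightarrow> bool" where
  "has_wheel adj k \<longleftrightarrow> (\<exists>v a p b.
     (\<forall>i<k. adj v (p i) \<and> adj (p i) (a i) \<and> adj (a i) (b i) \<and> adj (b i) (a (Suc i mod k))) \<and>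
     (\<forall>i<k. v \<noteq> a i \<and> v \<noteq> p i \<and> v \<noteq> b i) \<and>
     (\<forall>i<k. \<forall>j<k. a i \<noteq> p j \<and> a i \<noteq> b j \<and> p i \<noteq> b j) \<and>
     (\<forall>i<k. \<forall>j<k. i \<noteq> j \<longrightarrow> a i \<noteq> a j \<and> p i \<noteq> p j \<and> b i \<noteq> b j))"

text \<open>The closing edge of the rim is a separate condition, so that no \<open>mod\<close>
  appears, and by symmetry distinctness is asked only for \<open>i < j\<close>.\<close>

lemma has_wheelI:
  assumes "\<And>i. i \<le> m \<Longrightarrow> adj v (p i) \<and> adj (p i) (a i) \<and> adj (a i) (b i)"
    and "\<And>i. i < m \<Longrightarrow> adj (b i) (a (Suc i))" "adj (b m) (a 0)"
    and "\<And>i. i \<le> m \<Longrightarrow> v \<noteq> a i \<and> v \<noteq> p i \<and> v \<noteq> b i"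
    and "\<And>i j. i \<le> m \<Longrightarrow> j \<le> m \<Longrightarrow> a i \<noteq> p j \<and> a i \<noteq> b j \<and> p i \<noteq> b j"
    and "\<And>i j. i < j \<Longrightarrow> j \<le> m \<Longrightarrow> a i \<noteq> a j \<and> p i \<noteq> p j \<and> b i \<noteq> b j"
  shows "has_wheel adj (Suc m)"
proof -
  have "adj (b i) (a (Suc i mod Suc m))" if "i < Suc m" for i
    using that assms(2)[of i] assms(3) by (cases "i = m") auto
  moreover have "a i \<noteq> a j \<and> p i \<noteq> p j \<and> b i \<noteq> b j" if "i < Suc m" "j < Suc m" "i \<noteq> j" for i j
    using that assms(6)[of i j] assms(6)[of j i] by (cases i j rule: linorder_cases) force+
  ultimately show ?thesis
    unfolding has_wheel_def
    using assms(1,4,5)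
    by (intro exI[of _ v] exI[of _ a] exI[of _ p] exI[of _ b]) (auto simp: less_Suc_eq_le)
qed

section \<open>Light pairs, light paths and arcs in a host graph\<close>

locale simple_graph =
  fixes adj :: "'a \<Rightarrow> 'a \<Rightarrow> bool" and V :: "'a set" and t :: nat
  assumes finV: "finite V" and adj_sym: "adj x y \<Longrightarrow> adj y x"
    and adj_irrefl: "\<not> adj x x" and adj_V: "adj x y \<Longrightarrow> x \<in> V"
begin

lemma adj_V': "adj x y \<Longrightarrow> x \<in> V \<and> y \<in> V"
  using adj_V adj_sym by blast

lemma adj_neq: "adj x y \<Longrightarrow> x \<noteq> y"
  using adj_irrefl by blast

lemma adj_commute: "adj x y \<longleftrightarrow> adj y x"
  using adj_sym by blast

definition nbrs :: "'a \<Rightarrow> 'a set" where "nbrs x = {y. adj x y}"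

lemma nbrs_subset: "nbrs x \<subseteq> V"
  using adj_V' by (auto simp: nbrs_def)

lemma finite_nbrs [simp, intro]: "finite (nbrs x)"
  using nbrs_subset finV finite_subset by blast

text \<open>\<open>t\<close> is the threshold between light and heavy pairs. A vertex is neither
  light nor heavy to itself, so lightness also supplies distinctness.\<close>

definition light :: "'a \<Rightarrow> 'a \<Rightarrow> bool" where
  "light x y \<longleftrightarrow> x \<noteq> y \<and> card (nbrs x \<inter> nbrs y) < t"

definition heavy :: "'a \<Rightarrow> 'a \<Rightarrow> bool" where
  "heavy x y \<longleftrightarrow> x \<noteq> y \<and> t \<le> card (nbrs x \<inter> nbrs y)"

lemma light_sym: "light x y \<longleftrightarrow> light y x"
  by (auto simp: light_def Int_commute)

lemma light_neq: "light x y \<Longrightarrow> x \<noteq> y"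
  by (auto simp: light_def)

text \<open>Made empty for pairs that are not light, so that its size is at most \<open>t\<close>
  for every pair; this saves side conditions in the counting.\<close>

definition common :: "'a \<Rightarrow> 'a \<Rightarrow> 'a set" where
  "common x y = (if light x y then nbrs x \<inter> nbrs y else {})"

lemma finite_common [simp, intro]: "finite (common x y)"
  by (auto simp: common_def)

lemma card_common: "card (common x y) \<le> t"
  by (auto simp: common_def light_def)

lemma commonI: "light x y \<Longrightarrow> adj x z \<Longrightarrow> adj z y \<Longrightarrow> z \<in> common x y"
  by (auto simp: common_def nbrs_def adj_commute)

text \<open>The four vertices are distinct, as neighbours differ, light pairs differ and
  \<open>v \<noteq> b\<close>. Inside a wheel, \<open>v\<close> is the hub, \<open>p\<close> a spoke
  vertex, \<open>u\<close> a rim vertex and \<open>b\<close> a subdivision vertex of the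
  rim.\<close>

definition light_path :: "'a \<Rightarrow> 'a \<Rightarrow> 'a \<Rightarrow> 'a \<Rightarrow> bool" where
  "light_path v p u b \<longleftrightarrow> adj v p \<and> adj p u \<and> adj u b \<and> v \<noteq> b \<and> light v u \<and> light p b"

definition paths :: "'a \<Rightarrow> 'a \<Rightarrow> ('a \<times> 'a) set" where
  "paths x z = {(b, u). light_path x b u z}"

lemma paths_subset: "paths x z \<subseteq> V \<times> V"
  using adj_V' by (auto simp: paths_def light_path_def)

lemma finite_paths [simp, intro]: "finite (paths x z)"
  using paths_subset finV finite_subset by blast

text \<open>One step along the rim of a wheel with hub \<open>v\<close>: from the rim vertex
  \<open>u\<close> with spoke vertex \<open>p\<close> through \<open>b\<close> to the rim vertex
  \<open>u'\<close> with spoke vertex \<open>p'\<close>. That \<open>p\<close> and \<open>p'\<close>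
  differ has to come from the disjointness in a zigzag.\<close>

definition arc :: "'a \<Rightarrow> 'a \<Rightarrow> 'a \<Rightarrow> 'a \<Rightarrow> 'a \<Rightarrow> 'a \<Rightarrow> bool" where
  "arc v p u b p' u' \<longleftrightarrow> light_path v p u b \<and> light_path v p' u' b \<and> light u u' \<and> u \<noteq> p' \<and> u' \<noteq> p"

lemma arc_sym: "arc v p u b p' u' \<longleftrightarrow> arc v p' u' b p u"
  by (auto simp: arc_def light_sym)

lemma light_pathD:
  assumes "light_path v p u b"
  shows "adj v p" "adj p u" "adj u b" "adj b u" "v \<noteq> b" "light v u" "light p b"
    "v \<noteq> p" "v \<noteq> u" "p \<noteq> u" "p \<noteq> b" "u \<noteq> b"
    "p \<in> common v u" "u \<in> common p b"
  using assms adj_neq light_neq by (auto simp: light_path_def adj_commute intro!: commonI)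

text \<open>In the next four lemmas the first and the last walk of the zigzag branch at the subdivision vertex
  \<open>b'\<close> or at the vertex \<open>x\<close> of the rim; the zigzag uses the third (short) or the fourth (long) level of
  the exploration.\<close>

lemma wheel_rooted_at_middle_short:
  assumes fin: "finite E"
    and E: "\<And>b' p' u' c b. ((b', p', u'), (c, b)) \<in> E \<Longrightarrow>
        c = b' \<and> light_path v p' u' b' \<and> light_path v p' u' b"
    and big: "N * 1 * card (fst ` E) + N * (2 * t) * card (snd ` E) < card E"
    and N: "6 * l + 6 \<le> N"
  shows "has_wheel adj (Suc l)"
proof -
  define VP :: "'a \<times> 'a \<times> 'a \<Rightarrow> 'a set" where "VP = (\<lambda>(b', p', u'). {p', u'})"
  define VY :: "'a \<times> 'a \<Rightarrow> 'a set" where "VY = (\<lambda>(c, b). {b})"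
  have "\<exists>y0. y0 \<in> snd ` E \<and> (\<forall>U l. finite U \<longrightarrow> card U + 6 * l + 4 \<le> N \<longrightarrow>
           (\<exists>P Y. (P 0, y0) \<in> E \<and> zigzag E VP VY U l P Y))"
  proof (rule exists_zigzag[OF fin _ _ _ _ big])
    show "finite (VP p) \<and> card (VP p) \<le> 4" for p
      by (cases p) (auto simp: VP_def card_insert_if)
    show "finite (VY p) \<and> card (VY p) \<le> 2" for p
      by (cases p) (auto simp: VY_def card_insert_if)
    show "card {y. (p, y) \<in> E \<and> z \<in> VY y} \<le> 1" for p z
    proof -
      obtain b' p' u' where p: "p = (b', p', u')" by (cases p) auto
      have "{y. (p, y) \<in> E \<and> z \<in> VY y} \<subseteq> {(b', z)}"
        using E unfolding p by (auto simp: VY_def)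
      from card_mono[OF _ this] show ?thesis by simp
    qed
    \<comment> \<open>The node \<open>y\<close> determines \<open>b' = c\<close>. If
      \<open>z = p'\<close>, then \<open>u'\<close> is a common neighbour of \<open>z\<close> and
      \<open>c\<close>; if \<open>z = u'\<close>, then \<open>p'\<close> is one of \<open>v\<close>
      and \<open>z\<close>.\<close>
    show "card {p. (p, y) \<in> E \<and> z \<in> VP p} \<le> 2 * t" for y z
    proof -
      obtain c b where y: "y = (c, b)" by force
      have "p \<in> (\<lambda>u'. (c, z, u')) ` common z c \<union> (\<lambda>p'. (c, p', z)) ` common v z"
        if "(p, y) \<in> E" "z \<in> VP p" for p
      proof -
        obtain b' p' u' where p: "p = (b', p', u')" by (cases p) auto
        have "c = b'" "light_path v p' u' b'" using E that unfolding p y by auto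
        then show ?thesis using that(2) light_pathD(13,14)[of v p' u' b']
          unfolding p VP_def by auto
      qed
      then have "card {p. (p, y) \<in> E \<and> z \<in> VP p} \<le>
          card ((\<lambda>u'. (c, z, u')) ` common z c \<union> (\<lambda>p'. (c, p', z)) ` common v z)"
        by (intro card_mono) auto
      also have "\<dots> \<le> card ((\<lambda>u'. (c, z, u')) ` common z c) + card ((\<lambda>p'. (c, p', z)) ` common v z)"
        by (rule card_Un_le)
      also have "\<dots> \<le> card (common z c) + card (common v z)"
        by (intro add_mono card_image_le) auto
      finally show ?thesis using card_common[of z c] card_common[of v z] by linarith
    qed
  qed
  then obtain y0 where y0: "\<And>U l. finite U \<Longrightarrow> card U + 6 * l + 4 \<le> N \<Longrightarrow>
           (\<exists>P Y. (P 0, y0) \<in> E \<and> zigzag E VP VY U l P Y)" by blast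
  obtain c b0 where "y0 = (c, b0)" by force
  note * = y0[unfolded this]
  \<comment> \<open>All nodes of the zigzag share the vertex \<open>b' = c\<close> that
    \<open>y0\<close> records. So \<open>c\<close> is forbidden for the zigzag and afterwards closes
    it to the rim \<open>a 0, b 0, a 1, ..., a l, c\<close>.\<close>
  have "card {v, c} + 6 * l + 4 \<le> N"
    using N by (auto simp: card_insert_if)
  from *[OF _ this] obtain P Y where P0: "(P 0, (c, b0)) \<in> E" and zz: "zigzag E VP VY {v, c} l P Y"
    by auto
  define p where "p i = fst (snd (P i))" for i
  define a where "a i = snd (snd (P i))" for i
  define b where "b i = (if i < l then snd (Y i) else c)" for i
  have Pi: "P i = (fst (P i), p i, a i)" for i by (simp add: p_def a_def)
  have Yi: "Y i = (fst (Y i), b i)" if "i < l" for i using that by (simp add: b_def)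
  have e1: "fst (Y i) = fst (P i) \<and> light_path v (p i) (a i) (b i)" if "i < l" for i
    using zigzagD(1)[OF zz that] E Pi[of i] Yi[OF that] by metis
  have e2: "fst (Y i) = fst (P (Suc i)) \<and> light_path v (p (Suc i)) (a (Suc i)) (fst (P (Suc i))) \<and>
      light_path v (p (Suc i)) (a (Suc i)) (b i)" if "i < l" for i
    using zigzagD(2)[OF zz that] E Pi[of "Suc i"] Yi[OF that] by metis
  have e0: "c = fst (P 0)" "light_path v (p 0) (a 0) c"
    using P0 E Pi[of 0] by metis+
  have fP: "i \<le> l \<Longrightarrow> fst (P i) = c" for i
    by (induction i) (use e1 e2 e0 in auto)
  have lp: "light_path v (p i) (a i) c" if "i \<le> l" for i
    using that e0 e2[of "i - 1"] fP[of i] by (cases i) auto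
  have VPi: "VP (P i) = {p i, a i}" for i by (subst Pi) (simp add: VP_def)
  have VYi: "VY (Y i) = {b i}" if "i < l" for i by (subst Yi[OF that]) (simp add: VY_def)
  note z = zigzagD(3-7)[OF zz, unfolded VPi]
  have dUY: "b i \<noteq> v \<and> b i \<noteq> c" if "i < l" for i
    using z(2)[OF that] VYi[OF that] by auto
  have dY: "b i \<noteq> b j" if "i < l" "j < l" "i \<noteq> j" for i j
    using z(4)[OF that] VYi that by auto
  have dPY: "p i \<noteq> b j \<and> a i \<noteq> b j" if "i \<le> l" "j < l" for i j
    using z(5)[OF that] VYi that by auto
  have bl: "b l = c" by (simp add: b_def)
  show ?thesis
  proof (rule has_wheelI[where v = v and a = a and p = p and b = b])
    show "adj v (p i) \<and> adj (p i) (a i) \<and> adj (a i) (b i)" if "i \<le> l" for i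
      using that e1[of i] lp[of i] bl by (cases "i = l") (auto simp: light_path_def)
    show "adj (b i) (a (Suc i))" if "i < l" for i
      using e2[OF that] light_pathD by blast
    show "adj (b l) (a 0)" using light_pathD[OF lp[of 0]] bl by auto
    show "v \<noteq> a i \<and> v \<noteq> p i \<and> v \<noteq> b i" if "i \<le> l" for i
      using z(1)[OF that] dUY[of i] bl light_pathD(5)[OF lp[OF that]] that by (cases "i = l") auto
    show "a i \<noteq> p j \<and> a i \<noteq> b j \<and> p i \<noteq> b j" if "i \<le> l" "j \<le> l" for i j
      using that z(3)[of i j] dPY[of i j] z(1)[of i] bl light_pathD(10)[OF lp, of i]
      by (cases "j = l"; cases "i = j") auto
    show "a i \<noteq> a j \<and> p i \<noteq> p j \<and> b i \<noteq> b j" if "i < j" "j \<le> l" for i j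
      using that z(3)[of i j] dY[of i j] dUY[of i] bl by (cases "j = l") auto
  qed
qed

lemma wheel_rooted_at_end_short:
  assumes fin: "finite E"
    and E: "\<And>b' p' u' b. ((b', p', u'), b) \<in> E \<Longrightarrow> arc v p0 x b' p' u' \<and> light_path v p' u' b"
    and S: "\<And>b z. card {r. (r, b) \<in> E \<and> fst r = z} \<le> S"
    and big: "N * 1 * card (fst ` E) + N * (S + 2 * t * t) * card (snd ` E) < card E"
    and N: "6 * l + 7 \<le> N" and l: "l > 0"
  shows "has_wheel adj (Suc (Suc l))"
proof -
  define VP :: "'a \<times> 'a \<times> 'a \<Rightarrow> 'a set" where "VP = (\<lambda>(b', p', u'). {b', p', u'})"
  define VY :: "'a \<Rightarrow> 'a set" where "VY = (\<lambda>b. {b})"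
  have "\<exists>y0. y0 \<in> snd ` E \<and> (\<forall>U l. finite U \<longrightarrow> card U + 6 * l + 4 \<le> N \<longrightarrow>
           (\<exists>P Y. (P 0, y0) \<in> E \<and> zigzag E VP VY U l P Y))"
  proof (rule exists_zigzag[OF fin _ _ _ _ big])
    show "finite (VP p) \<and> card (VP p) \<le> 4" for p
      by (cases p) (auto simp: VP_def card_insert_if)
    show "finite (VY p) \<and> card (VY p) \<le> 2" for p
      by (auto simp: VY_def)
    show "card {y. (p, y) \<in> E \<and> z \<in> VY y} \<le> 1" for p z
    proof -
      have "{y. (p, y) \<in> E \<and> z \<in> VY y} \<subseteq> {z}" by (auto simp: VY_def)
      from card_mono[OF _ this] show ?thesis by simp
    qed
    show "card {p. (p, b) \<in> E \<and> z \<in> VP p} \<le> S + 2 * t * t" for b z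
    proof -
      \<comment> \<open>\<open>A1\<close>, \<open>A2\<close> and \<open>A3\<close> collect the walks
        in which \<open>z\<close> plays the role of \<open>b'\<close>, \<open>u'\<close> and
        \<open>p'\<close>. In the last two cases the other vertices are common neighbours of light
        pairs; the first case is controlled by \<open>S\<close>.\<close>
      define A1 where "A1 = {r. (r, b) \<in> E \<and> fst r = z}"
      define A2 where "A2 = (\<lambda>(b', p'). (b', p', z)) ` (common x z \<times> common v z)"
      define A3 where "A3 = (\<lambda>(u', b'). (b', z, u')) ` (SIGMA u' : common z b. common x u')"
      have fA1: "finite A1"
        by (rule finite_subset[of _ "fst ` E"]) (use fin in \<open>force simp: A1_def\<close>)+
      have fA: "finite A2" "finite A3" by (auto simp: A2_def A3_def)
      have "r \<in> A1 \<union> A2 \<union> A3" if "(r, b) \<in> E" "z \<in> VP r" for r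
      proof -
        obtain b' p' u' where r: "r = (b', p', u')" by (cases r) auto
        have *: "arc v p0 x b' p' u'" "light_path v p' u' b" using E that unfolding r by auto
        have "b' \<in> common x u'" using *(1) by (intro commonI) (auto simp: arc_def dest: light_pathD)
        moreover have "p' \<in> common v u'" "u' \<in> common p' b" using light_pathD[OF *(2)] by auto
        moreover have "z = b' \<or> z = p' \<or> z = u'" using that unfolding r VP_def by auto
        ultimately show ?thesis using that(1) unfolding r A1_def A2_def A3_def by (auto simp: image_iff)
      qed
      then have "card {p. (p, b) \<in> E \<and> z \<in> VP p} \<le> card (A1 \<union> A2 \<union> A3)"
        using fA1 fA by (intro card_mono) auto
      also have "\<dots> \<le> card A1 + card A2 + card A3"
        using card_Un_le[of "A1 \<union> A2" A3] card_Un_le[of A1 A2] by linarith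
      also have "card A2 \<le> t * t"
        unfolding A2_def by (intro order_trans[OF card_image_le] order_trans[OF eq_refl[OF card_cartesian_product]] mult_mono)
          (auto simp: card_common)
      also have "card A3 \<le> t * t"
        unfolding A3_def
        by (intro order_trans[OF card_image_le] card_le_Sigma[where f = id and J = "common z b" and Y = "common x"])
          (auto simp: card_common)
      also have "card A1 \<le> S" unfolding A1_def by (rule S)
      finally show ?thesis by simp
    qed
  qed
  then obtain y0 where y0: "\<And>U l. finite U \<Longrightarrow> card U + 6 * l + 4 \<le> N \<Longrightarrow>
           (\<exists>P Y. (P 0, y0) \<in> E \<and> zigzag E VP VY U l P Y)" by blast
  have "card {v, p0, x} + 6 * l + 4 \<le> N"
    using N by (auto simp: card_insert_if)
  from y0[OF _ this] obtain P Y where zz: "zigzag E VP VY {v, p0, x} l P Y"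
    by auto
  define B' where "B' i = fst (P i)" for i
  define p' where "p' i = fst (snd (P i))" for i
  define u' where "u' i = snd (snd (P i))" for i
  have Pi: "P i = (B' i, p' i, u' i)" for i by (simp add: p'_def u'_def B'_def)
  have e1: "arc v p0 x (B' i) (p' i) (u' i) \<and> light_path v (p' i) (u' i) (Y i)" if "i < l" for i
    using zigzagD(1)[OF zz that] E Pi[of i] by metis
  have e2: "arc v p0 x (B' (Suc i)) (p' (Suc i)) (u' (Suc i)) \<and> light_path v (p' (Suc i)) (u' (Suc i)) (Y i)"
    if "i < l" for i
    using zigzagD(2)[OF zz that] E Pi[of "Suc i"] by metis
  have ar: "arc v p0 x (B' i) (p' i) (u' i)" if "i \<le> l" for i
    using that e1[of 0] e2[of "i - 1"] l by (cases i) auto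
  have lp: "light_path v p0 x (B' i)" "light_path v (p' i) (u' i) (B' i)" if "i \<le> l" for i
    using ar[OF that] by (auto simp: arc_def)
  have VPi: "VP (P i) = {B' i, p' i, u' i}" for i by (subst Pi) (simp add: VP_def)
  note z = zigzagD(3-7)[OF zz, unfolded VPi VY_def]
  \<comment> \<open>The rim runs \<open>x, B' 0, u' 0, Y 0, u' 1, ..., u' l, B' l\<close> and back
    to \<open>x\<close>: both ends of the zigzag reach \<open>x\<close> through their own vertex
    \<open>B'\<close>. This gives \<open>l + 2\<close> rim vertices.\<close>
  define a where "a i = (if i = 0 then x else u' (i - 1))" for i
  define p where "p i = (if i = 0 then p0 else p' (i - 1))" for i
  define b where "b i = (if i = 0 then B' 0 else if i \<le> l then Y (i - 1) else B' l)" for i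
  have kinds: "B' i \<noteq> p' j \<and> B' i \<noteq> u' j \<and> p' j \<noteq> B' i \<and> u' j \<noteq> B' i \<and> p' i \<noteq> u' j \<and> u' j \<noteq> p' i"
    if "i \<le> l" "j \<le> l" for i j
    using light_pathD(10,11,12)[OF lp(2)[OF that(1)]] z(3)[of i j] that by (cases "i = j") auto
  have kinds': "B' i \<noteq> Y j \<and> p' i \<noteq> Y j \<and> u' i \<noteq> Y j \<and> Y j \<noteq> B' i \<and> Y j \<noteq> p' i \<and> Y j \<noteq> u' i"
    if "i \<le> l" "j < l" for i j
    using z(5)[of i j] that by auto
  have same: "B' i \<noteq> B' j \<and> p' i \<noteq> p' j \<and> u' i \<noteq> u' j" if "i < j" "j \<le> l" for i j
    using z(3)[of i j] that by auto
  have same': "Y i \<noteq> Y j" if "i < j" "j < l" for i j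
    using z(4)[of i j] that by auto
  have root: "v \<noteq> p0" "p0 \<noteq> v" "v \<noteq> x" "x \<noteq> v" "p0 \<noteq> x" "x \<noteq> p0"
    using light_pathD[OF lp(1)[of 0]] by auto
  have out: "v \<noteq> B' i \<and> v \<noteq> p' i \<and> v \<noteq> u' i \<and> p0 \<noteq> B' i \<and> p0 \<noteq> p' i \<and> p0 \<noteq> u' i \<and>
      x \<noteq> B' i \<and> x \<noteq> p' i \<and> x \<noteq> u' i \<and> B' i \<noteq> p0 \<and> p' i \<noteq> p0 \<and> u' i \<noteq> p0 \<and>
      B' i \<noteq> x \<and> p' i \<noteq> x \<and> u' i \<noteq> x" if "i \<le> l" for i
    using z(1)[OF that] by auto
  have out': "v \<noteq> Y i \<and> p0 \<noteq> Y i \<and> x \<noteq> Y i" if "i < l" for i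
    using z(2)[OF that] by auto
  show ?thesis
  proof (rule has_wheelI[where v = v and a = a and p = p and b = b])
    show "adj v (p i) \<and> adj (p i) (a i) \<and> adj (a i) (b i)" if "i \<le> Suc l" for i
    proof -
      have "(i = 0) \<or> (0 < i \<and> i - 1 < l) \<or> (i = Suc l)"
        using that by arith
      then consider "i = 0" | "0 < i" "i - 1 < l" | "i = Suc l" by blast
      then show ?thesis
        using light_pathD[OF lp(1)[of 0]] light_pathD[OF lp(2)[of l]] e1[of "i - 1"] light_pathD
        by cases (auto simp: a_def p_def b_def)
    qed
    show "adj (b i) (a (Suc i))" if "i < Suc l" for i
      using that e2[of "i - 1"] light_pathD(4)[OF lp(2)[of 0]] light_pathD(4)
      by (cases i) (auto simp: a_def b_def)
    show "adj (b (Suc l)) (a 0)"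
      using light_pathD[OF lp(1)[of l]] by (auto simp: a_def b_def)
    show "v \<noteq> a i \<and> v \<noteq> p i \<and> v \<noteq> b i" if "i \<le> Suc l" for i
      using that root out[of "i - 1"] out'[of "i - 1"] out[of 0] out[of l] by (auto simp: a_def p_def b_def)
    show "a i \<noteq> p j \<and> a i \<noteq> b j \<and> p i \<noteq> b j" if "i \<le> Suc l" "j \<le> Suc l" for i j
      using that l root out[of "i - 1"] out[of "j - 1"] out'[of "j - 1"] out[of 0] out[of l]
        kinds[of 0 "i - 1"] kinds[of l "i - 1"] kinds[of "j - 1" "i - 1"] kinds'[of "i - 1" "j - 1"]
      by (auto simp: a_def p_def b_def)
    show "a i \<noteq> a j \<and> p i \<noteq> p j \<and> b i \<noteq> b j" if "i < j" "j \<le> Suc l" for i j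
      using that l root out[of "j - 1"] same[of "i - 1" "j - 1"] same[of 0 l] same'[of "i - 1" "j - 1"]
        kinds'[of 0 "j - 1"] kinds'[of l "i - 1"]
      by (auto simp: a_def p_def b_def)
  qed
qed

lemma wheel_rooted_at_middle_long:
  assumes fin: "finite E"
    and E: "\<And>b' p' u' b c p u. (((b', p', u'), b), (c, p, u)) \<in> E \<Longrightarrow>
        c = b' \<and> light_path v p' u' b' \<and> arc v p' u' b p u"
    and S: "\<And>y z. card {r. (r, y) \<in> E \<and> snd r = z} \<le> S"
    and big: "N * (2 * t) * card (fst ` E) + N * (S + 2 * t * t) * card (snd ` E) < card E"
    and N: "6 * l + 6 \<le> N" and l: "l > 0"
  shows "has_wheel adj (Suc (Suc l))"
proof -
  define VP :: "('a \<times> 'a \<times> 'a) \<times> 'a \<Rightarrow> 'a set" where "VP = (\<lambda>((b', p', u'), b). {p', u', b})"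
  define VY :: "'a \<times> 'a \<times> 'a \<Rightarrow> 'a set" where "VY = (\<lambda>(c, p, u). {p, u})"
  have "\<exists>y0. y0 \<in> snd ` E \<and> (\<forall>U l. finite U \<longrightarrow> card U + 6 * l + 4 \<le> N \<longrightarrow>
           (\<exists>P Y. (P 0, y0) \<in> E \<and> zigzag E VP VY U l P Y))"
  proof (rule exists_zigzag[OF fin _ _ _ _ big])
    show "finite (VP p) \<and> card (VP p) \<le> 4" for p
      by (cases p) (auto simp: VP_def card_insert_if)
    show "finite (VY p) \<and> card (VY p) \<le> 2" for p
      by (cases p) (auto simp: VY_def card_insert_if)
    show "card {y. (r, y) \<in> E \<and> z \<in> VY y} \<le> 2 * t" for r z
    proof -
      obtain b' p' u' b where r: "r = ((b', p', u'), b)" by (metis prod.exhaust)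
      have "y \<in> (\<lambda>u. (b', z, u)) ` common z b \<union> (\<lambda>p. (b', p, z)) ` common v z"
        if "(r, y) \<in> E" "z \<in> VY y" for y
      proof -
        obtain c p u where y: "y = (c, p, u)" by (cases y) auto
        have "c = b'" "light_path v p u b" using E that unfolding r y by (auto simp: arc_def)
        then show ?thesis using that(2) light_pathD(13,14)[of v p u b]
          unfolding y VY_def by auto
      qed
      then have "card {y. (r, y) \<in> E \<and> z \<in> VY y} \<le>
          card ((\<lambda>u. (b', z, u)) ` common z b \<union> (\<lambda>p. (b', p, z)) ` common v z)"
        by (intro card_mono) auto
      also have "\<dots> \<le> card ((\<lambda>u. (b', z, u)) ` common z b) + card ((\<lambda>p. (b', p, z)) ` common v z)"
        by (rule card_Un_le)
      also have "\<dots> \<le> card (common z b) + card (common v z)"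
        by (intro add_mono card_image_le) auto
      finally show ?thesis using card_common[of z b] card_common[of v z] by linarith
    qed
    show "card {r. (r, y) \<in> E \<and> z \<in> VP r} \<le> S + 2 * t * t" for y z
    proof -
      obtain c p u where y: "y = (c, p, u)" by (cases y) auto
      define A1 where "A1 = {r. (r, y) \<in> E \<and> snd r = z}"
      define A2 where "A2 = (\<lambda>(p', b). ((c, p', z), b)) ` (common v z \<times> common z u)"
      define A3 where "A3 = (\<lambda>(u', b). ((c, z, u'), b)) ` (SIGMA u' : common z c. common u' u)"
      have fA1: "finite A1"
        by (rule finite_subset[of _ "fst ` E"]) (use fin in \<open>force simp: A1_def\<close>)+
      have fA: "finite A2" "finite A3" by (auto simp: A2_def A3_def)
      have "r \<in> A1 \<union> A2 \<union> A3" if "(r, y) \<in> E" "z \<in> VP r" for r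
      proof -
        obtain b' p' u' b where r: "r = ((b', p', u'), b)" by (metis prod.exhaust)
        have *: "c = b'" "light_path v p' u' b'" "arc v p' u' b p u" using E that unfolding r y by auto
        have "b \<in> common u' u" using *(3) by (intro commonI) (auto simp: arc_def dest: light_pathD)
        moreover have "p' \<in> common v u'" "u' \<in> common p' c" using light_pathD[OF *(2)] *(1) by auto
        moreover have "z = b \<or> z = p' \<or> z = u'" using that unfolding r VP_def by auto
        ultimately show ?thesis using that(1) *(1) unfolding r A1_def A2_def A3_def by (auto simp: image_iff)
      qed
      then have "card {r. (r, y) \<in> E \<and> z \<in> VP r} \<le> card (A1 \<union> A2 \<union> A3)"
        using fA1 fA by (intro card_mono) auto
      also have "\<dots> \<le> card A1 + card A2 + card A3"
        using card_Un_le[of "A1 \<union> A2" A3] card_Un_le[of A1 A2] by linarith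
      also have "card A2 \<le> t * t"
        unfolding A2_def by (intro order_trans[OF card_image_le] order_trans[OF eq_refl[OF card_cartesian_product]] mult_mono)
          (auto simp: card_common)
      also have "card A3 \<le> t * t"
        unfolding A3_def
        by (intro order_trans[OF card_image_le] card_le_Sigma[where f = id and J = "common z c" and Y = "\<lambda>u'. common u' u"])
          (auto simp: card_common)
      also have "card A1 \<le> S" unfolding A1_def by (rule S)
      finally show ?thesis by simp
    qed
  qed
  then obtain y0 where y0: "\<And>U l. finite U \<Longrightarrow> card U + 6 * l + 4 \<le> N \<Longrightarrow>
           (\<exists>P Y. (P 0, y0) \<in> E \<and> zigzag E VP VY U l P Y)" by blast
  obtain c q where y0c: "y0 = (c, q)" by (rule prod.exhaust)
  have "card {v, c} + 6 * l + 4 \<le> N"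
    using N by (auto simp: card_insert_if)
  from y0[OF _ this] obtain P Y where P0: "(P 0, (c, q)) \<in> E" and zz: "zigzag E VP VY {v, c} l P Y"
    using y0c by auto
  define B' where "B' i = fst (fst (P i))" for i
  define p' where "p' i = fst (snd (fst (P i)))" for i
  define u' where "u' i = snd (snd (fst (P i)))" for i
  define B where "B i = snd (P i)" for i
  define C where "C i = fst (Y i)" for i
  define r where "r i = fst (snd (Y i))" for i
  define u where "u i = snd (snd (Y i))" for i
  have Pi: "P i = ((B' i, p' i, u' i), B i)" for i by (simp add: p'_def u'_def B'_def B_def)
  have Yi: "Y i = (C i, r i, u i)" for i by (simp add: C_def r_def u_def)
  have e1: "C i = B' i \<and> light_path v (p' i) (u' i) (B' i) \<and> arc v (p' i) (u' i) (B i) (r i) (u i)"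
    if "i < l" for i
    using zigzagD(1)[OF zz that] E Pi[of i] Yi[of i] by metis
  have e2: "C i = B' (Suc i) \<and> light_path v (p' (Suc i)) (u' (Suc i)) (B' (Suc i)) \<and>
      arc v (p' (Suc i)) (u' (Suc i)) (B (Suc i)) (r i) (u i)"
    if "i < l" for i
    using zigzagD(2)[OF zz that] E Pi[of "Suc i"] Yi[of i] by metis
  have "c = B' 0"
    using P0 E[of "B' 0" "p' 0" "u' 0" "B 0" c "fst q" "snd q"] Pi[of 0] by simp
  then have Bc: "i \<le> l \<Longrightarrow> B' i = c" for i
    by (induction i) (use e1 e2 in auto)
  have lp: "light_path v (p' i) (u' i) c" if "i \<le> l" for i
    using that e1[of 0] e2[of "i - 1"] Bc[of i] Bc[of 0] l by (cases i) auto
  have lp2: "light_path v (p' i) (u' i) (B i)" if "i \<le> l" for i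
    using that e1[of 0] e2[of "i - 1"] l by (cases i) (auto simp: arc_def)
  have lp3: "light_path v (r i) (u i) (B i)" "light_path v (r i) (u i) (B (Suc i))" if "i < l" for i
    using e1[OF that] e2[OF that] by (auto simp: arc_def)
  have VPi: "VP (P i) = {p' i, u' i, B i}" for i by (subst Pi) (simp add: VP_def)
  have VYi: "VY (Y i) = {r i, u i}" for i by (subst Yi) (simp add: VY_def)
  note z = zigzagD(3-7)[OF zz, unfolded VPi VYi]
  \<comment> \<open>The rim runs \<open>u' 0, B 0, u 0, B 1, ..., u (l - 1), B l, u' l, c\<close>
    and back to \<open>u' 0\<close>. Of the vertices \<open>u' i\<close> only those of the first and
    the last node occur; they are joined through the common vertex \<open>c\<close>.\<close>
  define a where "a i = (if i = 0 then u' 0 else if i \<le> l then u (i - 1) else u' l)" for i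
  define p where "p i = (if i = 0 then p' 0 else if i \<le> l then r (i - 1) else p' l)" for i
  define b where "b i = (if i \<le> l then B i else c)" for i
  have kinds: "p' i \<noteq> u' j \<and> u' j \<noteq> p' i \<and> p' i \<noteq> B j \<and> u' i \<noteq> B j \<and> B j \<noteq> p' i \<and> B j \<noteq> u' i"
    if "i \<le> l" "j \<le> l" for i j
    using light_pathD(10,11,12)[OF lp2[OF that(1)]] z(3)[of i j] that by (cases "i = j") auto
  have kinds': "p' i \<noteq> r j \<and> p' i \<noteq> u j \<and> u' i \<noteq> r j \<and> u' i \<noteq> u j \<and> B i \<noteq> r j \<and> B i \<noteq> u j
      \<and> r j \<noteq> p' i \<and> u j \<noteq> p' i \<and> r j \<noteq> u' i \<and> u j \<noteq> u' i \<and> r j \<noteq> B i \<and> u j \<noteq> B i"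
    if "i \<le> l" "j < l" for i j
    using z(5)[of i j] that by auto
  have kinds'': "r i \<noteq> u j \<and> u j \<noteq> r i" if "i < l" "j < l" for i j
    using light_pathD(10)[OF lp3(1)[OF that(1)]] z(4)[of i j] that by (cases "i = j") auto
  have same: "p' i \<noteq> p' j \<and> u' i \<noteq> u' j \<and> B i \<noteq> B j" if "i < j" "j \<le> l" for i j
    using z(3)[of i j] that by auto
  have same': "r i \<noteq> r j \<and> u i \<noteq> u j" if "i < j" "j < l" for i j
    using z(4)[of i j] that by auto
  have out: "v \<noteq> p' i \<and> v \<noteq> u' i \<and> v \<noteq> B i \<and> c \<noteq> p' i \<and> c \<noteq> u' i \<and> c \<noteq> B i \<and>
      p' i \<noteq> c \<and> u' i \<noteq> c \<and> B i \<noteq> c" if "i \<le> l" for i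
    using z(1)[OF that] by auto
  have out': "v \<noteq> r i \<and> v \<noteq> u i \<and> r i \<noteq> c \<and> u i \<noteq> c" if "i < l" for i
    using z(2)[OF that] by auto
  have "v \<noteq> c" using light_pathD(5)[OF lp[of 0]] by simp
  show ?thesis
  proof (rule has_wheelI[where v = v and a = a and p = p and b = b])
    show "adj v (p i) \<and> adj (p i) (a i) \<and> adj (a i) (b i)" if "i \<le> Suc l" for i
    proof -
      have "(i = 0) \<or> (0 < i \<and> i - 1 < l \<and> Suc (i - 1) = i \<and> i \<le> l) \<or> (i = Suc l)"
        using that by arith
      then consider "i = 0" | "0 < i" "i - 1 < l" "Suc (i - 1) = i" "i \<le> l" | "i = Suc l" by blast
      then show ?thesis
        using light_pathD[OF lp2[of 0]] light_pathD[OF lp[of l]] light_pathD[OF lp3(2)[of "i - 1"]]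
        by cases (auto simp: a_def p_def b_def)
    qed
    show "adj (b i) (a (Suc i))" if "i < Suc l" for i
      using that light_pathD(4)[OF lp3(1)[of i]] light_pathD(4)[OF lp2[of l]]
      by (cases "i = l") (auto simp: a_def b_def)
    show "adj (b (Suc l)) (a 0)"
      using light_pathD[OF lp[of 0]] by (auto simp: a_def b_def)
    show "v \<noteq> a i \<and> v \<noteq> p i \<and> v \<noteq> b i" if "i \<le> Suc l" for i
      using that \<open>v \<noteq> c\<close> out[of i] out'[of "i - 1"] out[of 0] out[of l] by (auto simp: a_def p_def b_def)
    show "a i \<noteq> p j \<and> a i \<noteq> b j \<and> p i \<noteq> b j" if "i \<le> Suc l" "j \<le> Suc l" for i j
      using that l out[of 0] out[of l] out'[of "i - 1"] kinds[of 0 j] kinds[of l j] kinds[of 0 0] kinds[of l l]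
        kinds[of 0 l] kinds[of l 0] kinds'[of 0 "j - 1"] kinds'[of l "j - 1"] kinds'[of 0 "i - 1"] kinds'[of l "i - 1"]
        kinds'[of j "i - 1"] kinds''[of "j - 1" "i - 1"]
      by (auto simp: a_def p_def b_def)
    show "a i \<noteq> a j \<and> p i \<noteq> p j \<and> b i \<noteq> b j" if "i < j" "j \<le> Suc l" for i j
      using that l out[of i] same[of i j] same[of 0 l] same'[of "i - 1" "j - 1"]
        kinds'[of 0 "j - 1"] kinds'[of l "i - 1"]
      by (auto simp: a_def p_def b_def)
  qed
qed

lemma wheel_rooted_at_end_long:
  assumes fin: "finite E"
    and E: "\<And>b' p' u' b p u. (((b', p', u'), b), (p, u)) \<in> E \<Longrightarrow>
        arc v p0 x b' p' u' \<and> arc v p' u' b p u \<and> b \<noteq> b' \<and> card (paths x p') \<le> M"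
    and S: "\<And>y z. card {r. (r, y) \<in> E \<and> snd r = z} \<le> S"
    and T: "\<And>y z. card {r. (r, y) \<in> E \<and> fst (fst r) = z} \<le> T"
    and big: "N * (2 * t) * card (fst ` E) + N * (S + T + t * t * t + M * t) * card (snd ` E) < card E"
    and N: "6 * l + 7 \<le> N" and l: "l > 0"
  shows "has_wheel adj (Suc (Suc (Suc l)))"
proof -
  define VP :: "('a \<times> 'a \<times> 'a) \<times> 'a \<Rightarrow> 'a set" where "VP = (\<lambda>((b', p', u'), b). {b', p', u', b})"
  define VY :: "'a \<times> 'a \<Rightarrow> 'a set" where "VY = (\<lambda>(p, u). {p, u})"
  have "\<exists>y0. y0 \<in> snd ` E \<and> (\<forall>U l. finite U \<longrightarrow> card U + 6 * l + 4 \<le> N \<longrightarrow>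
           (\<exists>P Y. (P 0, y0) \<in> E \<and> zigzag E VP VY U l P Y))"
  proof (rule exists_zigzag[OF fin _ _ _ _ big])
    show "finite (VP p) \<and> card (VP p) \<le> 4" for p
      by (cases p) (auto simp: VP_def card_insert_if)
    show "finite (VY p) \<and> card (VY p) \<le> 2" for p
      by (cases p) (auto simp: VY_def card_insert_if)
    show "card {y. (r, y) \<in> E \<and> z \<in> VY y} \<le> 2 * t" for r z
    proof -
      obtain b' p' u' b where r: "r = ((b', p', u'), b)" by (metis prod.exhaust)
      have "y \<in> (\<lambda>u. (z, u)) ` common z b \<union> (\<lambda>p. (p, z)) ` common v z"
        if "(r, y) \<in> E" "z \<in> VY y" for y
      proof -
        obtain p u where y: "y = (p, u)" by (cases y) auto
        have "light_path v p u b" using E that unfolding r y by (auto simp: arc_def)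
        then show ?thesis using that(2) light_pathD(13,14)[of v p u b]
          unfolding y VY_def by auto
      qed
      then have "card {y. (r, y) \<in> E \<and> z \<in> VY y} \<le>
          card ((\<lambda>u. (z, u)) ` common z b \<union> (\<lambda>p. (p, z)) ` common v z)"
        by (intro card_mono) auto
      also have "\<dots> \<le> card ((\<lambda>u. (z, u)) ` common z b) + card ((\<lambda>p. (p, z)) ` common v z)"
        by (rule card_Un_le)
      also have "\<dots> \<le> card (common z b) + card (common v z)"
        by (intro add_mono card_image_le) auto
      finally show ?thesis using card_common[of z b] card_common[of v z] by linarith
    qed
    show "card {r. (r, y) \<in> E \<and> z \<in> VP r} \<le> S + T + t * t * t + M * t" for y z
    proof -
      obtain p u where y: "y = (p, u)" by (cases y) auto
      define A1 where "A1 = {r. (r, y) \<in> E \<and> snd r = z}"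
      define A0 where "A0 = {r. (r, y) \<in> E \<and> fst (fst r) = z}"
      define A2 where "A2 = (\<lambda>((b', p'), b). ((b', p', z), b)) ` ((common x z \<times> common v z) \<times> common z u)"
      \<comment> \<open>If \<open>z\<close> is the spoke vertex \<open>p'\<close>, then
        \<open>b'\<close> and \<open>u'\<close> are the inner vertices of a light path from
        \<open>x\<close> to \<open>z\<close>, and there are at most \<open>M\<close> of these. When
        this bound fails for \<open>z\<close>, no walk has \<open>p' = z\<close> and
        \<open>Z\<close> may be empty.\<close>
      define Z where "Z = (if card (paths x z) \<le> M then paths x z else {})"
      define A3 where "A3 = (\<lambda>((b', u'), b). ((b', z, u'), b)) ` (SIGMA w : Z. common (snd w) u)"
      have fA1: "finite A1" "finite A0"
        by (rule finite_subset[of _ "fst ` E"]; use fin in \<open>force simp: A1_def A0_def\<close>)+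
      have fZ: "finite Z" "card Z \<le> M" by (auto simp: Z_def)
      have fA: "finite A2" "finite A3" using fZ by (auto simp: A2_def A3_def)
      have "r \<in> A1 \<union> A0 \<union> A2 \<union> A3" if "(r, y) \<in> E" "z \<in> VP r" for r
      proof -
        obtain b' p' u' b where r: "r = ((b', p', u'), b)" by (metis prod.exhaust)
        have *: "arc v p0 x b' p' u'" "arc v p' u' b p u" "card (paths x p') \<le> M"
          using E that unfolding r y by auto
        have "b' \<in> common x u'" using *(1) by (intro commonI) (auto simp: arc_def dest: light_pathD)
        moreover have "b \<in> common u' u" using *(2) by (intro commonI) (auto simp: arc_def dest: light_pathD)
        moreover have "p' \<in> common v u'" using *(1) by (auto simp: arc_def dest: light_pathD)
        moreover have "(b', u') \<in> paths x p'"
        proof -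
          show ?thesis using *(1)
            by (auto simp: arc_def paths_def light_path_def adj_commute light_sym)
        qed
        moreover have "z = b' \<or> z = b \<or> z = p' \<or> z = u'" using that unfolding r VP_def by auto
        moreover from calculation have "r \<in> A3" if "z = p'"
          unfolding A3_def r by (intro rev_image_eqI[of "((b', u'), b)"]) (use that *(3) in \<open>auto simp: Z_def\<close>)
        moreover from calculation have "r \<in> A2" if "z = u'"
          unfolding A2_def r by (intro rev_image_eqI[of "((b', p'), b)"]) (use that in auto)
        ultimately show ?thesis using that(1) unfolding r A0_def A1_def by auto
      qed
      then have "card {r. (r, y) \<in> E \<and> z \<in> VP r} \<le> card (A1 \<union> A0 \<union> A2 \<union> A3)"
        using fA1 fA by (intro card_mono) auto
      also have "\<dots> \<le> card A1 + card A0 + card A2 + card A3"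
        using card_Un_le[of "A1 \<union> A0 \<union> A2" A3] card_Un_le[of "A1 \<union> A0" A2] card_Un_le[of A1 A0] by linarith
      also have "card A2 \<le> t * t * t"
        unfolding A2_def by (intro order_trans[OF card_image_le] order_trans[OF eq_refl[OF card_cartesian_product]] mult_mono)
          (auto simp: card_common)
      also have "card A3 \<le> M * t"
        unfolding A3_def
        by (intro order_trans[OF card_image_le] card_le_Sigma[where f = id and J = Z and Y = "\<lambda>w. common (snd w) u"])
          (auto simp: card_common fZ)
      also have "card A1 \<le> S" unfolding A1_def by (rule S)
      also have "card A0 \<le> T" unfolding A0_def by (rule T)
      finally show ?thesis by simp
    qed
  qed
  then obtain y0 where y0: "\<And>U l. finite U \<Longrightarrow> card U + 6 * l + 4 \<le> N \<Longrightarrow>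
           (\<exists>P Y. (P 0, y0) \<in> E \<and> zigzag E VP VY U l P Y)" by blast
  have "card {v, p0, x} + 6 * l + 4 \<le> N"
    using N by (auto simp: card_insert_if)
  from y0[OF _ this] obtain P Y where zz: "zigzag E VP VY {v, p0, x} l P Y"
    by auto
  define B' where "B' i = fst (fst (P i))" for i
  define p' where "p' i = fst (snd (fst (P i)))" for i
  define u' where "u' i = snd (snd (fst (P i)))" for i
  define B where "B i = snd (P i)" for i
  define r where "r i = fst (Y i)" for i
  define u where "u i = snd (Y i)" for i
  have Pi: "P i = ((B' i, p' i, u' i), B i)" for i by (simp add: p'_def u'_def B'_def B_def)
  have Yi: "Y i = (r i, u i)" for i by (simp add: r_def u_def)
  have e1: "arc v p0 x (B' i) (p' i) (u' i) \<and> arc v (p' i) (u' i) (B i) (r i) (u i) \<and> B i \<noteq> B' i"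
    if "i < l" for i
    using zigzagD(1)[OF zz that] E Pi[of i] Yi[of i] by metis
  have e2: "arc v p0 x (B' (Suc i)) (p' (Suc i)) (u' (Suc i)) \<and>
      arc v (p' (Suc i)) (u' (Suc i)) (B (Suc i)) (r i) (u i) \<and> B (Suc i) \<noteq> B' (Suc i)"
    if "i < l" for i
    using zigzagD(2)[OF zz that] E Pi[of "Suc i"] Yi[of i] by metis
  have ar: "arc v p0 x (B' i) (p' i) (u' i)" "B i \<noteq> B' i" if "i \<le> l" for i
    using that e1[of 0] e2[of "i - 1"] l by (cases i, auto)+
  have lp: "light_path v (p' i) (u' i) (B' i)" "light_path v p0 x (B' i)" if "i \<le> l" for i
    using ar(1)[OF that] by (auto simp: arc_def)
  have lp2: "light_path v (p' i) (u' i) (B i)" if "i \<le> l" for i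
    using that e1[of 0] e2[of "i - 1"] l by (cases i) (auto simp: arc_def)
  have lp3: "light_path v (r i) (u i) (B i)" "light_path v (r i) (u i) (B (Suc i))" if "i < l" for i
    using e1[OF that] e2[OF that] by (auto simp: arc_def)
  have VPi: "VP (P i) = {B' i, p' i, u' i, B i}" for i by (subst Pi) (simp add: VP_def)
  have VYi: "VY (Y i) = {r i, u i}" for i by (subst Yi) (simp add: VY_def)
  note z = zigzagD(3-7)[OF zz, unfolded VPi VYi]
  \<comment> \<open>The rim runs \<open>x, B' 0, u' 0, B 0, u 0, B 1, ..., u (l - 1), B l, u' l, B'
    l\<close> and back to \<open>x\<close>, with \<open>l + 3\<close> rim vertices.\<close>
  define a where "a i = (if i = 0 then x else if i = 1 then u' 0 else if i \<le> Suc l then u (i - 2) else u' l)" for i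
  define p where "p i = (if i = 0 then p0 else if i = 1 then p' 0 else if i \<le> Suc l then r (i - 2) else p' l)" for i
  define b where "b i = (if i = 0 then B' 0 else if i \<le> Suc l then B (i - 1) else B' l)" for i
  have kinds: "p' i \<noteq> u' j \<and> u' j \<noteq> p' i \<and> p' i \<noteq> B j \<and> u' i \<noteq> B j \<and> B j \<noteq> p' i \<and> B j \<noteq> u' i \<and>
      p' i \<noteq> B' j \<and> u' i \<noteq> B' j \<and> B' j \<noteq> p' i \<and> B' j \<noteq> u' i \<and> B' i \<noteq> B j \<and> B j \<noteq> B' i"
    if "i \<le> l" "j \<le> l" for i j
    using light_pathD(10,11,12)[OF lp2[OF that(1)]] light_pathD(10,11,12)[OF lp(1)[OF that(1)]]
      ar(2)[OF that(1)] z(3)[of i j] that by (cases "i = j") auto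
  have kinds': "p' i \<noteq> r j \<and> p' i \<noteq> u j \<and> u' i \<noteq> r j \<and> u' i \<noteq> u j \<and> B i \<noteq> r j \<and> B i \<noteq> u j
      \<and> r j \<noteq> p' i \<and> u j \<noteq> p' i \<and> r j \<noteq> u' i \<and> u j \<noteq> u' i \<and> r j \<noteq> B i \<and> u j \<noteq> B i
      \<and> r j \<noteq> B' i \<and> u j \<noteq> B' i"
    if "i \<le> l" "j < l" for i j
    using z(5)[of i j] that by auto
  have kinds'': "r i \<noteq> u j \<and> u j \<noteq> r i" if "i < l" "j < l" for i j
    using light_pathD(10)[OF lp3(1)[OF that(1)]] z(4)[of i j] that by (cases "i = j") auto
  have same: "p' i \<noteq> p' j \<and> u' i \<noteq> u' j \<and> B i \<noteq> B j \<and> B' i \<noteq> B' j" if "i < j" "j \<le> l" for i j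
    using z(3)[of i j] that by auto
  have same': "r i \<noteq> r j \<and> u i \<noteq> u j" if "i < j" "j < l" for i j
    using z(4)[of i j] that by auto
  have root: "v \<noteq> p0" "p0 \<noteq> v" "v \<noteq> x" "x \<noteq> v" "p0 \<noteq> x" "x \<noteq> p0"
    using light_pathD[OF lp(2)[of 0]] by auto
  have out: "w \<noteq> p' i \<and> w \<noteq> u' i \<and> w \<noteq> B i \<and> w \<noteq> B' i \<and> p' i \<noteq> w \<and> u' i \<noteq> w"
    if "i \<le> l" "w = v \<or> w = p0 \<or> w = x" for i w
    using z(1)[OF that(1)] that(2) by auto
  have out': "w \<noteq> r i \<and> w \<noteq> u i \<and> r i \<noteq> w \<and> u i \<noteq> w" if "i < l" "w = v \<or> w = p0 \<or> w = x" for i w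
    using z(2)[OF that(1)] that(2) by auto
  show ?thesis
  proof (rule has_wheelI[where v = v and a = a and p = p and b = b])
    show "adj v (p i) \<and> adj (p i) (a i) \<and> adj (a i) (b i)" if "i \<le> Suc (Suc l)" for i
    proof -
      have "(i = 0) \<or> (i = 1) \<or> (1 < i \<and> i - 2 < l \<and> Suc (i - 2) = i - 1 \<and> i \<le> Suc l) \<or> (i = Suc (Suc l))"
        using that by arith
      then consider "i = 0" | "i = 1" | "1 < i" "i - 2 < l" "Suc (i - 2) = i - 1" "i \<le> Suc l" | "i = Suc (Suc l)" by blast
      then show ?thesis
        using light_pathD[OF lp2[of 0]] light_pathD[OF lp(1)[of l]] light_pathD[OF lp(2)[of 0]]
          light_pathD[OF lp3(2)[of "i - 2"]]
        by cases (auto simp: a_def p_def b_def)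
    qed
    show "adj (b i) (a (Suc i))" if "i < Suc (Suc l)" for i
    proof -
      have "(i = 0) \<or> (0 < i \<and> i - 1 < l \<and> Suc i - 2 = i - 1 \<and> i \<le> l) \<or> (i = Suc l)"
        using that by arith
      then consider "i = 0" | "0 < i" "i - 1 < l" "Suc i - 2 = i - 1" "i \<le> l" | "i = Suc l" by blast
      then show ?thesis
        using light_pathD(4)[OF lp3(1)[of "i - 1"]] light_pathD(4)[OF lp2[of l]] light_pathD(4)[OF lp(1)[of 0]]
        by cases (auto simp: a_def b_def)
    qed
    show "adj (b (Suc (Suc l))) (a 0)"
      using light_pathD[OF lp(2)[of l]] by (auto simp: a_def b_def)
    show "v \<noteq> a i \<and> v \<noteq> p i \<and> v \<noteq> b i" if "i \<le> Suc (Suc l)" for i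
      using that root out[of "i - 1" v] out'[of "i - 2" v] out[of 0 v] out[of l v] by (auto simp: a_def p_def b_def)
    show "a i \<noteq> p j \<and> a i \<noteq> b j \<and> p i \<noteq> b j" if "i \<le> Suc (Suc l)" "j \<le> Suc (Suc l)" for i j
    proof -
      have "i = 0 \<or> i = 1 \<or> 1 < i \<and> i - 2 < l \<and> i \<le> Suc l \<or> i = Suc (Suc l)"
        "j = 0 \<or> j = 1 \<or> 1 < j \<and> j - 2 < l \<and> j - 1 \<le> l \<and> j \<le> Suc l \<or> j = Suc (Suc l)"
        using that by arith+
      then show ?thesis
        by (elim disjE; insert l root out[of 0 x] out[of 0 p0] out[of l x] out[of l p0]
          out[of "j - 1" x] out[of "j - 1" p0]
          out'[of "i - 2" x] out'[of "i - 2" p0] out'[of "j - 2" x] out'[of "j - 2" p0]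
          kinds[of 0 0] kinds[of l l] kinds[of 0 l] kinds[of l 0] kinds[of 0 "j - 1"] kinds[of l "j - 1"]
          kinds'[of 0 "j - 2"] kinds'[of l "j - 2"] kinds'[of 0 "i - 2"] kinds'[of l "i - 2"]
          kinds'[of 0 "i - 2"] kinds'[of "j - 1" "i - 2"] kinds''[of "j - 2" "i - 2"];
          simp add: a_def p_def b_def)
    qed
    show "a i \<noteq> a j \<and> p i \<noteq> p j \<and> b i \<noteq> b j" if "i < j" "j \<le> Suc (Suc l)" for i j
    proof -
      have "(i = 0) \<or> (i = 1) \<or> (1 < i \<and> i - 2 < l \<and> i \<le> Suc l \<and> i - 1 \<le> l)"
        using that by arith
      then consider "i = 0" | "i = 1" | "1 < i" "i - 2 < l" "i \<le> Suc l" "i - 1 \<le> l" by blast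
      then show ?thesis
        using that l root out[of 0 x] out[of 0 p0] out[of l x] out[of l p0]
          out'[of "j - 2" x] out'[of "j - 2" p0] same[of "i - 1" "j - 1"] same[of 0 l]
          same'[of "i - 2" "j - 2"] kinds[of 0 "j - 1"] kinds[of l "i - 1"] kinds[of l 0]
          kinds'[of 0 "j - 2"] kinds'[of l "i - 2"]
        by cases (auto simp: a_def p_def b_def)
    qed
  qed
qed

section \<open>Cleaning the arcs that leave one rim vertex\<close>

text \<open>An element \<open>(((b', p', u'), b), (p, u))\<close> continues the exploration step through \<open>b'\<close> to \<open>u'\<close>
  by a step through \<open>b\<close> to \<open>u\<close>; here \<open>p'\<close> and \<open>p\<close> are the spoke vertices of \<open>u'\<close> and \<open>u\<close>.\<close>

definition arc_pairs :: "'a \<Rightarrow> ('a \<times> 'a \<times> 'a) set \<Rightarrow> ((('a \<times> 'a \<times> 'a) \<times> 'a) \<times> 'a \<times> 'a) set" where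
  "arc_pairs v R = {(((b', p', u'), b), (p, u)) | b' p' u' b p u.
      (b', p', u') \<in> R \<and> arc v p' u' b p u \<and> b \<noteq> b'}"

lemma arc_V: "arc v p u b p' u' \<Longrightarrow> p \<in> V \<and> u \<in> V \<and> b \<in> V \<and> p' \<in> V \<and> u' \<in> V"
  using adj_V' by (auto simp: arc_def light_path_def)

lemma finite_arc_pairs:
  assumes "finite R" shows "finite (arc_pairs v R)"
  by (rule finite_subset[of _ "(R \<times> V) \<times> V \<times> V"])
    (use assms finV arc_V in \<open>auto simp: arc_pairs_def\<close>)

text \<open>The walks from \<open>x\<close> are treated in two rounds. The first shows that few
  walks of the third level have an end \<open>b\<close> reached more than \<open>S\<close> times,
  the second finds a wheel on the fourth level after the edges over such \<open>b\<close> are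
  removed. In both rounds, walks that often reach the same end through the same \<open>b'\<close>
  yield a wheel closed at \<open>b'\<close>, the others one closed at \<open>x\<close>.
  \<open>S3\<close>, \<open>S\<close> and \<open>T\<close> are chosen so that the weighted numbers
  of nodes stay below the number of edges, as \<open>exists_zigzag\<close> demands.\<close>

lemma wheel_from_dense_arcs:
  fixes k M N \<Delta> R S3 S T v
  defines "N \<equiv> 6 * k" and "E \<equiv> arc_pairs v R"
  defines "S3 \<equiv> 4 * t * N"
  defines "S \<equiv> 4 * N * (S3 + 2 * t * t)"
  defines "T \<equiv> 2 * N * (S + 2 * t * t)"
  assumes k: "4 \<le> k" and M: "1 \<le> M"
    and R: "\<And>b' p' u'. (b', p', u') \<in> R \<Longrightarrow> arc v p0 x b' p' u' \<and> card (paths x p') \<le> M"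
    and deg: "\<And>y. card (nbrs y) \<le> \<Delta>"
    and E1: "20 * t * N * (\<Delta> * card R) \<le> card E"
    and E2: "8 * N * (S + T + t * t * t + t) * M * (\<Delta> * \<Delta>) \<le> card E"
    and E0: "0 < card E"
  shows "has_wheel adj k"
proof (rule ccontr)
  assume no: "\<not> has_wheel adj k"
  have finR: "finite R"
  proof (rule finite_subset[of _ "V \<times> V \<times> V"])
    show "R \<subseteq> V \<times> V \<times> V"
    proof clarsimp
      fix b' p' u' assume "(b', p', u') \<in> R"
      then have "arc v p0 x b' p' u'" using R by blast
      then show "b' \<in> V \<and> p' \<in> V \<and> u' \<in> V" using arc_V by blast
    qed
  qed (use finV in auto)
  have finE: "finite E" unfolding E_def by (rule finite_arc_pairs[OF finR])
  have EE: "(b', p', u') \<in> R" "arc v p0 x b' p' u'" "arc v p' u' b p u" "b \<noteq> b'" "card (paths x p') \<le> M"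
    if "(((b', p', u'), b), (p, u)) \<in> E" for b' p' u' b p u
    using that R by (auto simp: E_def arc_pairs_def)
  define F0 where "F0 = fst ` E"
  have finF0: "finite F0" using finE by (simp add: F0_def)
  have F0: "(b', p', u') \<in> R \<and> arc v p0 x b' p' u' \<and> light_path v p' u' b' \<and> light_path v p' u' b"
    if "((b', p', u'), b) \<in> F0" for b' p' u' b
    using that EE unfolding F0_def arc_def by fastforce
  define s where "s b = card {r. (r, b) \<in> F0}" for b
  define F where "F = {e \<in> F0. S < s (snd e)}"
  have finF: "finite F" using finF0 by (simp add: F_def)
  have FF0: "F \<subseteq> F0" by (auto simp: F_def)
  have F0R: "fst ` F0 \<subseteq> R" using F0 by (auto; blast)
  \<comment> \<open>If the walks to ends reached more than \<open>S\<close> times were many,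
    \<open>FD\<close> or its complement in \<open>F\<close> would contain at least half of them and
    produce a wheel.\<close>
  have step1: "card F \<le> 4 * N * card R"
  proof (rule ccontr)
    assume "\<not> ?thesis"
    then have big: "4 * N * card R < card F" by simp
    define FD where "FD = {e \<in> F. S3 < card {r. (r, snd e) \<in> F \<and> fst r = fst (fst e)}}"
    have FDF: "FD \<subseteq> F" by (auto simp: FD_def)
    have finFD: "finite FD" using finF FDF finite_subset by blast
    have split: "card F = card FD + card (F - FD)" by (rule card_partition[OF finF FDF])
    have imgR: "card (fst ` J) \<le> card R" if "J \<subseteq> F" for J
      using that FF0 F0R finR by (intro card_mono) auto
    have sec: "finite {r. (r, b) \<in> J}" if "J \<subseteq> F" for J b
      by (rule finite_subset[of _ "fst ` F"]) (use that finF in force)+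
    show False
    proof (cases "card F \<le> 2 * card FD")
      case True
      \<comment> \<open>The end \<open>b\<close> is refined to the pair of \<open>b'\<close> and
        \<open>b\<close>. By the definition of \<open>FD\<close> each such pair that occurs is still
        reached at least \<open>S3\<close> times.\<close>
      define g where "g = (\<lambda>e :: ('a \<times> 'a \<times> 'a) \<times> 'a. (fst e, (fst (fst e), snd e)))"
      define ED where "ED = g ` FD"
      have injg: "inj_on g J" for J by (auto simp: g_def inj_on_def prod_eq_iff)
      have cED: "card ED = card FD" unfolding ED_def by (rule card_image[OF injg])
      have finED: "finite ED" using finFD by (simp add: ED_def)
      have nodes: "S3 * card (snd ` ED) \<le> card ED"
      proof (rule card_ge_fibres[OF finED])
        fix y assume "y \<in> snd ` ED"
        then obtain r b where rb: "(r, b) \<in> FD" "y = (fst r, b)" by (auto simp: ED_def g_def)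
        have "{r'. (r', b) \<in> F \<and> fst r' = fst r} \<subseteq> fst ` {e \<in> ED. snd e = y}"
        proof
          fix r' assume r': "r' \<in> {r'. (r', b) \<in> F \<and> fst r' = fst r}"
          then have "(r', b) \<in> FD" using rb(1) by (auto simp: FD_def)
          then have "(r', y) \<in> ED" unfolding ED_def rb(2) g_def using r' by force
          then show "r' \<in> fst ` {e \<in> ED. snd e = y}" by force
        qed
        then have "card {r'. (r', b) \<in> F \<and> fst r' = fst r} \<le> card {e \<in> ED. snd e = y}"
          using finED by (intro surj_card_le) auto
        then show "S3 \<le> card {e \<in> ED. snd e = y}" using rb(1) by (simp add: FD_def)
      qed
      have "fst ` ED = fst ` FD" by (auto simp: ED_def g_def image_image)
      then have c1: "N * card (fst ` ED) \<le> N * card R" using imgR[OF FDF] by simp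
      have "has_wheel adj (Suc (k - 1))"
      proof (rule wheel_rooted_at_middle_short[where E = ED and N = N and v = v])
        show "c = b' \<and> light_path v p' u' b' \<and> light_path v p' u' b"
          if "((b', p', u'), (c, b)) \<in> ED" for b' p' u' c b
          using that F0 FF0 FDF unfolding ED_def g_def by fastforce
        show "N * 1 * card (fst ` ED) + N * (2 * t) * card (snd ` ED) < card ED"
        proof -
          have "2 * (N * (2 * t) * card (snd ` ED)) \<le> card ED"
            using nodes by (simp add: S3_def algebra_simps)
          then show ?thesis using c1 big True cED by linarith
        qed
      qed (use finED k in \<open>auto simp: N_def\<close>)
      then show False using no k by simp
    next
      case False
      define FC where "FC = F - FD"
      have FCF: "FC \<subseteq> F" by (auto simp: FC_def)
      have finFC: "finite FC" using finF by (simp add: FC_def)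
      have half: "card F \<le> 2 * card FC" using split False by (simp add: FC_def)
      have nodes: "S * card (snd ` F) \<le> card F"
      proof (rule card_ge_fibres[OF finF])
        fix b assume "b \<in> snd ` F"
        then have sb: "S < s b" by (auto simp: F_def)
        have "{r. (r, b) \<in> F0} \<subseteq> fst ` {e \<in> F. snd e = b}"
          using sb by (force simp: F_def)
        then have "card {r. (r, b) \<in> F0} \<le> card {e \<in> F. snd e = b}"
          using finF by (intro surj_card_le) auto
        then show "S \<le> card {e \<in> F. snd e = b}" using sb by (simp add: s_def)
      qed
      have "card (snd ` FC) \<le> card (snd ` F)" using finF FCF by (intro card_mono) auto
      then have "S * card (snd ` FC) \<le> S * card (snd ` F)" by simp
      then have nodes': "S * card (snd ` FC) \<le> 2 * card FC" using nodes half by linarith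
      have c1: "N * card (fst ` FC) \<le> N * card R" using imgR[OF FCF] by simp
      have "has_wheel adj (Suc (Suc (k - 2)))"
      proof (rule wheel_rooted_at_end_short[where E = FC and N = N and v = v and S = S3 and x = x and ?p0.0 = p0])
        show "arc v p0 x b' p' u' \<and> light_path v p' u' b" if "((b', p', u'), b) \<in> FC" for b' p' u' b
          using that F0 FF0 FCF by blast
        show "card {r. (r, b) \<in> FC \<and> fst r = z} \<le> S3" for b z
        proof (cases "{r. (r, b) \<in> FC \<and> fst r = z} = {}")
          case False
          then obtain r where r: "(r, b) \<in> FC" "fst r = z" by auto
          have "card {r. (r, b) \<in> FC \<and> fst r = z} \<le> card {r. (r, b) \<in> F \<and> fst r = z}"
            using FCF by (intro card_mono finite_subset[OF _ sec[of F b]]) auto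
          also have "\<dots> \<le> S3" using r by (auto simp: FC_def FD_def)
          finally show ?thesis .
        next
          case True
          then show ?thesis by (simp only: card.empty le0)
        qed
        show "N * 1 * card (fst ` FC) + N * (S3 + 2 * t * t) * card (snd ` FC) < card FC"
        proof -
          have "4 * (N * (S3 + 2 * t * t) * card (snd ` FC)) \<le> 2 * card FC"
            using nodes' by (simp add: S_def mult.assoc)
          then show ?thesis using c1 big half by linarith
        qed
      qed (use finFC k in \<open>auto simp: N_def\<close>)
      moreover have "Suc (Suc (k - 2)) = k" using k by simp
      ultimately show False using no by simp
    qed
  qed
  define Eb where "Eb = {e \<in> E. s (snd (fst e)) \<le> S}"
  have EbE: "Eb \<subseteq> E" by (auto simp: Eb_def)
  have finEb: "finite Eb" using finE EbE finite_subset by blast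
  \<comment> \<open>A walk with end \<open>b\<close> has at most \<open>\<Delta> * t\<close>
    continuations: \<open>u\<close> is a neighbour of \<open>b\<close>, and \<open>p\<close> a
    common neighbour of the light pair \<open>v\<close>, \<open>u\<close>. With \<open>step1\<close>
    the edges lost are few compared with \<open>E\<close>, by \<open>E1\<close>.\<close>
  have "card (E - Eb) \<le> \<Delta> * t * card (fst ` (E - Eb))"
  proof (rule card_le_fibres)
    fix w assume "w \<in> fst ` (E - Eb)"
    obtain r b where w: "w = (r, b)" by (rule prod.exhaust)
    show "card {e \<in> E - Eb. fst e = w} \<le> \<Delta> * t"
    proof (rule card_le_Sigma[where J = "nbrs b" and Y = "common v" and f = "\<lambda>e. (snd (snd e), fst (snd e))"])
      show "inj_on (\<lambda>e. (snd (snd e), fst (snd e))) {e \<in> E - Eb. fst e = w}"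
        by (auto simp: inj_on_def prod_eq_iff)
      show "(\<lambda>e. (snd (snd e), fst (snd e))) ` {e \<in> E - Eb. fst e = w} \<subseteq> Sigma (nbrs b) (common v)"
      proof (rule image_subsetI)
        fix e assume "e \<in> {e \<in> E - Eb. fst e = w}"
        moreover obtain b' p' u' where "r = (b', p', u')" by (cases r) auto
        ultimately obtain p u where e: "e = (((b', p', u'), b), (p, u))" "e \<in> E"
          using w by (cases e) auto
        then have "light_path v p u b" using EE(3) by (auto simp: arc_def)
        then show "(snd (snd e), fst (snd e)) \<in> Sigma (nbrs b) (common v)"
          using light_pathD e(1) by (auto simp: nbrs_def)
      qed
    qed (auto simp: deg card_common)
  qed (use finE in auto)
  also have "fst ` (E - Eb) \<subseteq> F" by (auto simp: Eb_def F_def F0_def)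
  then have "\<Delta> * t * card (fst ` (E - Eb)) \<le> \<Delta> * t * card F"
    using finF by (intro mult_le_mono2 card_mono)
  also have "\<dots> \<le> \<Delta> * t * (4 * N * card R)" using step1 by (rule mult_le_mono2)
  finally have lost: "card (E - Eb) \<le> 4 * (t * N * (\<Delta> * card R))" by (simp add: algebra_simps)
  have halfE: "card E \<le> 2 * card Eb"
    using card_partition[OF finE EbE] lost E1 by linarith
  have Pi: "card (fst ` E) \<le> card R * \<Delta>"
  proof (rule card_le_Sigma[where J = R and Y = "\<lambda>r. nbrs (snd (snd r))" and f = id])
    show "id ` fst ` E \<subseteq> (SIGMA r:R. nbrs (snd (snd r)))"
      using F0 light_pathD(3) unfolding F0_def[symmetric] by (fastforce simp: nbrs_def)
  qed (use finR deg in auto)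
  have Pi': "10 * (t * N * card (fst ` J)) \<le> card Eb" if "J \<subseteq> E" for J
  proof -
    have "card (fst ` J) \<le> card (fst ` E)" using that finE by (intro card_mono) auto
    then have "t * N * card (fst ` J) \<le> t * N * (\<Delta> * card R)"
      using Pi by (intro mult_le_mono2) (simp add: mult.commute)
    moreover have "20 * (t * N * (\<Delta> * card R)) \<le> card E" using E1 by (simp only: mult.assoc)
    ultimately show ?thesis using halfE by linarith
  qed
  have sS: "card {w. (w, y) \<in> J \<and> snd w = z} \<le> S" if "J \<subseteq> Eb" for J y z
  proof (cases "{w. (w, y) \<in> J \<and> snd w = z} = {}")
    case False
    then have sz: "s z \<le> S" using that by (auto simp: Eb_def)
    have "card {w. (w, y) \<in> J \<and> snd w = z} \<le> card {r. (r, z) \<in> F0}"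
    proof (rule card_inj_on_le[where f = fst])
      show "fst ` {w. (w, y) \<in> J \<and> snd w = z} \<subseteq> {r. (r, z) \<in> F0}"
        using that EbE by (force simp: F0_def)
      show "finite {r. (r, z) \<in> F0}"
        by (rule finite_subset[of _ "fst ` F0"]) (use finF0 in force)+
    qed (auto simp: inj_on_def prod_eq_iff)
    then show ?thesis using sz by (simp add: s_def)
  next
    case True
    then show ?thesis by (simp only: card.empty le0)
  qed
  \<comment> \<open>The same splitting one level further on: in \<open>EB\<close> the end
    \<open>(p, u)\<close> is reached more than \<open>T\<close> times through the same
    \<open>b'\<close>.\<close>
  define EB where "EB = {e \<in> Eb. T < card {w. (w, snd e) \<in> Eb \<and> fst (fst w) = fst (fst (fst e))}}"
  have EBE: "EB \<subseteq> Eb" by (auto simp: EB_def)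
  have finEB: "finite EB" using finEb EBE finite_subset by blast
  have split: "card Eb = card EB + card (Eb - EB)" by (rule card_partition[OF finEb EBE])
  have posEb: "0 < card Eb" using halfE E0 by simp
  show False
  proof (cases "card Eb \<le> 2 * card EB")
    case True
    define g where "g = (\<lambda>e :: (('a \<times> 'a \<times> 'a) \<times> 'a) \<times> 'a \<times> 'a. (fst e, (fst (fst (fst e)), snd e)))"
    define ED where "ED = g ` EB"
    have injg: "inj_on g J" for J by (auto simp: g_def inj_on_def prod_eq_iff)
    have cED: "card ED = card EB" unfolding ED_def by (rule card_image[OF injg])
    have finED: "finite ED" using finEB by (simp add: ED_def)
    have nodes: "T * card (snd ` ED) \<le> card ED"
    proof (rule card_ge_fibres[OF finED])
      fix y assume "y \<in> snd ` ED"
      then obtain w q where wq: "(w, q) \<in> EB" "y = (fst (fst w), q)" by (auto simp: ED_def g_def)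
      have "{w'. (w', q) \<in> Eb \<and> fst (fst w') = fst (fst w)} \<subseteq> fst ` {e \<in> ED. snd e = y}"
      proof
        fix w' assume w': "w' \<in> {w'. (w', q) \<in> Eb \<and> fst (fst w') = fst (fst w)}"
        then have "(w', q) \<in> EB" using wq(1) by (auto simp: EB_def)
        then have "(w', y) \<in> ED" unfolding ED_def wq(2) g_def using w' by force
        then show "w' \<in> fst ` {e \<in> ED. snd e = y}" by force
      qed
      then have "card {w'. (w', q) \<in> Eb \<and> fst (fst w') = fst (fst w)} \<le> card {e \<in> ED. snd e = y}"
        using finED by (intro surj_card_le) auto
      then show "T \<le> card {e \<in> ED. snd e = y}" using wq(1) by (simp add: EB_def)
    qed
    have "fst ` ED = fst ` EB" by (auto simp: ED_def g_def image_image)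
    then have c1: "5 * (t * N * card (fst ` ED)) \<le> card EB"
      unfolding \<open>fst ` ED = fst ` EB\<close>
      using Pi'[OF order_trans[OF EBE EbE]] True by linarith
    have "has_wheel adj (Suc (Suc (k - 2)))"
    proof (rule wheel_rooted_at_middle_long[where E = ED and N = N and v = v and S = S])
      show "c = b' \<and> light_path v p' u' b' \<and> arc v p' u' b p u"
        if "(((b', p', u'), b), (c, p, u)) \<in> ED" for b' p' u' b c p u
      proof -
        have "(((b', p', u'), b), (p, u)) \<in> E" "c = b'"
          using that EBE EbE unfolding ED_def g_def by auto
        then show ?thesis using EE(2,3) by (auto simp: arc_def)
      qed
      show "card {w. (w, y) \<in> ED \<and> snd w = z} \<le> S" for y z
      proof -
        have "{w. (w, y) \<in> ED \<and> snd w = z} \<subseteq> {w. (w, snd y) \<in> EB \<and> snd w = z}"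
          by (auto simp: ED_def g_def)
        moreover have "finite {w. (w, snd y) \<in> EB \<and> snd w = z}"
          by (rule finite_subset[of _ "fst ` EB"]) (use finEB in force)+
        ultimately show ?thesis using sS[OF EBE, of "snd y" z] card_mono le_trans by blast
      qed
      show "N * (2 * t) * card (fst ` ED) + N * (S + 2 * t * t) * card (snd ` ED) < card ED"
      proof -
        have "2 * (N * (S + 2 * t * t) * card (snd ` ED)) \<le> card ED"
          using nodes by (simp add: T_def mult.assoc)
        moreover have "5 * (N * (2 * t) * card (fst ` ED)) \<le> 2 * card ED"
          using c1 cED by (simp add: algebra_simps)
        ultimately show ?thesis using posEb True cED by linarith
      qed
    qed (use finED k in \<open>auto simp: N_def\<close>)
    moreover have "Suc (Suc (k - 2)) = k" using k by simp
    ultimately show False using no by simp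
  next
    case False
    define EA where "EA = Eb - EB"
    have EAE: "EA \<subseteq> Eb" by (auto simp: EA_def)
    have finEA: "finite EA" using finEb by (simp add: EA_def)
    have half: "card Eb \<le> 2 * card EA" using split False by (simp add: EA_def)
    have c1: "5 * (t * N * card (fst ` EA)) \<le> card EA"
      using Pi'[OF order_trans[OF EAE EbE]] half by linarith
    \<comment> \<open>An end consists of a neighbour \<open>p\<close> of \<open>v\<close> and a
      neighbour \<open>u\<close> of \<open>p\<close>. The bound \<open>\<Delta> * \<Delta>\<close>
      on their number is what \<open>E2\<close> is compared with.\<close>
    have "card (snd ` EA) \<le> \<Delta> * \<Delta>"
    proof (rule card_le_Sigma[where J = "nbrs v" and Y = nbrs and f = id])
      show "id ` snd ` EA \<subseteq> Sigma (nbrs v) nbrs"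
      proof (rule image_subsetI, elim imageE)
        fix q e assume "q = snd e" "e \<in> EA"
        moreover obtain b' p' u' b p u where "e = (((b', p', u'), b), (p, u))" by (metis prod.exhaust)
        ultimately have "q = (p, u)" "light_path v p u b" using EE(3) EAE EbE by (auto simp: arc_def)
        then show "id q \<in> Sigma (nbrs v) nbrs" using light_pathD by (auto simp: nbrs_def)
      qed
    qed (auto simp: deg)
    moreover have "S + T + t * t * t + M * t \<le> (S + T + t * t * t + t) * M"
    proof -
      have "(S + T + t * t * t) * 1 \<le> (S + T + t * t * t) * M" using M by (intro mult_le_mono2)
      then show ?thesis by (simp add: algebra_simps)
    qed
    ultimately have "(S + T + t * t * t + M * t) * card (snd ` EA) \<le> (S + T + t * t * t + t) * M * (\<Delta> * \<Delta>)"
      by (intro mult_le_mono)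
    then have "8 * N * ((S + T + t * t * t + M * t) * card (snd ` EA)) \<le> 8 * N * ((S + T + t * t * t + t) * M * (\<Delta> * \<Delta>))"
      by (rule mult_le_mono2)
    then have "8 * (N * (S + T + t * t * t + M * t) * card (snd ` EA)) \<le> card E"
      using E2 by (simp only: mult.assoc)
    then have c2: "2 * (N * (S + T + t * t * t + M * t) * card (snd ` EA)) \<le> card EA"
      using halfE half by linarith
    \<comment> \<open>The zigzag has \<open>k - 3\<close> steps and must have at least one, which is
      the step that needs \<open>4 \<le> k\<close>.\<close>
    have "has_wheel adj (Suc (Suc (Suc (k - 3))))"
    proof (rule wheel_rooted_at_end_long[where E = EA and N = N and v = v and S = S and T = T and M = M
          and x = x and ?p0.0 = p0])
      show "arc v p0 x b' p' u' \<and> arc v p' u' b p u \<and> b \<noteq> b' \<and> card (paths x p') \<le> M"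
        if "(((b', p', u'), b), (p, u)) \<in> EA" for b' p' u' b p u
        using EE(2-5)[OF subsetD[OF order_trans[OF EAE EbE] that]] by simp
      show "card {w. (w, y) \<in> EA \<and> snd w = z} \<le> S" for y z by (rule sS[OF EAE])
      show "card {w. (w, y) \<in> EA \<and> fst (fst w) = z} \<le> T" for y z
      proof (cases "{w. (w, y) \<in> EA \<and> fst (fst w) = z} = {}")
        case False
        then obtain w where w: "(w, y) \<in> EA" "fst (fst w) = z" by auto
        have "finite {w. (w, y) \<in> Eb}"
          by (rule finite_subset[of _ "fst ` Eb"]) (use finEb in force)+
        then have "card {w. (w, y) \<in> EA \<and> fst (fst w) = z} \<le> card {w. (w, y) \<in> Eb \<and> fst (fst w) = z}"
          using EAE by (intro card_mono) auto
        also have "\<dots> \<le> T" using w by (auto simp: EA_def EB_def)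
        finally show ?thesis .
      next
        case True
        then show ?thesis by (simp only: card.empty le0)
      qed
      show "N * (2 * t) * card (fst ` EA) + N * (S + T + t * t * t + M * t) * card (snd ` EA) < card EA"
      proof -
        have "5 * (N * (2 * t) * card (fst ` EA)) \<le> 2 * card EA"
          using c1 by (simp add: algebra_simps)
        then show ?thesis using c2 posEb half by linarith
      qed
    qed (use finEA k in \<open>auto simp: N_def\<close>)
    moreover have "Suc (Suc (Suc (k - 3))) = k" using k by simp
    ultimately show False using no by simp
  qed
qed

end

section \<open>Counting light paths of length three\<close>

lemma exists_distinct_representatives:
  fixes W :: "nat \<Rightarrow> 'a set"
  assumes "finite T" "\<And>j. j < n \<Longrightarrow> finite (W j) \<and> card T + n \<le> card (W j)"
  shows "\<exists>c. (\<forall>j<n. c j \<in> W j - T) \<and> inj_on c {..<n}"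
proof -
  have "\<exists>c. (\<forall>j<m. c j \<in> W j - T) \<and> inj_on c {..<m}" if "m \<le> n" for m
    using that
  proof (induction m)
    case (Suc m)
    then obtain c where c: "\<forall>j<m. c j \<in> W j - T" "inj_on c {..<m}" by auto
    have "card (T \<union> c ` {..<m}) \<le> card T + m"
      using card_Un_le[of T "c ` {..<m}"] card_image_le[of "{..<m}" c] by simp
    then have "card (T \<union> c ` {..<m}) < card (W m)" using assms(2)[of m] Suc.prems by simp
    then have "\<not> W m \<subseteq> T \<union> c ` {..<m}"
      using card_mono[of "T \<union> c ` {..<m}" "W m"] assms(1) by auto
    then obtain y where y: "y \<in> W m" "y \<notin> T" "y \<notin> c ` {..<m}" by blast
    have "inj_on (c(m := y)) {..<Suc m}"
      using c(2) y(3) by (auto simp: inj_on_def less_Suc_eq)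
    moreover have "\<forall>j<Suc m. (c(m := y)) j \<in> W j - T" using c(1) y by (auto simp: less_Suc_eq)
    ultimately show ?case by blast
  qed auto
  then show ?thesis by blast
qed

context simple_graph
begin

section \<open>Heavy cliques and the supply of light paths\<close>

text \<open>One of the \<open>k + 1\<close> vertices serves as hub, the others as rim, and the
  \<open>2 * k\<close> subdivision vertices are chosen greedily among common neighbours. The bound
  \<open>3 * k + 1\<close> is the sum of the \<open>k + 1\<close> clique vertices and the
  \<open>2 * k\<close> subdivision vertices.\<close>

lemma heavy_clique_wheel:
  assumes T: "card T = Suc k" "\<And>z w. z \<in> T \<Longrightarrow> w \<in> T \<Longrightarrow> z \<noteq> w \<Longrightarrow> heavy z w"
    and k: "2 \<le> k" and t: "3 * k + 1 \<le> t"
  shows "has_wheel adj k"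
proof -
  have finT: "finite T" using T(1) card.infinite by fastforce
  obtain h where h: "bij_betw h {..<Suc k} T"
    using ex_bij_betw_nat_finite[OF finT] T(1) by (auto simp: atLeast0LessThan)
  define W where "W j = (if j < k then nbrs (h k) \<inter> nbrs (h j)
      else nbrs (h (j - k)) \<inter> nbrs (h (Suc (j - k) mod k)))" for j
  have hT: "h i \<in> T" if "i \<le> k" for i using h that by (auto simp: bij_betw_def)
  have hneq: "h i \<noteq> h j" if "i \<le> k" "j \<le> k" "i \<noteq> j" for i j
    using h that by (auto simp: bij_betw_def inj_on_def less_Suc_eq_le)
  have hh: "t \<le> card (nbrs (h i) \<inter> nbrs (h j))" if "i \<le> k" "j \<le> k" "i \<noteq> j" for i j
    using T(2)[OF hT hT hneq] that by (auto simp: heavy_def)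
  have mk: "Suc i mod k \<le> k \<and> Suc i mod k \<noteq> i" if "i < k" for i
    using that k by (cases "Suc i = k") auto
  have "finite (W j) \<and> card T + 2 * k \<le> card (W j)" if "j < 2 * k" for j
  proof (cases "j < k")
    case True
    then show ?thesis using hh[of k j] T(1) t by (auto simp: W_def)
  next
    case False
    then have "j - k < k" using that by simp
    then show ?thesis using hh[of "j - k" "Suc (j - k) mod k"] mk[of "j - k"] T(1) t False
      by (auto simp: W_def)
  qed
  from exists_distinct_representatives[of T "2 * k" W, OF finT this]
  obtain c where c: "\<forall>j<2 * k. c j \<in> W j - T" "inj_on c {..<2 * k}" by auto
  have cT: "c j \<noteq> h i" if "j < 2 * k" "i \<le> k" for i j
    using c(1) hT[of i] that by auto
  have cc: "c i \<noteq> c j" if "i < 2 * k" "j < 2 * k" "i \<noteq> j" for i j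
    using c(2) that by (auto simp: inj_on_def)
  have edges: "adj (h k) (c i) \<and> adj (c i) (h i) \<and> adj (h i) (c (k + i)) \<and> adj (c (k + i)) (h (Suc i mod k))"
    if i: "i < k" for i
  proof -
    have "c i \<in> W i" "c (k + i) \<in> W (k + i)" using c(1) i by auto
    then show ?thesis using i adj_commute by (auto simp: W_def nbrs_def)
  qed
  have ne1: "h k \<noteq> h i \<and> h k \<noteq> c i \<and> h k \<noteq> c (k + i)" if "i < k" for i
    using that hneq[of k i] cT[of i k] cT[of "k + i" k] by auto
  have ne2: "h i \<noteq> c j \<and> h i \<noteq> c (k + j) \<and> c i \<noteq> c (k + j)" if "i < k" "j < k" for i j
    using that cT[of j i] cT[of "k + j" i] cc[of i "k + j"] by auto
  have ne3: "h i \<noteq> h j \<and> c i \<noteq> c j \<and> c (k + i) \<noteq> c (k + j)" if "i < k" "j < k" "i \<noteq> j" for i j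
    using that hneq[of i j] cc[of i j] cc[of "k + i" "k + j"] by auto
  show ?thesis
    unfolding has_wheel_def using edges ne1 ne2 ne3
    by (intro exI[of _ "h k"] exI[of _ h] exI[of _ c] exI[of _ "\<lambda>i. c (k + i)"]) simp
qed

lemma not_heavy_iff: "\<not> heavy x y \<longleftrightarrow> x = y \<or> light x y"
  by (auto simp: heavy_def light_def)

lemma heavy_sym: "heavy x y \<longleftrightarrow> heavy y x"
  by (auto simp: heavy_def Int_commute)

text \<open>A vertex with fewer than \<open>d\<close> light partners in \<open>S\<close> fails to be
  heavy to at most \<open>d\<close> vertices, itself included. More than \<open>k * d\<close> such
  vertices would therefore contain \<open>k + 1\<close> pairwise heavy ones, hence a wheel.\<close>

lemma few_vertices_with_few_light:
  assumes no: "\<not> has_wheel adj k" and k: "2 \<le> k" and t: "3 * k + 1 \<le> t" and S: "finite S"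
  shows "card {u \<in> S. card {w \<in> S. light u w} < d} \<le> k * d"
proof (rule ccontr)
  define B where "B = {u \<in> S. card {w \<in> S. light u w} < d}"
  assume "\<not> card {u \<in> S. card {w \<in> S. light u w} < d} \<le> k * d"
  then have big: "k * d < card B" by (simp add: B_def)
  have finB: "finite B" using S by (simp add: B_def)
  have "\<exists>T \<subseteq> B. card T = Suc k \<and> (\<forall>z\<in>T. \<forall>w\<in>T. z \<noteq> w \<longrightarrow> \<not> \<not> heavy z w)"
  proof (rule exists_pairwise_unrelated[OF finB _ _ _ big])
    fix z assume z: "z \<in> B"
    have "card {w \<in> B. \<not> heavy z w} \<le> card (insert z {w \<in> S. light z w})"
      using S by (intro card_mono) (auto simp: not_heavy_iff B_def)
    also have "\<dots> \<le> Suc (card {w \<in> S. light z w})" by (rule card_insert_le_m1) (auto simp: S)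
    also have "\<dots> \<le> d" using z by (auto simp: B_def)
    finally show "card {w \<in> B. \<not> heavy z w} \<le> d" .
  qed (auto simp: heavy_sym heavy_def)
  then obtain T where "T \<subseteq> B" "card T = Suc k" "\<And>z w. z \<in> T \<Longrightarrow> w \<in> T \<Longrightarrow> z \<noteq> w \<Longrightarrow> heavy z w"
    by auto
  then show False using heavy_clique_wheel[of T k] no k t by auto
qed

text \<open>A path is built around its middle edge \<open>(p, u)\<close>: \<open>v\<close> is a
  light partner of \<open>u\<close> among the neighbours of \<open>p\<close>, and \<open>b\<close> a
  light partner of \<open>p\<close> among the neighbours of \<open>u\<close>. Each vertex has at
  most \<open>k * d\<close> neighbours with too few light partners, so
  \<open>4 * k * d \<le> \<delta>\<close> leaves at least half of the oriented edges good in both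
  directions. These allow \<open>d\<close> choices of \<open>v\<close> and \<open>d - 1\<close>
  choices of \<open>b \<noteq> v\<close>.\<close>

lemma card_light_paths:
  assumes no: "\<not> has_wheel adj k" and k: "2 \<le> k" and t: "3 * k + 1 \<le> t"
    and deg: "\<And>y. y \<in> V \<Longrightarrow> \<delta> \<le> card (nbrs y)" and d: "4 * k * d \<le> \<delta>"
  shows "card V * \<delta> * (d * (d - 1)) \<le> 2 * (\<Sum>(v, b)\<in>V \<times> V. card (paths v b))"
proof -
  define D where "D = (SIGMA p:V. nbrs p)"
  define B1 where "B1 = (SIGMA p:V. {u \<in> nbrs p. card {w \<in> nbrs p. light u w} < d})"
  define B2 where "B2 = (\<lambda>(p, u). (u, p)) ` B1"
  define G where "G = D - (B1 \<union> B2)"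
  have finD: "finite D" "finite B1" using finV by (auto simp: D_def B1_def)
  have "card D = (\<Sum>p\<in>V. card (nbrs p))" unfolding D_def using finV by (intro card_SigmaI) auto
  also have "\<dots> \<ge> (\<Sum>p\<in>V. \<delta>)" using deg by (intro sum_mono) auto
  finally have cD: "card V * \<delta> \<le> card D" by simp
  have cB1: "card B1 \<le> card V * (k * d)"
    unfolding B1_def
    by (rule card_le_Sigma[where f = id and J = V and
          Y = "\<lambda>p. {u \<in> nbrs p. card {w \<in> nbrs p. light u w} < d}"])
      (use finV few_vertices_with_few_light[OF no k t] in auto)
  have cB2: "card B2 \<le> card V * (k * d)"
    unfolding B2_def using card_image_le[OF finD(2)] cB1 le_trans by blast
  have "card D \<le> card G + card (B1 \<union> B2)"
    unfolding G_def using diff_card_le_card_Diff[of "B1 \<union> B2" D] finD by (auto simp: B2_def)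
  also have "card (B1 \<union> B2) \<le> card B1 + card B2" by (rule card_Un_le)
  finally have "card D \<le> card G + 2 * (card V * (k * d))" using cB1 cB2 by linarith
  moreover have "4 * (card V * (k * d)) \<le> card V * \<delta>"
    using mult_le_mono2[OF d, of "card V"] by (simp add: algebra_simps)
  ultimately have cG: "card V * \<delta> \<le> 2 * card G" using cD by linarith
  define L where "L = {(v, p, u, b). light_path v p u b}"
  have LV: "L \<subseteq> V \<times> V \<times> V \<times> V"
    using adj_V' by (auto simp: L_def light_path_def)
  have finL: "finite L" using LV finV by (auto elim: finite_subset)
  define J where "J p u = {v \<in> nbrs p. light u v}" for p u
  have finX: "finite (J p u)" for p u by (auto simp: J_def)
  have XG: "d \<le> card (J p u)" "d \<le> card (J u p)" if "(p, u) \<in> G" for p u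
  proof -
    have "(p, u) \<in> D" "(p, u) \<notin> B1" "(u, p) \<notin> B1" using that by (force simp: G_def B2_def)+
    moreover have "u \<in> V" "p \<in> V" "p \<in> nbrs u" "u \<in> nbrs p"
      using \<open>(p, u) \<in> D\<close> adj_V' adj_commute by (auto simp: D_def nbrs_def)
    ultimately show "d \<le> card (J p u)" "d \<le> card (J u p)" by (auto simp: B1_def J_def)
  qed
  have "card G * (d * (d - 1)) = (\<Sum>g\<in>G. d * (d - 1))" by simp
  also have "\<dots> \<le> (\<Sum>g\<in>G. card (SIGMA v:J (fst g) (snd g). J (snd g) (fst g) - {v}))"
  proof (rule sum_mono)
    fix g assume g: "g \<in> G"
    obtain p u where pu: "g = (p, u)" by force
    have "d * (d - 1) \<le> card (J p u) * (d - 1)" using XG g pu by (intro mult_le_mono1) auto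
    also have "\<dots> = (\<Sum>v\<in>J p u. d - 1)" by simp
    also have "\<dots> \<le> (\<Sum>v\<in>J p u. card (J u p - {v}))"
    proof (rule sum_mono)
      fix v show "d - 1 \<le> card (J u p - {v})"
        using XG(2)[of p u] g pu finX[of u p] by (cases "v \<in> J u p") auto
    qed
    also have "\<dots> = card (SIGMA v:J p u. J u p - {v})"
      using finX by (intro card_SigmaI[symmetric]) auto
    finally show "d * (d - 1) \<le> card (SIGMA v:J (fst g) (snd g). J (snd g) (fst g) - {v})"
      by (simp add: pu)
  qed
  also have "\<dots> = card (SIGMA g:G. SIGMA v:J (fst g) (snd g). J (snd g) (fst g) - {v})"
    using finX finD by (intro card_SigmaI[symmetric]) (auto simp: G_def)
  also have "\<dots> \<le> card L"
  proof (rule card_inj_on_le[where f = "\<lambda>((p, u), (v, b)). (v, p, u, b)"])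
    show "(\<lambda>((p, u), (v, b)). (v, p, u, b)) `
        (SIGMA g:G. SIGMA v:J (fst g) (snd g). J (snd g) (fst g) - {v}) \<subseteq> L"
      by (auto simp: G_def D_def J_def nbrs_def L_def light_path_def adj_commute light_sym)
  qed (auto simp: inj_on_def finL)
  also have "card L = card (SIGMA w:V \<times> V. paths (fst w) (snd w))"
  proof (rule bij_betw_same_card[where f = "\<lambda>(v, p, u, b). ((v, b), (p, u))"],
      rule bij_betwI[where g = "\<lambda>((v, b), (p, u)). (v, p, u, b)"])
    show "(\<lambda>(v, p, u, b). ((v, b), (p, u))) \<in> L \<rightarrow> (SIGMA w:V \<times> V. paths (fst w) (snd w))"
      using LV by (auto simp: L_def paths_def)
  qed (auto simp: L_def paths_def)
  also have "\<dots> = (\<Sum>(v, b)\<in>V \<times> V. card (paths v b))"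
    using finV by (subst card_SigmaI) (auto simp: case_prod_unfold)
  finally have "card G * (d * (d - 1)) \<le> (\<Sum>(v, b)\<in>V \<times> V. card (paths v b))" .
  then have "(2 * card G) * (d * (d - 1)) \<le> 2 * (\<Sum>(v, b)\<in>V \<times> V. card (paths v b))" by simp
  moreover have "card V * \<delta> * (d * (d - 1)) \<le> (2 * card G) * (d * (d - 1))"
    using cG by (rule mult_le_mono1)
  ultimately show ?thesis by linarith
qed

section \<open>Hexagons from pairs of light paths\<close>

text \<open>For the inner vertices of two light paths with the same ends this says that the two
  paths form a hexagon all of whose pairs at distance two are light.\<close>

definition compatible :: "'a \<times> 'a \<Rightarrow> 'a \<times> 'a \<Rightarrow> bool" where
  "compatible z w \<longleftrightarrow> light (fst z) (fst w) \<and> light (snd z) (snd w) \<and> fst z \<noteq> snd w \<and> snd z \<noteq> fst w"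

text \<open>Ramsey's theorem is applied to the colouring of pairs of disjoint paths by
  the side on which they are heavy.\<close>

lemma many_compatible_paths:
  fixes r :: nat
  assumes no: "\<not> has_wheel adj k" and k: "2 \<le> k" and t: "3 * k + 1 \<le> t"
    and r: "1 \<le> r" "\<And>(Z :: ('a \<times> 'a) set) E. finite Z \<Longrightarrow> r \<le> card Z \<Longrightarrow>
        \<exists>R \<subseteq> Z. card R = Suc k \<and> (clique R E \<or> indep R E)"
    and q: "16 * t * r \<le> card (paths x y)"
  shows "card (paths x y) * card (paths x y) \<le>
    16 * r * card {(z, w). z \<in> paths x y \<and> w \<in> paths x y \<and> compatible z w}"
proof -
  define Z where "Z = paths x y"
  define clash where "clash z w \<longleftrightarrow> fst z \<noteq> fst w \<and> snd z \<noteq> snd w \<and> fst z \<noteq> snd w \<and> snd z \<noteq> fst w \<and>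
      (heavy (fst z) (fst w) \<or> heavy (snd z) (snd w))" for z w
  define d where "d = card Z div (2 * r)"
  have finZ: "finite Z" by (simp add: Z_def)
  define B where "B = {z \<in> Z. card {w \<in> Z. \<not> clash z w} \<le> d}"
  have finB: "finite B" using finZ by (simp add: B_def)
  \<comment> \<open>More than \<open>r * d\<close> paths, each failing to clash with at most
    \<open>d\<close> paths, would contain \<open>r + 1\<close> pairwise clashing ones. By Ramsey's
    theorem, \<open>k + 1\<close> of these have pairwise heavy first vertices or pairwise heavy
    second vertices.\<close>
  have cB: "card B \<le> r * d"
  proof (rule ccontr)
    assume "\<not> ?thesis"
    then have big: "r * d < card B" by simp
    have "\<exists>T \<subseteq> B. card T = Suc r \<and> (\<forall>z\<in>T. \<forall>w\<in>T. z \<noteq> w \<longrightarrow> \<not> \<not> clash z w)"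
    proof (rule exists_pairwise_unrelated[OF finB _ _ _ big])
      fix z assume z: "z \<in> B"
      have "card {w \<in> B. \<not> clash z w} \<le> card {w \<in> Z. \<not> clash z w}"
        using finZ by (intro card_mono) (auto simp: B_def)
      then show "card {w \<in> B. \<not> clash z w} \<le> d" using z by (simp add: B_def)
    qed (auto simp: clash_def heavy_sym)
    then obtain T where T: "T \<subseteq> B" "card T = Suc r" "\<And>z w. z \<in> T \<Longrightarrow> w \<in> T \<Longrightarrow> z \<noteq> w \<Longrightarrow> clash z w"
      by auto
    have finT: "finite T" using T(1) finB finite_subset by blast
    define E where "E = {{z, w} | z w :: 'a \<times> 'a. heavy (fst z) (fst w)}"
    obtain R where R: "R \<subseteq> T" "card R = Suc k" "clique R E \<or> indep R E"
      using r(2)[OF finT, of E] T(2) by auto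
    have TR: "z = w" if "z \<in> R" "w \<in> R" "fst z = fst w \<or> snd z = snd w" for z w
      using T(3)[of z w] R(1) that unfolding clash_def by blast
    have inj: "inj_on fst R" "inj_on snd R" by (rule inj_onI, rule TR; simp)+
    from R(3) show False
    proof
      assume cl: "clique R E"
      have H: "heavy a b" if ab: "a \<in> fst ` R" "b \<in> fst ` R" "a \<noteq> b" for a b
      proof -
        obtain z w where zw: "z \<in> R" "w \<in> R" "a = fst z" "b = fst w" using ab(1,2) by (meson imageE)
        have "z \<noteq> w" using zw ab(3) by metis
        then have "{z, w} \<in> E" using cl zw(1,2) unfolding clique_def by simp
        then obtain z' w' where "{z, w} = {z', w'}" "heavy (fst z') (fst w')" unfolding E_def by blast
        then show ?thesis using zw heavy_sym[of "fst z" "fst w"] by (auto simp: doubleton_eq_iff)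
      qed
      have "has_wheel adj k"
        by (rule heavy_clique_wheel[OF _ H k t]) (simp_all add: card_image[OF inj(1)] R(2))
      then show False using no by blast
    next
      assume cl: "indep R E"
      have H: "heavy a b" if ab: "a \<in> snd ` R" "b \<in> snd ` R" "a \<noteq> b" for a b
      proof -
        obtain z w where zw: "z \<in> R" "w \<in> R" "a = snd z" "b = snd w" using ab(1,2) by (meson imageE)
        have "z \<noteq> w" using zw ab(3) by metis
        then have "{z, w} \<notin> E" using cl zw(1,2) unfolding indep_def by simp
        then have "\<not> heavy (fst z) (fst w)" unfolding E_def by blast
        moreover have "clash z w" using T(3)[of z w] R(1) zw(1,2) \<open>z \<noteq> w\<close> by blast
        ultimately show ?thesis using zw unfolding clash_def by blast
      qed
      have "has_wheel adj k"
        by (rule heavy_clique_wheel[OF _ H k t]) (simp_all add: card_image[OF inj(2)] R(2))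
      then show False using no by blast
    qed
  qed
  have deg: "d - 4 * t \<le> card {w \<in> Z. compatible z w}" if z: "z \<in> Z - B" for z
  proof -
    obtain b u where zbu: "z = (b, u)" by force
    \<comment> \<open>\<open>Q\<close> covers the paths that meet \<open>z\<close>: in turn those
      with first vertex \<open>b\<close>, second vertex \<open>u\<close>, second vertex
      \<open>b\<close> and first vertex \<open>u\<close>. A path outside these that does not clash
      with \<open>z\<close> is compatible with it.\<close>
    define Q where "Q = Pair b ` common b y \<union> (\<lambda>c. (c, u)) ` common x u \<union> (\<lambda>c. (c, b)) ` common x b
        \<union> Pair u ` common u y"
    have finQ: "finite Q" by (auto simp: Q_def)
    have "{w \<in> Z. \<not> clash z w} \<subseteq> {w \<in> Z. compatible z w} \<union> Q"
    proof
      fix w assume w: "w \<in> {w \<in> Z. \<not> clash z w}"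
      obtain b2 u2 where w2: "w = (b2, u2)" by force
      have "light_path x b2 u2 y" using w by (simp add: w2 Z_def paths_def)
      note l = light_pathD(13,14)[OF this]
      show "w \<in> {w \<in> Z. compatible z w} \<union> Q"
      proof (cases "b = b2 \<or> u = u2 \<or> b = u2 \<or> u = b2")
        case True
        then show ?thesis using l by (auto simp: Q_def w2)
      next
        case False
        then have "compatible z w" using w
          by (auto simp: clash_def compatible_def zbu w2 not_heavy_iff)
        then show ?thesis using w by simp
      qed
    qed
    then have "card {w \<in> Z. \<not> clash z w} \<le> card ({w \<in> Z. compatible z w} \<union> Q)"
      using finZ finQ by (intro card_mono) auto
    also have "\<dots> \<le> card {w \<in> Z. compatible z w} + card Q" by (rule card_Un_le)
    also have "card Q \<le> 4 * t"
    proof -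
      have "card Q \<le> card (Pair b ` common b y) + card ((\<lambda>c. (c, u)) ` common x u)
          + card ((\<lambda>c. (c, b)) ` common x b) + card (Pair u ` common u y)"
        unfolding Q_def by (meson add_le_mono1 card_Un_le le_trans)
      also have "\<dots> \<le> t + t + t + t"
        by (intro add_mono order_trans[OF card_image_le card_common]) auto
      finally show ?thesis by simp
    qed
    finally have "card {w \<in> Z. \<not> clash z w} \<le> card {w \<in> Z. compatible z w} + 4 * t" by simp
    moreover have "d < card {w \<in> Z. \<not> clash z w}" using z by (auto simp: B_def)
    ultimately show ?thesis by linarith
  qed
  define P where "P = {(z, w). z \<in> Z \<and> w \<in> Z \<and> compatible z w}"
  have "card (Z - B) * (d - 4 * t) = (\<Sum>z\<in>Z - B. d - 4 * t)" by simp
  also have "\<dots> \<le> (\<Sum>z\<in>Z - B. card {w \<in> Z. compatible z w})" using deg by (intro sum_mono) auto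
  also have "\<dots> = card (SIGMA z:Z - B. {w \<in> Z. compatible z w})"
    using finZ by (intro card_SigmaI[symmetric]) auto
  also have "\<dots> \<le> card P"
    using finZ by (intro card_mono finite_subset[of P "Z \<times> Z"]) (auto simp: P_def)
  finally have cP: "card (Z - B) * (d - 4 * t) \<le> card P" .
  have "2 * r * d \<le> card Z" unfolding d_def by simp
  moreover have "card (Z - B) = card Z - card B"
    using finB by (intro card_Diff_subset) (auto simp: B_def)
  ultimately have h1: "card Z \<le> 2 * card (Z - B)" using cB by simp
  \<comment> \<open>Having \<open>16 * t * r\<close> paths makes the loss \<open>4 * t\<close> at
    most half of \<open>d\<close>.\<close>
  have "8 * t \<le> d"
    unfolding d_def using q r(1) by (simp add: less_eq_div_iff_mult_less_eq Z_def algebra_simps)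
  then have h2: "d \<le> 2 * (d - 4 * t)" by simp
  have "card Z < 2 * r * (d + 1)"
    unfolding d_def using r(1) dividend_less_times_div[of "2 * r" "card Z"] by (simp add: algebra_simps)
  also have "\<dots> \<le> 2 * r * (2 * d)"
    using \<open>8 * t \<le> d\<close> t by (intro mult_le_mono2) simp
  finally have h3: "card Z \<le> 4 * r * d" by simp
  have "card Z * card Z \<le> 2 * card (Z - B) * (4 * r * (2 * (d - 4 * t)))"
    using h1 h2 h3 by (intro mult_le_mono) (auto intro: le_trans)
  also have "\<dots> = 16 * r * (card (Z - B) * (d - 4 * t))" by simp
  also have "\<dots> \<le> 16 * r * card P" using cP by (rule mult_le_mono2)
  finally show ?thesis by (simp add: P_def Z_def)
qed

end

section \<open>Multiplicities of light paths and the choice of the hub\<close>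

lemma exists_ge_average:
  fixes f :: "'i \<Rightarrow> real" and w :: real
  assumes "finite I" "I \<noteq> {}" "card I * w \<le> (\<Sum>i\<in>I. f i)"
  shows "\<exists>i\<in>I. w \<le> f i"
proof (rule ccontr)
  assume "\<not> ?thesis"
  then have "(\<Sum>i\<in>I. f i) < (\<Sum>i\<in>I. w)"
    using assms by (intro sum_strict_mono) auto
  then show False using assms(3) by simp
qed

text \<open>\<open>W^2\<close> is \<open>Q\<close> times \<open>Q * F^2\<close> over a factor that
  does not depend on \<open>Q\<close>. So a lower bound for \<open>Q * F^2\<close>, transferred from
  \<open>Q0\<close>, makes \<open>W^2\<close> at least a multiple of \<open>Q * D^2\<close>. This is
  why \<open>Q * F^2\<close> is the quantity that gets maximised.\<close>

lemma rescaled_square_bound: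
  fixes Q Q0 F F0 c n D r s W :: real
  assumes pos: "0 \<le> Q" "0 \<le> Q0" "0 < n" "0 < D" "0 < r" "0 \<le> c"
    and F0: "c * n * D ^ 3 \<le> 2 * F0" and F: "Q0 * F0\<^sup>2 \<le> Q * F\<^sup>2"
    and W: "Q * F = W * (64 * r * n * D\<^sup>2)" and s: "(128 * r)\<^sup>2 * s \<le> Q0 * c\<^sup>2"
  shows "s * Q * D\<^sup>2 \<le> W\<^sup>2"
proof -
  have "(c * n * D ^ 3)\<^sup>2 \<le> (2 * F0)\<^sup>2" using F0 pos by (intro power_mono) auto
  then have "Q * (Q0 * (c * n * D ^ 3)\<^sup>2) \<le> Q * (Q0 * (2 * F0)\<^sup>2)"
    using pos by (intro mult_left_mono) auto
  also have "\<dots> = 4 * (Q * (Q0 * F0\<^sup>2))" by (simp add: eval_nat_numeral algebra_simps)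
  also have "\<dots> \<le> 4 * (Q * (Q * F\<^sup>2))" using F pos by (intro mult_left_mono) auto
  also have "\<dots> = 4 * (Q * F)\<^sup>2" by (simp add: eval_nat_numeral algebra_simps)
  also have "\<dots> = W\<^sup>2 * (128 * r)\<^sup>2 * (n\<^sup>2 * D ^ 4)" unfolding W by (simp add: eval_nat_numeral algebra_simps)
  also have "Q * (Q0 * (c * n * D ^ 3)\<^sup>2) = Q * (Q0 * c\<^sup>2) * D\<^sup>2 * (n\<^sup>2 * D ^ 4)" by (simp add: eval_nat_numeral algebra_simps)
  finally have *: "Q * (Q0 * c\<^sup>2) * D\<^sup>2 \<le> W\<^sup>2 * (128 * r)\<^sup>2"
    using pos by (simp add: mult_le_cancel_right_pos)
  have "Q * ((128 * r)\<^sup>2 * s) * D\<^sup>2 \<le> Q * (Q0 * c\<^sup>2) * D\<^sup>2"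
    using s pos by (intro mult_right_mono mult_left_mono) auto
  then have "(s * Q * D\<^sup>2) * (128 * r)\<^sup>2 \<le> W\<^sup>2 * (128 * r)\<^sup>2"
    using * by (simp only: mult.assoc mult.commute mult.left_commute)
  then show ?thesis by (rule mult_right_le_imp_le) (use pos in simp)
qed

lemma real_le_sum: "(a :: nat) \<le> (\<Sum>i\<in>I. f i) \<Longrightarrow> real a \<le> (\<Sum>i\<in>I. real (f i))"
  by (simp flip: of_nat_sum)

context simple_graph
begin

text \<open>Collects the constants of \<open>wheel_from_dense_arcs\<close>.\<close>

definition slack :: "nat \<Rightarrow> nat" where
  "slack k = (let N = 6 * k; S = 4 * N * (4 * t * N + 2 * t * t); T = 2 * N * (S + 2 * t * t)
     in 64 * N * (S + T + t * t * t + t) + 1600 * t * t * N * N)"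

definition nbhd2 :: "'a \<Rightarrow> ('a \<times> 'a) set" where
  "nbhd2 v = (SIGMA p:nbrs v. nbrs p)"

lemma finite_nbhd2: "finite (nbhd2 v)"
  by (auto simp: nbhd2_def)

lemma card_nbhd2:
  assumes "\<And>y. card (nbrs y) \<le> \<Delta>"
  shows "card (nbhd2 v) \<le> \<Delta> * \<Delta>"
  unfolding nbhd2_def
  by (rule card_le_Sigma[where f = id and J = "nbrs v" and Y = nbrs]) (use assms in auto)

text \<open>Together with \<open>v\<close> such a tuple is a closed walk
  \<open>v, p0, x, b', u', p'\<close> of length six whose opposite vertices \<open>x\<close> and
  \<open>p'\<close> are joined by at most \<open>M\<close> light paths.\<close>

definition good_arcs :: "nat \<Rightarrow> 'a \<Rightarrow> ('a \<times> 'a \<times> 'a \<times> 'a \<times> 'a) set" where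
  "good_arcs M v = {(p0, x, b', p', u'). arc v p0 x b' p' u' \<and> card (paths x p') \<le> M}"

lemma finite_good_arcs: "finite (good_arcs M v)"
  by (rule finite_subset[of _ "V \<times> V \<times> V \<times> V \<times> V"]) (use finV arc_V in \<open>auto simp: good_arcs_def\<close>)

lemma arc_nbhd2: "arc v p u b p' u' \<Longrightarrow> (p, u) \<in> nbhd2 v \<and> (p', u') \<in> nbhd2 v"
  by (auto simp: arc_def nbhd2_def nbrs_def light_path_def)

text \<open>An arc can be read backwards, so a target \<open>(p', u')\<close> with fewer than
  \<open>W\<close> outgoing arcs is hit by fewer than \<open>W\<close> arcs. As there are at most
  \<open>\<Delta> * \<Delta>\<close> targets, at least half of the required
  \<open>2 * W * \<Delta>^2\<close> arcs lead to targets with at least \<open>W\<close> outgoing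
  arcs. By averaging some \<open>(p0, x)\<close> starts at least \<open>W\<close> of these, and the
  number of their continuations, at least \<open>W^2 / 2\<close>, suffices for
  \<open>wheel_from_dense_arcs\<close> with \<open>M = 4 * Q\<close>.\<close>

lemma wheel_from_good_arcs:
  fixes W :: real
  assumes k: "4 \<le> k" and Q: "1 \<le> Q" and t: "1 \<le> t"
    and deg: "\<And>y. card (nbrs y) \<le> \<Delta>" and \<Delta>: "0 < \<Delta>"
    and W: "0 < W" "real (slack k) * real Q * (real \<Delta>)\<^sup>2 \<le> W\<^sup>2"
    and A: "2 * W * (real \<Delta>)\<^sup>2 \<le> card (good_arcs (4 * Q) v)"
  shows "has_wheel adj k"
proof -
  define N where "N = 6 * k"
  define S where "S = 4 * N * (4 * t * N + 2 * t * t)"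
  define T where "T = 2 * N * (S + 2 * t * t)"
  define S' where "S' = S + T + t * t * t + t"
  have slack: "slack k = 64 * N * S' + 1600 * t * t * N * N"
    by (simp add: slack_def S'_def S_def T_def N_def Let_def)
  define out where "out y = {(b, p, u). arc v (fst y) (snd y) b p u}" for y
  have fin_out: "finite (out y)" for y
    by (rule finite_subset[of _ "V \<times> V \<times> V"]) (use finV arc_V in \<open>auto simp: out_def\<close>)
  define M where "M = 4 * Q"
  define A where "A = good_arcs M v"
  have finA: "finite A" by (simp add: A_def finite_good_arcs)
  define tgt where "tgt = (\<lambda>(p0 :: 'a, x :: 'a, b' :: 'a, p' :: 'a, u' :: 'a). (p', u'))"
  define A' where "A' = {e \<in> A. W \<le> card (out (tgt e))}"
  have few: "card (A - A') \<le> W * \<Delta>\<^sup>2"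
  proof -
    have "card (A - A') = card (\<Union>y\<in>tgt ` (A - A'). {e \<in> A - A'. tgt e = y})"
      by (rule arg_cong[where f = card]) auto
    also have "\<dots> \<le> (\<Sum>y\<in>tgt ` (A - A'). card {e \<in> A - A'. tgt e = y})"
      using finA by (intro card_UN_le) auto
    finally have "real (card (A - A')) \<le> (\<Sum>y\<in>tgt ` (A - A'). real (card {e \<in> A - A'. tgt e = y}))"
      by (rule real_le_sum)
    also have "\<dots> \<le> (\<Sum>y\<in>tgt ` (A - A'). W)"
    proof (rule sum_mono)
      fix y assume y: "y \<in> tgt ` (A - A')"
      have "card {e \<in> A - A'. tgt e = y} \<le> card (out y)"
      proof (rule card_inj_on_le[where f = "\<lambda>(p0, x, b', p', u'). (b', p0, x)"])
        show "inj_on (\<lambda>(p0, x, b', p', u'). (b', p0, x)) {e \<in> A - A'. tgt e = y}"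
          by (auto simp: inj_on_def tgt_def)
        show "(\<lambda>(p0, x, b', p', u'). (b', p0, x)) ` {e \<in> A - A'. tgt e = y} \<subseteq> out y"
          by (auto simp: A_def good_arcs_def tgt_def out_def arc_sym)
      qed (rule fin_out)
      moreover have "card (out y) < W" using y by (auto simp: A'_def)
      ultimately show "real (card {e \<in> A - A'. tgt e = y}) \<le> W" by linarith
    qed
    also have "\<dots> = card (tgt ` (A - A')) * W" by simp
    also have "\<dots> \<le> real (\<Delta> * \<Delta>) * W"
    proof (rule mult_right_mono)
      have "card (tgt ` (A - A')) \<le> card (nbhd2 v)"
        using finite_nbhd2 arc_nbhd2 by (intro card_mono) (auto simp: A_def good_arcs_def tgt_def)
      then show "real (card (tgt ` (A - A'))) \<le> real (\<Delta> * \<Delta>)"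
        using card_nbhd2[OF deg, of v] by linarith
    qed (use W in simp)
    finally show ?thesis by (simp add: power2_eq_square algebra_simps)
  qed
  have "card A = card A' + card (A - A')"
    using finA by (intro card_partition) (auto simp: A'_def)
  then have cA': "W * \<Delta>\<^sup>2 \<le> card A'" using A few unfolding M_def[symmetric] A_def[symmetric] by simp
  have pos: "0 < W * (real \<Delta>)\<^sup>2" using W(1) \<Delta> by simp
  define RR where "RR y = {(b', p', u'). (fst y, snd y, b', p', u') \<in> A'}" for y
  have finRR: "finite (RR y)" for y
    by (rule finite_subset[of _ "V \<times> V \<times> V"])
      (use finV arc_V in \<open>auto simp: RR_def A'_def A_def good_arcs_def\<close>)
  have "\<exists>y\<in>nbhd2 v. W \<le> card (RR y)"
  proof (rule exists_ge_average[OF finite_nbhd2])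
    have "A' \<noteq> {}" using cA' pos by auto
    then show "nbhd2 v \<noteq> {}" using arc_nbhd2 by (fastforce simp: A'_def A_def good_arcs_def)
    have "card A' \<le> card (SIGMA y:nbhd2 v. RR y)"
    proof (rule card_inj_on_le[where f = "\<lambda>(p0, x, b', p', u'). ((p0, x), (b', p', u'))"])
      show "(\<lambda>(p0, x, b', p', u'). ((p0, x), (b', p', u'))) ` A' \<subseteq> (SIGMA y:nbhd2 v. RR y)"
        using arc_nbhd2 by (fastforce simp: A'_def A_def good_arcs_def RR_def)
    qed (use finite_nbhd2 finRR in \<open>auto simp: inj_on_def\<close>)
    also have "\<dots> = (\<Sum>y\<in>nbhd2 v. card (RR y))" using finite_nbhd2 finRR by (intro card_SigmaI) auto
    finally have "real (card A') \<le> (\<Sum>y\<in>nbhd2 v. real (card (RR y)))"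
      by (rule real_le_sum)
    moreover have "real (card (nbhd2 v)) * W \<le> real (\<Delta> * \<Delta>) * W"
      using card_nbhd2[OF deg, of v] W(1) by (intro mult_right_mono) (simp_all only: of_nat_le_iff less_imp_le)
    ultimately show "real (card (nbhd2 v)) * W \<le> (\<Sum>y\<in>nbhd2 v. real (card (RR y)))"
      using cA' by (simp add: power2_eq_square algebra_simps)
  qed
  then obtain p0 x where px: "W \<le> card (RR (p0, x))" by force
  define R where "R = RR (p0, x)"
  have R: "arc v p0 x b' p' u' \<and> card (paths x p') \<le> M \<and> W \<le> card (out (p', u'))"
    if "(b', p', u') \<in> R" for b' p' u'
    using that by (auto simp: R_def RR_def A'_def A_def good_arcs_def tgt_def)
  have finR: "finite R" by (simp add: R_def finRR)
  have Wsq: "real (64 * N * S' + 1600 * t * t * N * N) * real Q * \<Delta>\<^sup>2 \<le> W\<^sup>2"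
    using W(2) slack by simp
  \<comment> \<open>The summand \<open>1600 * t * t * N * N\<close> of \<open>slack\<close> is the
    square of \<open>40 * t * N\<close>.\<close>
  have W1: "40 * (t * N * \<Delta>) \<le> W"
  proof (rule power2_le_imp_le)
    have "(1600 * t * t * N * N) * 1 * \<Delta>\<^sup>2 \<le> (64 * N * S' + 1600 * t * t * N * N) * Q * \<Delta>\<^sup>2"
      using Q by (intro mult_le_mono) auto
    also have "(1600 * t * t * N * N) * 1 * \<Delta>\<^sup>2 = (40 * (t * N * \<Delta>))\<^sup>2"
      by (simp add: power2_eq_square)
    finally have "real ((40 * (t * N * \<Delta>))\<^sup>2) \<le> real ((64 * N * S' + 1600 * t * t * N * N) * Q * \<Delta>\<^sup>2)"
      by (simp only: of_nat_le_iff)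
    then show "(real (40 * (t * N * \<Delta>)))\<^sup>2 \<le> W\<^sup>2"
      using Wsq by (simp only: of_nat_power of_nat_mult)
  qed (use W in simp)
  have W2: "real (64 * N * S' * Q * \<Delta>\<^sup>2) \<le> W\<^sup>2"
  proof -
    have "64 * N * S' * Q * \<Delta>\<^sup>2 \<le> (64 * N * S' + 1600 * t * t * N * N) * Q * \<Delta>\<^sup>2"
      by (intro mult_le_mono) auto
    then have "real (64 * N * S' * Q * \<Delta>\<^sup>2) \<le> real ((64 * N * S' + 1600 * t * t * N * N) * Q * \<Delta>\<^sup>2)"
      by (simp only: of_nat_le_iff)
    then show ?thesis using Wsq by (simp only: of_nat_power of_nat_mult)
  qed
  \<comment> \<open>A continuation must not return to the vertex \<open>b'\<close> just used. This
    excludes at most \<open>\<Delta> * t\<close> of at least \<open>W\<close> arcs, which is less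
    than half by \<open>W1\<close>.\<close>
  define J where "J r = {w \<in> out (snd r). fst w \<noteq> fst r}" for r :: "'a \<times> 'a \<times> 'a"
  have J: "W / 2 \<le> card (J r)" if r: "r \<in> R" for r
  proof -
    obtain b' p' u' where rr: "r = (b', p', u')" by (cases r) auto
    have "card {w \<in> out (p', u'). fst w = b'} \<le> \<Delta> * t"
    proof (rule card_le_Sigma[where J = "nbrs b'" and Y = "common v" and f = "\<lambda>w. (snd (snd w), fst (snd w))"])
      show "(\<lambda>w. (snd (snd w), fst (snd w))) ` {w \<in> out (p', u'). fst w = b'} \<subseteq> Sigma (nbrs b') (common v)"
        using light_pathD(4,13) by (fastforce simp: out_def arc_def nbrs_def)
    qed (auto simp: inj_on_def card_common deg)
    moreover have "out (p', u') = J r \<union> {w \<in> out (p', u'). fst w = b'}" by (auto simp: J_def rr)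
    then have "card (out (p', u')) \<le> card (J r) + card {w \<in> out (p', u'). fst w = b'}"
      by (metis card_Un_le)
    ultimately have "card (out (p', u')) \<le> card (J r) + \<Delta> * t" by linarith
    moreover have "W \<le> card (out (p', u'))" using R r rr by auto
    moreover have "\<Delta> * t \<le> t * N * \<Delta>" using k by (simp add: N_def)
    ultimately show ?thesis using W1 by linarith
  qed
  have cE: "card (arc_pairs v R) = (\<Sum>r\<in>R. card (J r))"
  proof -
    have "card (arc_pairs v R) = card (SIGMA r:R. J r)"
    proof (rule bij_betw_same_card[where f = "\<lambda>((r, b), (p, u)). (r, (b, p, u))"],
        rule bij_betwI[where g = "\<lambda>(r, (b, p, u)). ((r, b), (p, u))"])
      show "(\<lambda>((r, b), (p, u)). (r, (b, p, u))) \<in> arc_pairs v R \<rightarrow> (SIGMA r:R. J r)"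
        by (auto simp: arc_pairs_def J_def out_def)
      show "(\<lambda>(r, (b, p, u)). ((r, b), (p, u))) \<in> (SIGMA r:R. J r) \<rightarrow> arc_pairs v R"
        by (auto simp: arc_pairs_def J_def out_def)
    qed auto
    also have "\<dots> = (\<Sum>r\<in>R. card (J r))" using finR fin_out by (intro card_SigmaI) (auto simp: J_def)
    finally show ?thesis .
  qed
  have cE2: "card R * (W / 2) \<le> card (arc_pairs v R)"
    unfolding cE of_nat_sum using sum_mono[of R "\<lambda>_. W / 2" "\<lambda>r. real (card (J r))"] J by simp
  have "W * (W / 2) \<le> card R * (W / 2)" using px W(1) by (intro mult_right_mono) (auto simp: R_def)
  then have cE3: "W\<^sup>2 / 2 \<le> card (arc_pairs v R)" using cE2 by (simp add: power2_eq_square)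
  show ?thesis
  proof (rule wheel_from_dense_arcs[where R = R and v = v and M = M and \<Delta> = \<Delta> and x = x and ?p0.0 = p0])
    show "20 * t * (6 * k) * (\<Delta> * card R) \<le> card (arc_pairs v R)"
    proof -
      have "real (20 * (t * N * \<Delta>)) * real (card R) \<le> W / 2 * real (card R)"
        using W1 by (intro mult_right_mono) auto
      then have "real (20 * t * (6 * k) * (\<Delta> * card R)) \<le> card (arc_pairs v R)"
        using cE2 by (simp add: N_def algebra_simps)
      then show ?thesis by (simp only: of_nat_le_iff)
    qed
    have "2 * (8 * N * S' * M * (\<Delta> * \<Delta>)) = 64 * N * S' * Q * \<Delta>\<^sup>2"
      by (simp add: M_def power2_eq_square)
    then have "real (2 * (8 * N * S' * M * (\<Delta> * \<Delta>))) \<le> W\<^sup>2" using W2 by (simp only:)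
    then have "2 * real (8 * N * S' * M * (\<Delta> * \<Delta>)) \<le> W\<^sup>2"
      by (simp only: of_nat_mult of_nat_numeral)
    then have "real (8 * N * S' * M * (\<Delta> * \<Delta>)) \<le> card (arc_pairs v R)" using cE3 by linarith
    then have "8 * N * S' * M * (\<Delta> * \<Delta>) \<le> card (arc_pairs v R)" by (simp only: of_nat_le_iff)
    then show "8 * (6 * k) * (4 * (6 * k) * (4 * t * (6 * k) + 2 * t * t) +
        2 * (6 * k) * (4 * (6 * k) * (4 * t * (6 * k) + 2 * t * t) + 2 * t * t) + t * t * t + t) * M * (\<Delta> * \<Delta>)
        \<le> card (arc_pairs v R)"
      unfolding S'_def T_def S_def N_def .
    have "0 < W\<^sup>2 / 2" using W(1) by simp
    then show "0 < card (arc_pairs v R)" using cE3 by linarith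
  qed (use k Q R deg in \<open>auto simp: M_def\<close>)
qed

text \<open>For the \<open>Q \<ge> Q0\<close> that maximises \<open>Q * F Q * F Q\<close>,
  comparison with \<open>4 * Q\<close> shows that at least half of the paths counted by
  \<open>F Q\<close> have ends joined by fewer than \<open>4 * Q\<close> paths. Each such pair of
  ends carries many hexagons, and some vertex is the hub of at least the average number of them. If
  \<open>Q0\<close> were larger, that average would suffice for
  \<open>wheel_from_good_arcs\<close>.\<close>

lemma light_path_count_bound:
  fixes r k Q0 :: nat and c :: real
  assumes no: "\<not> has_wheel adj k" and k: "4 \<le> k" and t: "3 * k + 1 \<le> t"
    and r: "1 \<le> r" "\<And>(Z :: ('a \<times> 'a) set) E. finite Z \<Longrightarrow> r \<le> card Z \<Longrightarrow>
        \<exists>R \<subseteq> Z. card R = Suc k \<and> (clique R E \<or> indep R E)"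
    and deg: "\<And>y. card (nbrs y) \<le> \<Delta>" and \<Delta>: "0 < \<Delta>" and V: "V \<noteq> {}"
    and Q0: "16 * t * r \<le> Q0"
    and L1: "2 * Q0 * (card V * card V) \<le> (\<Sum>(v, b)\<in>V \<times> V. card (paths v b))"
    and L2: "c * card V * \<Delta> ^ 3 \<le> (\<Sum>(v, b)\<in>V \<times> V. card (paths v b))" and c: "0 < c"
  shows "Q0 * c\<^sup>2 \<le> (128 * r)\<^sup>2 * slack k"
proof (rule ccontr)
  assume "\<not> ?thesis"
  then have big: "(128 * r)\<^sup>2 * slack k < Q0 * c\<^sup>2" by simp
  define n where "n = card V"
  have n: "0 < n" using V finV by (simp add: n_def card_gt_0_iff)
  define q where "q w = card (paths (fst w) (snd w))" for w
  define L where "L = (\<Sum>w\<in>V \<times> V. q w)"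
  have L: "L = (\<Sum>(v, b)\<in>V \<times> V. card (paths v b))" by (simp add: L_def q_def case_prod_unfold)
  define F where "F Q = (\<Sum>w\<in>V \<times> V. if Q \<le> q w then q w else 0)" for Q
  have finVV: "finite (V \<times> V)" using finV by simp
  have qn: "q w \<le> n * n" for w
    unfolding q_def n_def card_cartesian_product[symmetric] by (intro card_mono finVV paths_subset)
  have FL: "F Q \<le> L" for Q unfolding F_def L_def by (intro sum_mono) auto
  \<comment> \<open>Pairs of ends joined by fewer than \<open>Q0\<close> paths contribute at most
    \<open>Q0 * n * n\<close>, which is at most half of \<open>L\<close> by
    \<open>L1\<close>.\<close>
  have "L \<le> F Q0 + (\<Sum>w\<in>V \<times> V. Q0)"
    unfolding F_def L_def sum.distrib[symmetric] by (intro sum_mono) auto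
  then have F0: "L \<le> 2 * F Q0" using L1 by (simp add: L card_cartesian_product algebra_simps)
  have F_zero: "F Q = 0" if "n * n < Q" for Q
    unfolding F_def using qn that by (intro sum.neutral) (auto simp: not_le intro: le_less_trans)
  \<comment> \<open>A maximiser exists because \<open>F Q\<close> is at most \<open>L\<close> and
    vanishes for \<open>Q > n * n\<close>.\<close>
  have "\<exists>Q. Q0 \<le> Q \<and> (\<forall>Q'. Q0 \<le> Q' \<longrightarrow> Q' * (F Q' * F Q') \<le> Q * (F Q * F Q))"
  proof (rule Lattices_Big.ex_has_greatest_nat[where k = Q0 and b = "Suc (n * n * (L * L))"])
    show "\<forall>Q. Q0 \<le> Q \<longrightarrow> Q * (F Q * F Q) < Suc (n * n * (L * L))"
    proof (intro allI impI)
      fix Q show "Q * (F Q * F Q) < Suc (n * n * (L * L))"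
      proof (cases "Q \<le> n * n")
        case True
        then show ?thesis unfolding less_Suc_eq_le by (intro mult_le_mono FL)
      qed (simp add: F_zero)
    qed
  qed simp
  then obtain Q where Q: "Q0 \<le> Q" "\<And>Q'. Q0 \<le> Q' \<Longrightarrow> Q' * (F Q' * F Q') \<le> Q * (F Q * F Q)" by blast
  have "1 \<le> t * r" using t r(1) by simp
  then have Q1: "1 \<le> Q" using Q(1) Q0 by linarith
  have "4 * Q * (F (4 * Q) * F (4 * Q)) \<le> Q * (F Q * F Q)" using Q by simp
  then have "(2 * F (4 * Q))\<^sup>2 \<le> (F Q)\<^sup>2" using Q1 by (simp add: power2_eq_square)
  then have F4: "2 * F (4 * Q) \<le> F Q" by (rule power2_le_imp_le) simp
  define P where "P = {w \<in> V \<times> V. Q \<le> q w \<and> q w < 4 * Q}"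
  have finP: "finite P" using finVV by (simp add: P_def)
  have "F Q = F (4 * Q) + (\<Sum>w\<in>V \<times> V. if Q \<le> q w \<and> q w < 4 * Q then q w else 0)"
    unfolding F_def sum.distrib[symmetric] by (intro sum.cong) auto
  also have "(\<Sum>w\<in>V \<times> V. if Q \<le> q w \<and> q w < 4 * Q then q w else 0) = (\<Sum>w\<in>P. q w)"
    unfolding P_def using finVV by (rule sum.inter_filter[symmetric])
  finally have FP: "F Q \<le> 2 * (\<Sum>w\<in>P. q w)" using F4 by linarith
  define C where "C w = {(z, z'). z \<in> paths (fst w) (snd w) \<and> z' \<in> paths (fst w) (snd w) \<and> compatible z z'}" for w
  have finC: "finite (C w)" for w
    by (rule finite_subset[of _ "paths (fst w) (snd w) \<times> paths (fst w) (snd w)"]) (auto simp: C_def)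
  have "Q * (\<Sum>w\<in>P. q w) = (\<Sum>w\<in>P. Q * q w)" by (simp add: sum_distrib_left)
  also have "\<dots> \<le> (\<Sum>w\<in>P. 16 * r * card (C w))"
  proof (rule sum_mono)
    fix w assume w: "w \<in> P"
    have "Q * q w \<le> q w * q w" using w by (auto simp: P_def)
    also have "\<dots> \<le> 16 * r * card (C w)"
      unfolding q_def C_def using w Q0 Q(1) k
      by (intro many_compatible_paths[OF no _ t r]) (auto simp: P_def q_def)
    finally show "Q * q w \<le> 16 * r * card (C w)" .
  qed
  also have "\<dots> = 16 * r * card (SIGMA w:P. C w)"
    using finP finC by (subst card_SigmaI) (auto simp: sum_distrib_left)
  \<comment> \<open>The two paths \<open>x, b', u', p'\<close> and \<open>x, p0, v, p'\<close> of a
    compatible pair are read as an arc whose hub \<open>v\<close> is an inner vertex of the second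
    path.\<close>
  also have "card (SIGMA w:P. C w) \<le> card (SIGMA v:V. good_arcs (4 * Q) v)"
  proof (rule card_inj_on_le[where f = "\<lambda>((x, p'), ((b', u'), (p0, v))). (v, (p0, x, b', p', u'))"])
    show "(\<lambda>((x, p'), ((b', u'), (p0, v))). (v, (p0, x, b', p', u'))) ` (SIGMA w:P. C w)
        \<subseteq> (SIGMA v:V. good_arcs (4 * Q) v)"
    proof (rule image_subsetI)
      fix e assume e: "e \<in> (SIGMA w:P. C w)"
      obtain x p' b' u' p0 v where ee: "e = ((x, p'), ((b', u'), (p0, v)))" by (metis prod.exhaust)
      have l: "light_path x b' u' p'" "light_path x p0 v p'" "compatible (b', u') (p0, v)"
        using e by (auto simp: ee C_def paths_def)
      have "arc v p0 x b' p' u'"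
        using l adj_commute light_sym unfolding arc_def light_path_def compatible_def by auto
      moreover have "card (paths x p') \<le> 4 * Q" using e by (auto simp: ee P_def q_def)
      moreover have "v \<in> V" using l(2) adj_V' by (auto simp: light_path_def)
      ultimately show "(\<lambda>((x, p'), ((b', u'), (p0, v))). (v, (p0, x, b', p', u'))) e
          \<in> (SIGMA v:V. good_arcs (4 * Q) v)"
        by (simp add: ee good_arcs_def)
    qed
  qed (use finV finite_good_arcs in \<open>auto simp: inj_on_def\<close>)
  also have "card (SIGMA v:V. good_arcs (4 * Q) v) = (\<Sum>v\<in>V. card (good_arcs (4 * Q) v))"
    using finV finite_good_arcs by (intro card_SigmaI) auto
  finally have "Q * (\<Sum>w\<in>P. q w) \<le> 16 * r * (\<Sum>v\<in>V. card (good_arcs (4 * Q) v))" by simp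
  moreover have "Q * F Q \<le> Q * (2 * (\<Sum>w\<in>P. q w))" using FP by (rule mult_le_mono2)
  ultimately have "Q * F Q \<le> 32 * r * (\<Sum>v\<in>V. card (good_arcs (4 * Q) v))" by linarith
  then have "real (Q * F Q) \<le> real (32 * r * (\<Sum>v\<in>V. card (good_arcs (4 * Q) v)))"
    by (simp only: of_nat_le_iff)
  then have sumG: "real Q * real (F Q) \<le> 32 * real r * (\<Sum>v\<in>V. real (card (good_arcs (4 * Q) v)))"
    by (simp only: of_nat_mult of_nat_sum of_nat_numeral)
  define W where "W = real Q * real (F Q) / (64 * real r * real n * (real \<Delta>)\<^sup>2)"
  have rpos: "0 < real r" using r(1) by simp
  have WF: "real Q * real (F Q) = W * (64 * real r * real n * (real \<Delta>)\<^sup>2)"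
    using n \<Delta> rpos by (simp add: W_def)
  have "\<exists>v\<in>V. 2 * W * (real \<Delta>)\<^sup>2 \<le> card (good_arcs (4 * Q) v)"
  proof (rule exists_ge_average[OF finV V])
    have "32 * real r * (real n * (2 * W * (real \<Delta>)\<^sup>2)) = real Q * real (F Q)"
      unfolding WF by (simp add: eval_nat_numeral algebra_simps)
    then have "32 * real r * (real n * (2 * W * (real \<Delta>)\<^sup>2)) \<le> 32 * real r * (\<Sum>v\<in>V. real (card (good_arcs (4 * Q) v)))"
      using sumG by simp
    then show "real (card V) * (2 * W * (real \<Delta>)\<^sup>2) \<le> (\<Sum>v\<in>V. real (card (good_arcs (4 * Q) v)))"
      unfolding n_def by (rule mult_left_le_imp_le) (use rpos in simp)
  qed
  then obtain v where v: "2 * W * (real \<Delta>)\<^sup>2 \<le> card (good_arcs (4 * Q) v)" by blast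
  have Wsq: "real (slack k) * real Q * (real \<Delta>)\<^sup>2 \<le> W\<^sup>2"
  proof (rule rescaled_square_bound[OF _ _ _ _ rpos _ _ _ WF, where c = c and ?Q0.0 = Q0 and ?F0.0 = "F Q0"])
    have "real L \<le> real (2 * F Q0)" using F0 by (simp only: of_nat_le_iff)
    then show "c * real n * real \<Delta> ^ 3 \<le> 2 * real (F Q0)" using L2 unfolding L n_def by simp
    have "Q0 * (F Q0 * F Q0) \<le> Q * (F Q * F Q)" using Q(2)[of Q0] by simp
    then have "real (Q0 * (F Q0 * F Q0)) \<le> real (Q * (F Q * F Q))" by (simp only: of_nat_le_iff)
    then show "real Q0 * (real (F Q0))\<^sup>2 \<le> real Q * (real (F Q))\<^sup>2" by (simp add: power2_eq_square)
    show "(128 * real r)\<^sup>2 * real (slack k) \<le> real Q0 * c\<^sup>2" using big by simp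
  qed (use n \<Delta> c in auto)
  have "0 < slack k" using k t by (auto simp: slack_def Let_def)
  then have "0 < real (slack k) * real Q * (real \<Delta>)\<^sup>2" using Q1 \<Delta> by simp
  then have "0 < W\<^sup>2" using Wsq by linarith
  moreover have "0 \<le> W" by (simp add: W_def)
  ultimately have Wpos: "0 < W" by (simp add: zero_less_power2 order_le_less)
  have "has_wheel adj k"
    by (rule wheel_from_good_arcs[OF k Q1 _ deg \<Delta> Wpos Wsq v]) (use t in simp)
  then show False using no by blast
qed

end

section \<open>The bound for almost regular graphs\<close>

text \<open>Almost regularity turns the count of light paths into at least
  \<open>c * n * \<Delta>^3\<close>, so the average over pairs of ends is at least
  \<open>c * \<Delta>^3 / n\<close>. If \<open>\<Delta>^3\<close> were much larger than
  \<open>n\<close>, half of this, rounded down, would be a value of \<open>Q0\<close> that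
  \<open>light_path_count_bound\<close> forbids.\<close>

lemma almost_regular_wheel_free_bound:
  fixes K :: real
  assumes k: "4 \<le> k" and K: "1 \<le> K"
  shows "\<exists>C>0. \<forall>(adj :: 'a \<Rightarrow> 'a \<Rightarrow> bool) V \<delta> \<Delta>.
    simple_graph adj V \<longrightarrow> V \<noteq> {} \<longrightarrow> \<not> has_wheel adj k \<longrightarrow>
    (\<forall>y\<in>V. \<delta> \<le> card {z. adj y z}) \<longrightarrow> (\<forall>y\<in>V. card {z. adj y z} \<le> \<Delta>) \<longrightarrow> real \<Delta> \<le> K * real \<delta> \<longrightarrow>
    real \<Delta> ^ 3 \<le> C * real (card V)"
proof -
  obtain r where r: "1 \<le> r" "\<And>(Z :: ('a \<times> 'a) set) E. finite Z \<Longrightarrow> r \<le> card Z \<Longrightarrow>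
        \<exists>R \<subseteq> Z. card R = Suc k \<and> (clique R E \<or> indep R E)"
    using ramsey2[where m = "Suc k" and n = "Suc k" and ?'a = "'a \<times> 'a"] by metis
  define t where "t = 3 * k + 1"
  define c where "c = 1 / (128 * real k ^ 2 * K ^ 3)"
  have kpos: "0 < real k" using k by simp
  have c: "0 < c" using kpos K by (simp add: c_def)
  define B where "B = (128 * real r)\<^sup>2 * real (simple_graph.slack t k)"
  \<comment> \<open>In turn, the three summands ensure that \<open>Q0\<close> exceeds
    \<open>B / c^2\<close>, that \<open>Q0\<close> exceeds \<open>16 * t * r\<close>, and that
    \<open>\<delta>\<close> exceeds \<open>16 * k\<close>.\<close>
  define C where "C = 2 * (B / c\<^sup>2 + 1) / c + 2 * (16 * real t * real r + 1) / c + 256 * (real k)\<^sup>2 * K ^ 3"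
  have B0: "0 \<le> B" by (simp add: B_def)
  have C: "2 * (B / c\<^sup>2 + 1) / c \<le> C" "2 * (16 * real t * real r + 1) / c \<le> C" "256 * (real k)\<^sup>2 * K ^ 3 \<le> C"
    "0 < C"
  proof -
    have "0 \<le> 2 * (B / c\<^sup>2 + 1) / c" "0 \<le> 2 * (16 * real t * real r + 1) / c" "0 < 256 * (real k)\<^sup>2 * K ^ 3"
      using B0 c kpos K by (auto intro!: divide_nonneg_pos mult_nonneg_nonneg add_nonneg_nonneg)
    then show "2 * (B / c\<^sup>2 + 1) / c \<le> C" "2 * (16 * real t * real r + 1) / c \<le> C"
      "256 * (real k)\<^sup>2 * K ^ 3 \<le> C" "0 < C"
      unfolding C_def by linarith+
  qed
  have "real \<Delta> ^ 3 \<le> C * real (card V)"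
    if g: "simple_graph adj V" and V: "V \<noteq> {}" and no: "\<not> has_wheel adj k"
      and low: "\<forall>y\<in>V. \<delta> \<le> card {z. adj y z}" and up: "\<forall>y\<in>V. card {z. adj y z} \<le> \<Delta>"
      and \<Delta>K: "real \<Delta> \<le> K * real \<delta>"
    for adj :: "'a \<Rightarrow> 'a \<Rightarrow> bool" and V \<delta> \<Delta>
  proof (rule ccontr)
    assume "\<not> ?thesis"
    then have big: "C * card V < real \<Delta> ^ 3" by simp
    interpret simple_graph adj V t by (rule g)
    define n where "n = card V"
    have n: "0 < real n" using V finV by (simp add: n_def card_gt_0_iff)
    have \<Delta>0: "0 < \<Delta>"
    proof (rule ccontr)
      assume "\<not> 0 < \<Delta>"
      then have "C * n < 0" using big n_def by simp
      then show False using C(4) n by (simp add: mult_less_0_iff)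
    qed
    have deg: "card (nbrs y) \<le> \<Delta>" for y
    proof (cases "y \<in> V")
      case True then show ?thesis using up by (simp add: nbrs_def)
    next
      case False
      then have "nbrs y = {}" using adj_V by (auto simp: nbrs_def)
      then show ?thesis by simp
    qed
    have deg': "\<delta> \<le> card (nbrs y)" if "y \<in> V" for y using low that by (simp add: nbrs_def)
    obtain y where "y \<in> V" using V by blast
    \<comment> \<open>Since degrees are at most \<open>n\<close>, the assumption
      \<open>C * n < \<Delta>^3\<close> also forces \<open>\<delta>\<close> above
      \<open>16 * k\<close>; this makes the rounding in \<open>d\<close> and the step from
      \<open>d\<close> to \<open>d - 1\<close> harmless.\<close>
    then have "\<delta> \<le> n" using deg'[of y] card_mono[OF finV nbrs_subset[of y]] by (simp add: n_def)
    then have "real \<Delta> \<le> K * n" using \<Delta>K K by (meson of_nat_le_iff mult_left_mono order_trans zero_le_one)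
    then have "C * real \<Delta> \<le> K * (C * n)" using mult_left_mono[of "real \<Delta>" "K * n" C] C(4) by (simp add: algebra_simps)
    also have "\<dots> < K * real \<Delta> ^ 3" using big K by (simp add: n_def)
    also have "\<dots> = K * (real \<Delta>)\<^sup>2 * real \<Delta>" by (simp add: power2_eq_square power3_eq_cube)
    finally have "C < K * (real \<Delta>)\<^sup>2" using \<Delta>0 by simp
    then have "256 * (real k)\<^sup>2 * K ^ 3 < K * (real \<Delta>)\<^sup>2" using C(3) by linarith
    also have "\<dots> \<le> K * (K * real \<delta>)\<^sup>2" using \<Delta>K K by (intro mult_left_mono power_mono) auto
    finally have "(16 * real k)\<^sup>2 * K ^ 3 < (real \<delta>)\<^sup>2 * K ^ 3"
      by (simp add: power2_eq_square power3_eq_cube algebra_simps)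
    then have "(16 * real k)\<^sup>2 < (real \<delta>)\<^sup>2" using K by simp
    then have \<delta>k: "16 * real k < real \<delta>" by (rule power2_less_imp_less) simp
    define d where "d = \<delta> div (4 * k)"
    have dd: "4 * k * d \<le> \<delta>" by (simp add: d_def)
    have "\<delta> < 4 * k * (d + 1)"
      unfolding d_def using k dividend_less_times_div[of "4 * k" \<delta>] by (simp add: algebra_simps)
    then have "real \<delta> < real (4 * k * (d + 1))" by (simp only: of_nat_less_iff)
    then have d0: "real \<delta> < 4 * (real k * real d) + 4 * real k" by (simp add: algebra_simps)
    have "d \<noteq> 0" using d0 \<delta>k by (cases "d = 0") auto
    then have "real k * real (d - 1) = real k * real d - real k" by (simp add: of_nat_diff right_diff_distrib)
    then have d1: "real \<delta> \<le> 8 * (real k * real (d - 1))" "real \<delta> \<le> 8 * (real k * real d)"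
      using d0 \<delta>k by linarith+
    define L where "L = (\<Sum>(v, b)\<in>V \<times> V. card (paths v b))"
    have L: "n * \<delta> * (d * (d - 1)) \<le> 2 * L"
      unfolding n_def L_def by (rule card_light_paths[OF no _ _ deg' dd]) (use k in \<open>auto simp: t_def\<close>)
    have "real \<delta> * real \<delta> \<le> (8 * (real k * real d)) * (8 * (real k * real (d - 1)))"
      using d1 by (intro mult_mono) auto
    then have "(real n * real \<delta>) * (real \<delta> * real \<delta>) \<le>
        (real n * real \<delta>) * ((8 * (real k * real d)) * (8 * (real k * real (d - 1))))"
      by (rule mult_left_mono) simp
    also have "\<dots> = 64 * (real k)\<^sup>2 * real (n * \<delta> * (d * (d - 1)))"
      by (simp add: power2_eq_square)
    also have "\<dots> \<le> 64 * (real k)\<^sup>2 * real (2 * L)"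
      using L by (intro mult_left_mono) (simp only: of_nat_le_iff, simp)
    finally have nL: "real n * real \<delta> ^ 3 \<le> 128 * (real k)\<^sup>2 * real L"
      by (simp add: power3_eq_cube algebra_simps)
    have "real n * real \<Delta> ^ 3 \<le> real n * (K * real \<delta>) ^ 3"
      using \<Delta>K by (intro mult_left_mono power_mono) auto
    also have "\<dots> = K ^ 3 * (real n * real \<delta> ^ 3)" by (simp add: power_mult_distrib)
    also have "\<dots> \<le> K ^ 3 * (128 * (real k)\<^sup>2 * real L)" using nL K by (intro mult_left_mono) auto
    finally have cL: "c * n * real \<Delta> ^ 3 \<le> L"
      using kpos K by (simp add: c_def field_simps)
    define x where "x = c * real \<Delta> ^ 3 / (2 * n)"
    define Q0 where "Q0 = nat \<lfloor>x\<rfloor>"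
    have x0: "0 \<le> x" using c n by (simp add: x_def)
    have Q0: "real Q0 \<le> x" "x - 1 < real Q0" unfolding Q0_def using x0 by linarith+
    have "C * c / 2 < x"
      using big c n unfolding x_def n_def[symmetric] by (simp add: field_simps)
    moreover have "2 * (B / c\<^sup>2 + 1) \<le> C * c" "2 * (16 * real t * real r + 1) \<le> C * c"
      using C(1,2) by (simp_all only: pos_divide_le_eq[OF c])
    moreover have "b < real Q0" if "y / 2 < x" "2 * (b + 1) \<le> y" for b y
    proof -
      have "b + 1 \<le> y / 2" using that(2) by simp
      then show ?thesis using that(1) Q0(2) by linarith
    qed
    ultimately have x1: "B / c\<^sup>2 < Q0" "16 * real t * real r < Q0" by blast+
    have "16 * t * r \<le> Q0"
    proof -
      have "real (16 * t * r) \<le> real Q0" using x1(2) by simp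
      then show ?thesis by (simp only: of_nat_le_iff)
    qed
    moreover have "2 * Q0 * (n * n) \<le> L"
    proof -
      have "real Q0 * (2 * n * n) \<le> x * (2 * n * n)" using Q0(1) by (intro mult_right_mono) auto
      also have "\<dots> = c * n * real \<Delta> ^ 3" using n by (simp add: x_def field_simps)
      finally have "real (2 * Q0 * (n * n)) \<le> real L" using cL by simp
      then show ?thesis by (simp only: of_nat_le_iff)
    qed
    ultimately have "Q0 * c\<^sup>2 \<le> B"
      using light_path_count_bound[OF no k _ r deg \<Delta>0 V, of Q0 c] cL c
      unfolding n_def L_def B_def by (simp add: t_def)
    then show False using x1(1) c by (simp add: field_simps)
  qed
  then show ?thesis using C(4) by blast
qed

section \<open>The upper bound\<close>

text \<open>Copies need not be induced, so the image of \<open>F\<close> under an injective map that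
  preserves edges serves as the subgraph.\<close>

lemma contains_copyI:
  assumes F: "finite_simple_graph F" and inj: "inj_on f (verts F)" and V: "f ` verts F \<subseteq> verts G"
    and E: "\<And>e. e \<in> edges F \<Longrightarrow> f ` e \<in> edges G"
  shows "contains_copy G F"
proof -
  define H where "H = (f ` verts F, (\<lambda>e. f ` e) ` edges F)"
  have FE: "e \<subseteq> verts F" "card e = 2" if "e \<in> edges F" for e
    using F that by (auto simp: finite_simple_graph_def)
  have "card (f ` e) = 2" if "e \<in> edges F" for e
    using FE[OF that] inj by (metis card_image inj_on_subset)
  moreover have "f ` e \<subseteq> f ` verts F" if "e \<in> edges F" for e
    using FE(1)[OF that] by (rule image_mono)
  ultimately have "finite_simple_graph H"
    using F unfolding finite_simple_graph_def H_def by simp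
  then have "subgraph H G"
    using V E by (auto simp: subgraph_def H_def)
  moreover have "isomorphic H F"
    unfolding isomorphic_def
  proof (intro exI conjI)
    show "bij_betw (inv_into (verts F) f) (verts H) (verts F)"
      unfolding H_def using inj by (simp add: bij_betw_inv_into inj_on_imp_bij_betw)
    have "inv_into (verts F) f ` f ` e = e" if "e \<in> edges F" for e
      using FE(1)[OF that] inj by simp
    then show "(`) (inv_into (verts F) f) ` edges H = edges F"
      unfolding H_def by (simp add: image_image)
  qed
  ultimately show ?thesis unfolding contains_copy_def by blast
qed

lemma contains_copyE:
  assumes "contains_copy G F" and F: "\<And>e. e \<in> edges F \<Longrightarrow> e \<subseteq> verts F"
  obtains f where "inj_on f (verts F)" "f ` verts F \<subseteq> verts G" "\<And>e. e \<in> edges F \<Longrightarrow> f ` e \<in> edges G"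
proof -
  obtain H g where H: "subgraph H G" and g: "bij_betw g (verts H) (verts F)" "(\<lambda>e. g ` e) ` edges H = edges F"
    using assms(1) unfolding contains_copy_def isomorphic_def by blast
  have bij: "bij_betw (inv_into (verts H) g) (verts F) (verts H)" using g(1) by (rule bij_betw_inv_into)
  show ?thesis
  proof
    show "inj_on (inv_into (verts H) g) (verts F)" using bij by (simp add: bij_betw_def)
    show "inv_into (verts H) g ` verts F \<subseteq> verts G" using bij H by (simp add: bij_betw_def subgraph_def)
    fix e assume "e \<in> edges F"
    then obtain e' where e': "e' \<in> edges H" "e = g ` e'" using g(2) by blast
    have "e' \<subseteq> verts H" using H e'(1) by (auto simp: subgraph_def finite_simple_graph_def)
    then have "inv_into (verts H) g ` e = e'"
      using g(1) e'(2) by (simp add: bij_betw_def)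
    then show "inv_into (verts H) g ` e \<in> edges G" using H e'(1) by (auto simp: subgraph_def)
  qed
qed

definition rim :: "nat \<Rightarrow> nat \<Rightarrow> nat option set" where
  "rim k i = {Some i, Some (Suc i mod k)}"

definition spoke :: "nat \<Rightarrow> nat option set" where
  "spoke i = {None, Some i}"

lemma edges_wheel: "edges (add_apex (cycle_graph k)) = rim k ` {..<k} \<union> spoke ` {..<k}"
proof -
  have "edges (cycle_graph k) = (\<lambda>i. {i, Suc i mod k}) ` {..<k}"
    by (auto simp: cycle_graph_def)
  moreover have "{{None, Some v} | v. v \<in> verts (cycle_graph k)} = spoke ` {..<k}"
    by (auto simp: cycle_graph_def spoke_def)
  ultimately show ?thesis by (simp add: add_apex_def image_image rim_def)
qed

lemma verts_wheel: "verts (add_apex (cycle_graph k)) = insert None (Some ` {..<k})"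
  by (simp add: add_apex_def cycle_graph_def)

text \<open>If different rim edges were equal, each of \<open>i\<close> and \<open>j\<close> would
  be the successor of the other modulo \<open>k\<close>, which is impossible for
  \<open>k \<ge> 3\<close>.\<close>

lemma rim_inj:
  assumes "3 \<le> k" "i < k" "j < k" "rim k i = rim k j"
  shows "i = j"
proof (rule ccontr)
  assume "i \<noteq> j"
  then have ij: "i = Suc j mod k" "j = Suc i mod k" using assms(4) by (auto simp: rim_def doubleton_eq_iff)
  show False
  proof (cases "Suc i = k")
    case True
    then have "j = 0" using ij(2) by simp
    then have "i = 1" using ij(1) assms(1) by simp
    then show False using True assms(1) by simp
  next
    case False
    then have "j = Suc i" using ij(2) assms(2) by simp
    then show False using ij(1) assms(1,3) by (cases "Suc j = k") auto
  qed
qed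

lemma finite_simple_graph_subdivided_wheel:
  "finite_simple_graph (subdivision1 (add_apex (cycle_graph k)))"
proof -
  have "e \<subseteq> verts (add_apex (cycle_graph k))" if "e \<in> edges (add_apex (cycle_graph k))" for e
    using that unfolding edges_wheel verts_wheel by (auto simp: rim_def spoke_def)
  moreover have "finite (verts (add_apex (cycle_graph k)))" "finite (edges (add_apex (cycle_graph k)))"
    unfolding edges_wheel verts_wheel by auto
  ultimately show ?thesis
    unfolding finite_simple_graph_def subdivision1_def by auto
qed

lemma has_wheel_contains_copy:
  assumes k: "3 \<le> k" and w: "has_wheel adj k"
    and adj: "\<And>x y. adj x y \<Longrightarrow> x \<in> verts G \<and> y \<in> verts G \<and> {x, y} \<in> edges G"
  shows "contains_copy G (subdivision1 (add_apex (cycle_graph k)))"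
proof -
  obtain v a p b where vapb:
    "\<forall>i<k. adj v (p i) \<and> adj (p i) (a i) \<and> adj (a i) (b i) \<and> adj (b i) (a (Suc i mod k))"
    "\<forall>i<k. v \<noteq> a i \<and> v \<noteq> p i \<and> v \<noteq> b i"
    "\<forall>i<k. \<forall>j<k. a i \<noteq> p j \<and> a i \<noteq> b j \<and> p i \<noteq> b j"
    "\<forall>i<k. \<forall>j<k. i \<noteq> j \<longrightarrow> a i \<noteq> a j \<and> p i \<noteq> p j \<and> b i \<noteq> b j"
    using w unfolding has_wheel_def by blast
  have e: "adj v (p i)" "adj (p i) (a i)" "adj (a i) (b i)" "adj (b i) (a (Suc i mod k))" if "i < k" for i
    using vapb(1) that by auto
  \<comment> \<open>This inverts \<open>spoke\<close> and \<open>rim k\<close>: an edge with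
    \<open>None\<close> is the spoke at the only \<open>i\<close> with \<open>Some i\<close> in it,
    and the index of a rim edge is unique by \<open>rim_inj\<close>.\<close>
  define m where "m e = (if None \<in> e then p (THE i. Some i \<in> e) else b (THE i. i < k \<and> e = rim k i))" for e
  define f where "f = case_sum (case_option v a) m"
  have f1: "f (Inl None) = v" "f (Inl (Some i)) = a i" for i by (simp_all add: f_def)
  have f2: "f (Inr (spoke i)) = p i" for i
    by (simp add: f_def m_def spoke_def)
  have f3: "f (Inr (rim k i)) = b i" if "i < k" for i
  proof -
    have "(THE j. j < k \<and> rim k i = rim k j) = i"
      using that rim_inj[OF k] by (intro the_equality) auto
    moreover have "None \<notin> rim k i" by (simp add: rim_def)
    ultimately show ?thesis by (simp add: f_def m_def)
  qed
  have verts: "verts (subdivision1 (add_apex (cycle_graph k))) =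
      insert (Inl None) ((Inl \<circ> Some) ` {..<k} \<union> (Inr \<circ> rim k) ` {..<k} \<union> (Inr \<circ> spoke) ` {..<k})"
    by (simp add: subdivision1_def edges_wheel verts_wheel image_Un image_comp Un_assoc)
  show ?thesis
  proof (rule contains_copyI[where f = f, OF finite_simple_graph_subdivided_wheel])
    have ne1: "v \<noteq> a i" "v \<noteq> p i" "v \<noteq> b i" "a i \<noteq> v" "p i \<noteq> v" "b i \<noteq> v" if "i < k" for i
      using vapb(2) that by metis+
    have ne2: "a i = a j \<longleftrightarrow> i = j" "p i = p j \<longleftrightarrow> i = j" "b i = b j \<longleftrightarrow> i = j"
      "a i \<noteq> p j" "a i \<noteq> b j" "p i \<noteq> b j" "p j \<noteq> a i" "b j \<noteq> a i" "b j \<noteq> p i"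
      if "i < k" "j < k" for i j
      using vapb(3,4) that by metis+
    show "inj_on f (verts (subdivision1 (add_apex (cycle_graph k))))"
      unfolding verts inj_on_def by (auto simp: f1 f2 f3 ne1 ne2)
    have "0 < k" using k by simp
    then have "v \<in> verts G" "\<And>i. i < k \<Longrightarrow> a i \<in> verts G \<and> b i \<in> verts G \<and> p i \<in> verts G"
      using e adj by blast+
    then show "f ` verts (subdivision1 (add_apex (cycle_graph k))) \<subseteq> verts G"
      unfolding verts by (auto simp: f1 f2 f3)
    fix c assume "c \<in> edges (subdivision1 (add_apex (cycle_graph k)))"
    then obtain w e' where c: "c = {Inl w, Inr e'}" "e' \<in> edges (add_apex (cycle_graph k))" "w \<in> e'"
      by (auto simp: subdivision1_def)
    from c(2) consider i where "i < k" "e' = rim k i" | i where "i < k" "e' = spoke i"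
      unfolding edges_wheel by auto
    then show "f ` c \<in> edges G"
    proof cases
      case 1
      then have "f ` c = {a i, b i} \<or> f ` c = {b i, a (Suc i mod k)}"
        using c(1,3) by (auto simp: rim_def f1 f3[unfolded rim_def])
      then show ?thesis using e(3,4)[OF 1(1)] adj by auto
    next
      case 2
      then have "f ` c = {v, p i} \<or> f ` c = {p i, a i}"
        using c(1,3) by (auto simp: spoke_def f1 f2[unfolded spoke_def])
      then show ?thesis using e(1,2)[OF 2(1)] adj by auto
    qed
  qed
qed

section \<open>Passing to an almost regular subgraph\<close>

lemma exists_maximiser:
  fixes f :: "'i \<Rightarrow> real"
  assumes "finite S" "S \<noteq> {}"
  obtains x where "x \<in> S" "\<And>y. y \<in> S \<Longrightarrow> f y \<le> f x"
proof -
  have "Max (f ` S) \<in> f ` S" using assms by (intro Max_in) auto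
  then obtain x where "x \<in> S" "f x = Max (f ` S)" by auto
  then show thesis using that[of x] assms by simp
qed

definition induced :: "'a set set \<Rightarrow> 'a set \<Rightarrow> 'a set set" where
  "induced E U = {e \<in> E. e \<subseteq> U}"

lemma sum_degrees:
  assumes "finite U" "finite E" "\<And>e. e \<in> E \<Longrightarrow> card e = 2"
  shows "(\<Sum>w\<in>U. card {e \<in> induced E U. w \<in> e}) = 2 * card (induced E U)"
proof (rule sum_multicount)
  show "\<forall>e\<in>induced E U. card {w \<in> U. w \<in> e} = 2"
  proof
    fix e assume "e \<in> induced E U"
    then have "{w \<in> U. w \<in> e} = e" "card e = 2" using assms(3) by (auto simp: induced_def)
    then show "card {w \<in> U. w \<in> e} = 2" by simp
  qed
qed (use assms in \<open>auto simp: induced_def\<close>)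

text \<open>An enumeration cuts \<open>U\<close> into blocks of at most \<open>card S\<close>
  vertices. An edge of \<open>U\<close> that meets \<open>S\<close> lies in the union of
  \<open>S\<close> with one block, and the number of blocks is at most
  \<open>card U div card S + 1\<close>.\<close>

lemma card_edges_meeting_le:
  fixes x :: real
  assumes U: "finite U" and E: "finite E" "\<And>e. e \<in> E \<Longrightarrow> card e = 2" and S: "S \<subseteq> U" "S \<noteq> {}"
    and small: "\<And>T. T \<subseteq> U \<Longrightarrow> card T \<le> 2 * card S \<Longrightarrow> card (induced E T) \<le> x"
  shows "card {e \<in> induced E U. e \<inter> S \<noteq> {}} \<le> 2 * card U / card S * x"
proof -
  define s where "s = card S"
  have s: "0 < s" "s \<le> card U" using S U by (auto simp: s_def card_gt_0_iff card_mono finite_subset)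
  obtain h where h: "bij_betw h U {..<card U}" using ex_bij_betw_finite_nat[OF U] by (auto simp: atLeast0LessThan)
  define B where "B i = {w \<in> U. h w div s = i}" for i
  have B: "card (S \<union> B i) \<le> 2 * card S" for i
  proof -
    have "card (B i) \<le> card {i * s..<i * s + s}"
    proof (rule card_inj_on_le[where f = h])
      show "inj_on h (B i)" using h by (auto simp: bij_betw_def inj_on_def B_def)
      show "h ` B i \<subseteq> {i * s..<i * s + s}"
        using s(1) by (auto simp: B_def div_times_less_eq_dividend dividend_less_div_times add.commute)
    qed simp
    then show ?thesis using card_Un_le[of S "B i"] by (simp add: s_def)
  qed
  have "{e \<in> induced E U. e \<inter> S \<noteq> {}} \<subseteq> (\<Union>i\<in>{..card U div s}. induced E (S \<union> B i))"
  proof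
    fix e assume e: "e \<in> {e \<in> induced E U. e \<inter> S \<noteq> {}}"
    then obtain y where y: "y \<in> e" "y \<in> S" by auto
    have "card e = 2" using e E(2) by (auto simp: induced_def)
    then obtain z where z: "e = {y, z}" using y(1) by (auto simp: card_2_iff)
    have zU: "z \<in> U" using e z by (auto simp: induced_def)
    then have "h z < card U" using h by (auto simp: bij_betw_def)
    then have "h z div s \<le> card U div s" by (intro div_le_mono) simp
    moreover have "e \<in> induced E (S \<union> B (h z div s))" using e y z zU by (auto simp: induced_def B_def)
    ultimately show "e \<in> (\<Union>i\<in>{..card U div s}. induced E (S \<union> B i))" by blast
  qed
  then have "card {e \<in> induced E U. e \<inter> S \<noteq> {}} \<le> card (\<Union>i\<in>{..card U div s}. induced E (S \<union> B i))"
    using E(1) by (intro card_mono) (auto simp: induced_def)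
  also have "\<dots> \<le> (\<Sum>i\<le>card U div s. card (induced E (S \<union> B i)))"
    by (rule card_UN_le) simp
  finally have "real (card {e \<in> induced E U. e \<inter> S \<noteq> {}}) \<le> (\<Sum>i\<le>card U div s. real (card (induced E (S \<union> B i))))"
    by (rule real_le_sum)
  also have "\<dots> \<le> (\<Sum>i\<le>card U div s. x)"
    using S(1) by (intro sum_mono small B) (auto simp: B_def)
  also have "\<dots> = (real (card U div s) + 1) * x" by simp
  also have "\<dots> \<le> 2 * card U / s * x"
  proof (rule mult_right_mono)
    have "real (card U div s) \<le> card U / s" by (rule of_nat_div_le_of_nat)
    moreover have "1 \<le> card U / s" using s by simp
    ultimately show "real (card U div s) + 1 \<le> 2 * card U / s" by simp
    have "0 \<le> real (card (induced E {}))" by simp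
    also have "\<dots> \<le> x" by (rule small) auto
    finally show "0 \<le> x" .
  qed
  finally show ?thesis by (simp add: s_def)
qed

lemma card_incident_eq:
  assumes "\<And>e. e \<in> E \<Longrightarrow> card e = 2" "w \<in> W"
  shows "card {e \<in> induced E W. w \<in> e} = card {z. z \<in> W \<and> {w, z} \<in> E}"
proof (rule bij_betw_same_card[symmetric, where f = "\<lambda>z. {w, z}"])
  have ne: "z \<noteq> w" if "{w, z} \<in> E" for z using assms(1)[OF that] by auto
  have "inj_on (\<lambda>z. {w, z}) {z. z \<in> W \<and> {w, z} \<in> E}"
    by (auto simp: inj_on_def doubleton_eq_iff)
  moreover have "(\<lambda>z. {w, z}) ` {z. z \<in> W \<and> {w, z} \<in> E} = {e \<in> induced E W. w \<in> e}"
  proof (intro equalityI subsetI)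
    fix e assume e: "e \<in> {e \<in> induced E W. w \<in> e}"
    then have "card e = 2" using assms(1) by (auto simp: induced_def)
    then obtain z where "e = {w, z}" using e by (auto simp: card_2_iff)
    then show "e \<in> (\<lambda>z. {w, z}) ` {z. z \<in> W \<and> {w, z} \<in> E}" using e by (auto simp: induced_def)
  qed (use assms(2) in \<open>auto simp: induced_def\<close>)
  ultimately show "bij_betw (\<lambda>z. {w, z}) {z. z \<in> W \<and> {w, z} \<in> E} {e \<in> induced E W. w \<in> e}"
    by (simp add: bij_betw_def)
qed

text \<open>The set \<open>U\<close> maximises \<open>e(U) / |U|\<^bsup>4/3\<^esup>\<close>. By maximality, few of its edges meet the small set of
  vertices of large degree, so these vertices can be deleted.\<close>

lemma almost_regular_subgraph:
  assumes V: "finite V" and E: "\<And>e. e \<in> E \<Longrightarrow> e \<subseteq> V \<and> card e = 2" and ne: "E \<noteq> {}"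
  obtains U W where "U \<subseteq> V" "W \<subseteq> U" "W \<noteq> {}" "0 < card (induced E U)"
    "card E / card V powr (4 / 3) \<le> card (induced E U) / card U powr (4 / 3)"
    "\<And>w. w \<in> W \<Longrightarrow> card (induced E U) / (4 * card U) \<le> card {z. z \<in> W \<and> {w, z} \<in> E}"
    "\<And>w. w \<in> W \<Longrightarrow> card {z. z \<in> W \<and> {w, z} \<in> E} \<le> 2048 * card (induced E U) / card U"
proof -
  have finE: "finite E" using V E by (intro finite_subset[of E "Pow V"]) auto
  have E2: "card e = 2" if "e \<in> E" for e using E that by blast
  have Vne: "V \<noteq> {}"
  proof
    assume "V = {}"
    moreover obtain e where "e \<in> E" using ne by blast
    ultimately show False using E[of e] by auto
  qed
  define f where "f T = card (induced E T) / card T powr (4 / 3)" for T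
  obtain U where U: "U \<in> Pow V - {{}}" "\<And>T. T \<in> Pow V - {{}} \<Longrightarrow> f T \<le> f U"
    using exists_maximiser[of "Pow V - {{}}" f] V Vne by blast
  have UV: "U \<subseteq> V" "U \<noteq> {}" using U(1) by auto
  have finU: "finite U" using UV V finite_subset by blast
  define u where "u = real (card U)"
  define e where "e = real (card (induced E U))"
  have u: "0 < u" using UV finU by (simp add: u_def card_gt_0_iff)
  have indV: "induced E V = E" using E by (auto simp: induced_def)
  have fV: "card E / card V powr (4 / 3) \<le> f U"
    using U(2)[of V] Vne by (simp add: f_def indV)
  have "0 < card E" using ne finE by (simp add: card_gt_0_iff)
  moreover have "0 < card V" using V Vne by (simp add: card_gt_0_iff)
  ultimately have "0 < f U" using fV by (smt (verit) divide_pos_pos of_nat_0_less_iff powr_gt_zero)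
  then have e: "0 < e" by (simp add: f_def e_def zero_less_divide_iff)
  have fU: "f U = e / u powr (4 / 3)" by (simp add: f_def e_def u_def)
  have maxU: "card (induced E T) \<le> f U * card T powr (4 / 3)" if "T \<subseteq> U" for T
  proof (cases "T = {}")
    case True
    have "induced E {} = {}" using E2[of "{}"] by (auto simp: induced_def)
    then show ?thesis using True \<open>0 < f U\<close> by simp
  next
    case False
    then have "0 < real (card T)" using that finU finite_subset by (auto simp: card_gt_0_iff)
    moreover have "f T \<le> f U" using U(2)[of T] that UV False by blast
    ultimately show ?thesis by (simp add: f_def pos_divide_le_eq)
  qed
  define S where "S = {w \<in> U. 2048 * e / u < card {e \<in> induced E U. w \<in> e}}"
  have SU: "S \<subseteq> U" by (auto simp: S_def)
  have finS: "finite S" using SU finU finite_subset by blast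
  \<comment> \<open>The degrees in \<open>U\<close> sum to \<open>2 * e\<close>, so at most one
    vertex in \<open>1024\<close> can have degree above \<open>2048 * e / u\<close>.\<close>
  have cS: "1024 * real (card S) \<le> u"
  proof -
    have "card S * (2048 * e / u) \<le> (\<Sum>w\<in>S. real (card {e \<in> induced E U. w \<in> e}))"
      using sum_mono[of S "\<lambda>_. 2048 * e / u" "\<lambda>w. real (card {e \<in> induced E U. w \<in> e})"] by (simp add: S_def)
    also have "\<dots> \<le> (\<Sum>w\<in>U. real (card {e \<in> induced E U. w \<in> e}))"
      using SU finU by (intro sum_mono2) auto
    also have "\<dots> = 2 * e"
      using sum_degrees[OF finU finE E2] unfolding e_def by (simp flip: of_nat_sum)
    finally have "card S * (2048 * e) \<le> 2 * e * u" using u by (simp add: field_simps)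
    then have "(1024 * real (card S)) * (2 * e) \<le> u * (2 * e)" by (simp add: algebra_simps)
    then show ?thesis using e by simp
  qed
  \<comment> \<open>By maximality of \<open>U\<close>, sets of at most \<open>2 * s\<close> vertices
    span at most \<open>f U * (2 * s) powr (4 / 3)\<close> edges. As
    \<open>2 * s \<le> u / 512\<close> and the cube root of \<open>512\<close> is \<open>8\<close>,
    the bound for the edges meeting \<open>S\<close> becomes
    \<open>f U * u powr (4 / 3) / 2 = e / 2\<close>.\<close>
  have meet: "card {e \<in> induced E U. e \<inter> S \<noteq> {}} \<le> e / 2"
  proof (cases "S = {}")
    case True
    then show ?thesis using e by simp
  next
    case False
    define s where "s = real (card S)"
    have s: "0 < s" using False finS by (simp add: s_def card_gt_0_iff)
    define x where "x = f U * (2 * s) powr (4 / 3)"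
    have "card {e \<in> induced E U. e \<inter> S \<noteq> {}} \<le> 2 * card U / card S * x"
    proof (rule card_edges_meeting_le[OF finU finE E2 SU False])
      fix T assume T: "T \<subseteq> U" "card T \<le> 2 * card S"
      have "card (induced E T) \<le> f U * card T powr (4 / 3)" by (rule maxU[OF T(1)])
      also have "\<dots> \<le> f U * (2 * s) powr (4 / 3)"
        using T(2) \<open>0 < f U\<close> by (intro mult_left_mono powr_mono2) (auto simp: s_def)
      finally show "card (induced E T) \<le> x" by (simp add: x_def)
    qed
    also have "\<dots> = 2 * u / s * x" by (simp add: u_def s_def)
    also have "x = f U * (2 * s * (2 * s) powr (1 / 3))"
      using s powr_add[of "2 * s" 1 "1 / 3"] by (simp add: x_def)
    also have "2 * u / s * (f U * (2 * s * (2 * s) powr (1 / 3))) = f U * u * (4 * (2 * s) powr (1 / 3))"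
      using s by simp
    also have "\<dots> \<le> f U * u * (4 * (u powr (1 / 3) / 8))"
    proof (intro mult_left_mono)
      have "(2 * s) powr (1 / 3) \<le> (u / 512) powr (1 / 3)"
        using cS s by (intro powr_mono2) (auto simp: s_def)
      also have "\<dots> = u powr (1 / 3) / 512 powr (1 / 3)" using u by (simp add: powr_divide)
      also have "(512 :: real) powr (1 / 3) = (8 powr 3) powr (1 / 3)" by simp
      also have "\<dots> = 8" by (subst powr_powr) simp
      finally show "(2 * s) powr (1 / 3) \<le> u powr (1 / 3) / 8" .
    qed (use \<open>0 < f U\<close> u in auto)
    also have "\<dots> = f U * (u * u powr (1 / 3)) / 2" by simp
    also have "u * u powr (1 / 3) = u powr (4 / 3)" using u powr_add[of u 1 "1 / 3"] by simp
    also have "f U * u powr (4 / 3) = e" using u by (simp add: fU)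
    finally show ?thesis .
  qed
  define U' where "U' = U - S"
  have "induced E U = induced E U' \<union> {e \<in> induced E U. e \<inter> S \<noteq> {}}"
    by (auto simp: induced_def U'_def)
  then have "card (induced E U) \<le> card (induced E U') + card {e \<in> induced E U. e \<inter> S \<noteq> {}}"
    by (metis card_Un_le)
  then have eU': "e / 2 \<le> card (induced E U')" using meet unfolding e_def by linarith
  \<comment> \<open>Deleting a vertex of degree below \<open>c\<close> would increase
    \<open>g\<close>, so a maximiser \<open>W\<close> has all degrees at least \<open>c\<close>. It
    is nonempty since \<open>g\<close> is positive at \<open>U'\<close>: at least
    \<open>e / 2\<close> edges against a penalty of at most \<open>e / 4\<close>.\<close>
  define c where "c = e / (4 * u)"
  define g where "g T = card (induced E T) - c * card T" for T
  have finPU: "finite (Pow U')" using finU by (simp add: U'_def)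
  obtain W where W: "W \<in> Pow U'" "\<And>T. T \<in> Pow U' \<Longrightarrow> g T \<le> g W"
    using exists_maximiser[OF finPU, of g] by blast
  have WU: "W \<subseteq> U" "W \<subseteq> U'" using W(1) by (auto simp: U'_def)
  have finW: "finite W" using WU finU finite_subset by blast
  have "c * card U' \<le> c * u"
    using e u finU by (intro mult_left_mono) (auto simp: c_def u_def U'_def card_mono)
  also have "c * u = e / 4" using u by (simp add: c_def)
  finally have "0 < g U'" using eU' e by (simp add: g_def)
  then have gW: "0 < g W" using W(2)[of U'] by simp
  have Wne: "W \<noteq> {}"
  proof
    assume "W = {}"
    moreover have "induced E {} = {}" using E2[of "{}"] by (auto simp: induced_def)
    ultimately show False using gW by (simp add: g_def)
  qed
  show thesis
  proof (rule that[OF UV(1) WU(1) Wne])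
    show "0 < card (induced E U)" using e by (simp add: e_def)
    show "card E / card V powr (4 / 3) \<le> card (induced E U) / card U powr (4 / 3)"
      using fV by (simp add: f_def)
    fix w assume w: "w \<in> W"
    have deg: "card {z. z \<in> W \<and> {w, z} \<in> E} = card {e \<in> induced E W. w \<in> e}"
      by (rule card_incident_eq[OF E2 w, symmetric])
    have "induced E W = induced E (W - {w}) \<union> {e \<in> induced E W. w \<in> e}" by (auto simp: induced_def)
    then have "card (induced E W) \<le> card (induced E (W - {w})) + card {e \<in> induced E W. w \<in> e}"
      by (metis card_Un_le)
    moreover have "c * card W = c * card (W - {w}) + c"
      using card.remove[OF finW w] by (simp add: algebra_simps)
    moreover have "g (W - {w}) \<le> g W" using W by (intro W(2)) auto
    ultimately have "c \<le> card {e \<in> induced E W. w \<in> e}"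
      unfolding g_def by linarith
    then show "card (induced E U) / (4 * card U) \<le> card {z. z \<in> W \<and> {w, z} \<in> E}"
      unfolding deg c_def e_def u_def by simp
    have "w \<notin> S" "w \<in> U" using w WU by (auto simp: U'_def)
    then have "card {e \<in> induced E U. w \<in> e} \<le> 2048 * e / u" by (simp add: S_def)
    moreover have "card {e \<in> induced E W. w \<in> e} \<le> card {e \<in> induced E U. w \<in> e}"
      using finE WU(1) by (intro card_mono) (auto simp: induced_def)
    ultimately show "card {z. z \<in> W \<and> {w, z} \<in> E} \<le> 2048 * card (induced E U) / card U"
      unfolding deg e_def u_def by linarith
  qed
qed

text \<open>The degree bounds \<open>e / (4 * u)\<close> and \<open>2048 * e / u\<close> of the
  almost regular subgraph have ratio \<open>8192\<close>. With \<open>\<Delta>^3 \<le> C * u\<close>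
  they give \<open>e^3 \<le> 64 * C * u^4\<close>. This bounds \<open>e / u powr (4 / 3)\<close>,
  which is at least the same quotient for the whole graph.\<close>

lemma card_edges_subdivided_wheel_free:
  assumes k: "4 \<le> k"
  shows "\<exists>C>0. \<forall>G :: 'a graph. finite_simple_graph G \<longrightarrow>
    \<not> contains_copy G (subdivision1 (add_apex (cycle_graph k))) \<longrightarrow>
    card (edges G) \<le> C * card (verts G) powr (4 / 3)"
proof -
  obtain C where C: "0 < C" "\<And>(adj :: 'a \<Rightarrow> 'a \<Rightarrow> bool) V \<delta> \<Delta>.
    simple_graph adj V \<Longrightarrow> V \<noteq> {} \<Longrightarrow> \<not> has_wheel adj k \<Longrightarrow>
    (\<forall>y\<in>V. \<delta> \<le> card {z. adj y z}) \<Longrightarrow> (\<forall>y\<in>V. card {z. adj y z} \<le> \<Delta>) \<Longrightarrow> real \<Delta> \<le> 8192 * real \<delta> \<Longrightarrow>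
    real \<Delta> ^ 3 \<le> C * real (card V)"
    using almost_regular_wheel_free_bound[OF k, of 8192, where ?'a = 'a] by auto
  define C' where "C' = (64 * C) powr (1 / 3)"
  have "card (edges G) \<le> C' * card (verts G) powr (4 / 3)"
    if G: "finite_simple_graph G" and no: "\<not> contains_copy G (subdivision1 (add_apex (cycle_graph k)))"
    for G :: "'a graph"
  proof (cases "edges G = {}")
    case True
    then show ?thesis by (simp add: C'_def)
  next
    case False
    have V: "finite (verts G)" and E: "\<And>e. e \<in> edges G \<Longrightarrow> e \<subseteq> verts G \<and> card e = 2"
      using G by (auto simp: finite_simple_graph_def)
    obtain U W where UW: "U \<subseteq> verts G" "W \<subseteq> U" "W \<noteq> {}" "0 < card (induced (edges G) U)"
      "card (edges G) / card (verts G) powr (4 / 3) \<le> card (induced (edges G) U) / card U powr (4 / 3)"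
      and lo: "\<And>w. w \<in> W \<Longrightarrow> card (induced (edges G) U) / (4 * card U) \<le> card {z. z \<in> W \<and> {w, z} \<in> edges G}"
      and hi: "\<And>w. w \<in> W \<Longrightarrow> card {z. z \<in> W \<and> {w, z} \<in> edges G} \<le> 2048 * card (induced (edges G) U) / card U"
      by (rule almost_regular_subgraph[OF V E False]) (assumption, rule that)
    define e where "e = real (card (induced (edges G) U))"
    define u where "u = real (card U)"
    have finU: "finite U" using UW(1) V finite_subset by blast
    have u: "0 < u" using UW(2,3) finU by (auto simp: u_def card_gt_0_iff)
    have e: "0 < e" using UW(4) by (simp add: e_def)
    define adj where "adj x y \<longleftrightarrow> x \<in> W \<and> y \<in> W \<and> {x, y} \<in> edges G" for x y
    have adjW: "{z. adj w z} = {z. z \<in> W \<and> {w, z} \<in> edges G}" if "w \<in> W" for w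
      using that by (auto simp: adj_def)
    define \<delta> where "\<delta> = nat \<lceil>e / (4 * u)\<rceil>"
    define \<Delta> where "\<Delta> = nat \<lfloor>2048 * e / u\<rfloor>"
    have pos: "0 \<le> e / (4 * u)" "0 \<le> 2048 * e / u" using e u by auto
    have \<delta>1: "e / (4 * u) \<le> real \<delta>" unfolding \<delta>_def by linarith
    have low: "\<delta> \<le> card {z. adj w z}" if "w \<in> W" for w
      using lo[OF that] unfolding \<delta>_def adjW[OF that] e_def u_def by (simp add: nat_le_iff ceiling_le_iff)
    have up: "card {z. adj w z} \<le> \<Delta>" if "w \<in> W" for w
      using hi[OF that] unfolding \<Delta>_def adjW[OF that] e_def u_def by (simp add: le_nat_floor)
    have "real \<Delta> \<le> 2048 * e / u" using pos(2) unfolding \<Delta>_def by linarith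
    also have "\<dots> = 8192 * (e / (4 * u))" by simp
    also have "\<dots> \<le> 8192 * real \<delta>" using \<delta>1 by simp
    finally have \<Delta>\<delta>: "real \<Delta> \<le> 8192 * real \<delta>" .
    have sg: "simple_graph adj W"
    proof
      show "finite W" using UW(2) finU finite_subset by blast
      show "\<not> adj x x" for x using E[of "{x, x}"] by (auto simp: adj_def)
    qed (auto simp: adj_def insert_commute)
    have nw: "\<not> has_wheel adj k"
    proof
      assume "has_wheel adj k"
      then have "contains_copy G (subdivision1 (add_apex (cycle_graph k)))"
        by (rule has_wheel_contains_copy[rotated]) (use k UW(1,2) in \<open>auto simp: adj_def\<close>)
      then show False using no by blast
    qed
    obtain w where w: "w \<in> W" using UW(3) by blast
    have "\<delta> \<le> \<Delta>" using low[OF w] up[OF w] by simp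
    then have "e / (4 * u) \<le> real \<Delta>" using \<delta>1 by linarith
    then have "(e / (4 * u)) ^ 3 \<le> real \<Delta> ^ 3" using pos(1) by (rule power_mono)
    also have "\<dots> \<le> C * card W"
      using C(2)[OF sg UW(3) nw _ _ \<Delta>\<delta>] low up by blast
    also have "\<dots> \<le> C * u"
      using C(1) UW(2) finU by (intro mult_left_mono) (auto simp: u_def card_mono)
    finally have "e ^ 3 \<le> 64 * C * u ^ 4"
      using u by (simp add: power_divide power_mult_distrib field_simps eval_nat_numeral)
    then have "(e powr 3) powr (1 / 3) \<le> (64 * C * u powr 4) powr (1 / 3)"
      using e u by (intro powr_mono2) auto
    also have "(e powr 3) powr (1 / 3) = e" using e by (subst powr_powr) simp
    also have "(64 * C * u powr 4) powr (1 / 3) = C' * u powr (4 / 3)"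
    proof -
      have "(64 * C * u powr 4) powr (1 / 3) = C' * (u powr 4) powr (1 / 3)"
        unfolding C'_def by (rule powr_mult)
      also have "(u powr 4) powr (1 / 3) = u powr (4 / 3)" by (subst powr_powr) simp
      finally show ?thesis .
    qed
    finally have "e / u powr (4 / 3) \<le> C'" using u by (simp add: pos_divide_le_eq)
    then have "card (edges G) / card (verts G) powr (4 / 3) \<le> C'" using UW(5) by (simp add: e_def u_def)
    moreover have "0 < card (verts G)" using UW(1-3) V by (auto simp: card_gt_0_iff)
    ultimately show ?thesis by (simp add: pos_divide_le_eq)
  qed
  moreover have "0 < C'" using C(1) by (simp add: C'_def)
  ultimately show ?thesis by blast
qed

section \<open>The lower bound\<close>

text \<open>The fixed points of the \<open>m\<close>-th iterate of the Frobenius map on the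
  algebraic closure of the field with two elements.\<close>

definition GF2 :: "nat \<Rightarrow> bit alg_closure set" where
  "GF2 m = {x. x ^ (2 ^ m) = x}"

lemma two_alg_closure_bit: "(2 :: bit alg_closure) = 0"
proof -
  have "(2 :: bit alg_closure) = to_ac (2 :: bit)" by (rule to_ac_numeral[symmetric])
  also have "(2 :: bit) = 0" by simp
  finally show ?thesis by simp
qed

lemma frobenius_diff:
  fixes x y :: "bit alg_closure"
  shows "(x - y) ^ (2 ^ m) = x ^ (2 ^ m) - y ^ (2 ^ m)"
proof (induction m)
  case (Suc m)
  have "(x - y) ^ (2 ^ Suc m) = ((x - y) ^ (2 ^ m))\<^sup>2" by (simp add: power_mult[symmetric] mult.commute)
  also have "\<dots> = (x ^ (2 ^ m) - y ^ (2 ^ m))\<^sup>2" using Suc by simp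
  also have "\<dots> = (x ^ (2 ^ m))\<^sup>2 - (y ^ (2 ^ m))\<^sup>2 - 2 * (x ^ (2 ^ m) - y ^ (2 ^ m)) * y ^ (2 ^ m)"
    by (simp add: power2_eq_square algebra_simps)
  also have "\<dots> = (x ^ (2 ^ m))\<^sup>2 - (y ^ (2 ^ m))\<^sup>2" by (simp add: two_alg_closure_bit)
  finally show ?case by (simp add: power_mult[symmetric] mult.commute)
qed simp

lemma GF2_diff: "x \<in> GF2 m \<Longrightarrow> y \<in> GF2 m \<Longrightarrow> x - y \<in> GF2 m"
  by (simp add: GF2_def frobenius_diff)

lemma GF2_mult: "x \<in> GF2 m \<Longrightarrow> y \<in> GF2 m \<Longrightarrow> x * y \<in> GF2 m"
  by (simp add: GF2_def power_mult_distrib)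

text \<open>The polynomial \<open>X^(2^m) - X\<close> splits over the algebraic closure. In
  characteristic two its derivative is the constant \<open>-1\<close>, so its roots are simple and
  their number is its degree.\<close>

lemma card_GF2:
  assumes m: "0 < m"
  shows "finite (GF2 m)" "card (GF2 m) = 2 ^ m"
proof -
  define p :: "bit alg_closure poly" where "p = monom 1 (2 ^ m) - monom 1 1"
  have q: "1 < (2 :: nat) ^ m" using m one_less_power[of "2 :: nat" m] by simp
  have deg: "degree p = 2 ^ m"
  proof -
    have "degree (- monom 1 1 :: bit alg_closure poly) < degree (monom 1 (2 ^ m) :: bit alg_closure poly)"
      using q by (simp add: degree_monom_eq)
    then have "degree (monom 1 (2 ^ m) + - monom 1 1 :: bit alg_closure poly) = 2 ^ m"
      by (subst degree_add_eq_left) (auto simp: degree_monom_eq)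
    then show ?thesis by (simp add: p_def)
  qed
  then have p0: "p \<noteq> 0" using q by auto
  obtain A where A: "size A = degree p" "p = smult (lead_coeff p) (\<Prod>x\<in>#A. [:-x, 1:])"
    using alg_closed_imp_factorization[OF p0] by blast
  have roots: "poly p x = 0 \<longleftrightarrow> x \<in> GF2 m" for x
    by (simp add: p_def GF2_def poly_monom)
  have "poly p x = lead_coeff p * (\<Prod>a\<in>#A. x - a)" for x
    by (subst A(2)) (simp add: poly_prod_mset image_mset.compositionality o_def)
  then have "poly p x = 0 \<longleftrightarrow> x \<in># A" for x
    using p0 by (auto simp: prod_mset_zero_iff)
  then have set: "set_mset A = GF2 m" using roots by auto
  have two_power: "(2 :: bit alg_closure) ^ m = 0" using m by (simp add: two_alg_closure_bit)
  have "poly (pderiv p) x = - 1" for x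
    by (simp add: p_def pderiv_diff pderiv_monom poly_monom two_power)
  then have pd: "poly (pderiv p) x \<noteq> 0" for x by simp
  have "count A a \<le> 1" for a
  proof (rule ccontr)
    assume "\<not> count A a \<le> 1"
    then have "a \<in># A" "a \<in># A - {#a#}" by (auto simp: in_diff_count simp flip: count_greater_zero_iff)
    then obtain B where "A = {#a, a#} + B" by (metis add_mset_add_single insert_DiffM union_commute add_mset_add_mset_same_iff multi_member_split union_mset_add_mset_left add.left_neutral)
    then have "p = [:-a, 1:] * ([:-a, 1:] * smult (lead_coeff p) (\<Prod>x\<in>#B. [:-x, 1:]))"
      by (subst A(2)) simp
    then obtain r where "p = [:-a, 1:] * ([:-a, 1:] * r)" by blast
    then have "poly (pderiv p) a = 0" by (simp only: pderiv_mult poly_add poly_mult) simp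
    then show False using pd by blast
  qed
  then have "A = mset_set (set_mset A)"
    by (intro multiset_eqI) (metis count_eq_zero_iff count_mset_set(1) count_mset_set(3) finite_set_mset le_antisym less_one not_le count_greater_zero_iff)
  then have "size A = card (set_mset A)" by (metis size_mset_set)
  then show "card (GF2 m) = 2 ^ m" using A(1) deg set by simp
  show "finite (GF2 m)" using set by (metis finite_set_mset)
qed

section \<open>The Wenger graph and its hexagons\<close>

definition incident :: "bit alg_closure \<times> bit alg_closure \<times> bit alg_closure
    \<Rightarrow> bit alg_closure \<times> bit alg_closure \<times> bit alg_closure \<Rightarrow> bool" where
  "incident P L \<longleftrightarrow> (case P of (a, b, c) \<Rightarrow> case L of (x, y, z) \<Rightarrow> b + y = a * x \<and> c + z = a * y)"

text \<open>Two points on a line with the same first coordinate coincide, so \<open>a1\<close>,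
  \<open>a2\<close>, \<open>a3\<close> are distinct. The differences \<open>x1 - x2\<close>,
  \<open>x2 - x3\<close>, \<open>x3 - x1\<close> sum to zero, also with weights \<open>a2\<close>,
  \<open>a3\<close>, \<open>a1\<close> and with the squares of these weights. Eliminating from this
  Vandermonde system leaves \<open>x2 = x3\<close>, and then \<open>L2 = L3\<close>.\<close>

lemma incident_no_hexagon:
  assumes "incident P1 L1" "incident P2 L1" "incident P2 L2" "incident P3 L2" "incident P3 L3" "incident P1 L3"
    and "P1 \<noteq> P2" "P2 \<noteq> P3" "P1 \<noteq> P3" "L2 \<noteq> L3"
  shows False
proof -
  obtain a1 b1 c1 a2 b2 c2 a3 b3 c3 x1 y1 z1 x2 y2 z2 x3 y3 z3 where eqs:
    "P1 = (a1, b1, c1)" "P2 = (a2, b2, c2)" "P3 = (a3, b3, c3)"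
    "L1 = (x1, y1, z1)" "L2 = (x2, y2, z2)" "L3 = (x3, y3, z3)"
    by (metis prod.exhaust)
  have *: "b1 = a1 * x1 - y1" "c1 = a1 * y1 - z1" "b2 = a2 * x1 - y1" "c2 = a2 * y1 - z1"
    "b2 = a2 * x2 - y2" "c2 = a2 * y2 - z2" "b3 = a3 * x2 - y2" "c3 = a3 * y2 - z2"
    "b3 = a3 * x3 - y3" "c3 = a3 * y3 - z3" "b1 = a1 * x3 - y3" "c1 = a1 * y3 - z3"
    using assms(1-6) unfolding eqs incident_def by (auto simp: eq_diff_eq)
  have ne: "a1 \<noteq> a2" "a2 \<noteq> a3" "a1 \<noteq> a3"
    using assms(7-9) * unfolding eqs by auto
  have y: "y1 - y2 = a2 * (x1 - x2)" "y2 - y3 = a3 * (x2 - x3)" "y1 - y3 = a1 * (x1 - x3)"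
    and z: "z1 - z2 = a2 * (y1 - y2)" "z2 - z3 = a3 * (y2 - y3)" "z1 - z3 = a1 * (y1 - y3)"
    using * by (auto simp: algebra_simps)
  have h1: "a2 * (x1 - x2) + a3 * (x2 - x3) = a1 * (x1 - x3)"
    unfolding y[symmetric] by simp
  have h2: "a2 * (a2 * (x1 - x2)) + a3 * (a3 * (x2 - x3)) = a1 * (a1 * (x1 - x3))"
    unfolding y[symmetric] z[symmetric] by simp
  have "(a3 - a1) * (a3 - a2) * (x2 - x3) =
      (a2 * (a2 * (x1 - x2)) + a3 * (a3 * (x2 - x3)) - a1 * (a1 * (x1 - x3)))
      - (a1 + a2) * (a2 * (x1 - x2) + a3 * (x2 - x3) - a1 * (x1 - x3))"
    by (simp add: algebra_simps)
  also have "\<dots> = 0" unfolding h1 h2 by simp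
  finally have "(a3 - a1) * (a3 - a2) * (x2 - x3) = 0" .
  then have "x2 = x3" using ne by simp
  then have "y2 = y3" "z2 = z3" using * by auto
  then show False using \<open>x2 = x3\<close> assms(10) eqs by simp
qed

definition wenger_edges :: "nat \<Rightarrow> ((bit alg_closure \<times> bit alg_closure \<times> bit alg_closure) +
    (bit alg_closure \<times> bit alg_closure \<times> bit alg_closure)) set set" where
  "wenger_edges m = {{Inl P, Inr L} | P L. P \<in> GF2 m \<times> GF2 m \<times> GF2 m \<and> L \<in> GF2 m \<times> GF2 m \<times> GF2 m \<and> incident P L}"

text \<open>A line \<open>(x, y, z)\<close> and the first coordinate \<open>a\<close> of a point on
  it determine the point, so the edges correspond to quadruples of field elements.\<close>

lemma card_wenger_edges:
  assumes m: "0 < m"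
  shows "finite (wenger_edges m)" "card (wenger_edges m) = (2 ^ m) ^ 4"
proof -
  define g where "g = (\<lambda>(a, x, y, z). {Inl (a, a * x - y, a * y - z), Inr (x, y, z) ::
      (bit alg_closure \<times> bit alg_closure \<times> bit alg_closure) + (bit alg_closure \<times> bit alg_closure \<times> bit alg_closure)})"
  define S where "S = GF2 m \<times> GF2 m \<times> GF2 m \<times> GF2 m"
  have "inj_on g S" by (auto simp: inj_on_def g_def doubleton_eq_iff)
  have img: "g ` S = wenger_edges m"
  proof (intro equalityI subsetI)
    fix e assume "e \<in> g ` S"
    then obtain a x y z where e: "a \<in> GF2 m" "x \<in> GF2 m" "y \<in> GF2 m" "z \<in> GF2 m" "e = g (a, x, y, z)"
      by (auto simp: S_def)
    have "incident (a, a * x - y, a * y - z) (x, y, z)" by (simp add: incident_def)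
    moreover have "(a, a * x - y, a * y - z) \<in> GF2 m \<times> GF2 m \<times> GF2 m" "(x, y, z) \<in> GF2 m \<times> GF2 m \<times> GF2 m"
      using e by (auto intro!: GF2_diff GF2_mult)
    ultimately show "e \<in> wenger_edges m"
      unfolding wenger_edges_def e(5) g_def by blast
  next
    fix e assume "e \<in> wenger_edges m"
    then obtain a b c x y z where e: "e = {Inl (a, b, c), Inr (x, y, z)}" "incident (a, b, c) (x, y, z)"
      "a \<in> GF2 m" "x \<in> GF2 m" "y \<in> GF2 m" "z \<in> GF2 m" by (auto simp: wenger_edges_def)
    have "b = a * x - y" "c = a * y - z" using e(2) by (simp_all add: incident_def eq_diff_eq)
    then have "e = g (a, x, y, z)" using e(1) by (simp add: g_def)
    then show "e \<in> g ` S" using e by (auto simp: S_def)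
  qed
  show "finite (wenger_edges m)" unfolding img[symmetric] using card_GF2(1)[OF m] by (simp add: S_def)
  have "card (wenger_edges m) = card S" unfolding img[symmetric] using \<open>inj_on g S\<close> by (rule card_image)
  then show "card (wenger_edges m) = (2 ^ m) ^ 4"
    by (simp add: S_def card_cartesian_product card_GF2[OF m] power4_eq_xxxx)
qed

text \<open>The Wenger graph is embedded into the vertices below \<open>n\<close>, and the vertices
  outside its image are isolated. The subdivided wheel contains a hexagon through the hub and two
  consecutive rim vertices, which this graph does not.\<close>

lemma exists_subdivided_wheel_free_graph:
  assumes m: "0 < m" and n: "2 * (2 ^ m) ^ 3 \<le> n" and k: "3 \<le> k"
  shows "\<exists>G :: nat graph. finite_simple_graph G \<and> card (verts G) = n \<and>
    \<not> contains_copy G (subdivision1 (add_apex (cycle_graph k))) \<and> card (edges G) = (2 ^ m) ^ 4"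
proof -
  define T where "T = GF2 m \<times> GF2 m \<times> GF2 m"
  have T: "finite T" "card T = (2 ^ m) ^ 3"
    using card_GF2[OF m] by (simp_all add: T_def card_cartesian_product power3_eq_cube)
  define U :: "((bit alg_closure \<times> bit alg_closure \<times> bit alg_closure) +
      (bit alg_closure \<times> bit alg_closure \<times> bit alg_closure)) set" where "U = Inl ` T \<union> Inr ` T"
  have "card U \<le> card T + card T"
    unfolding U_def by (rule order_trans[OF card_Un_le add_mono[OF card_image_le card_image_le]]) (use T in auto)
  then have "finite U" "card U \<le> card {..<n}" using T n by (auto simp: U_def)
  then obtain h where h: "inj_on h U" "h ` U \<subseteq> {..<n}"
    using card_le_inj[of U "{..<n}"] by auto
  define E where "E = (\<lambda>e. h ` e) ` wenger_edges m"
  define G :: "nat graph" where "G = ({..<n}, E)"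
  have sub: "e \<subseteq> U" if "e \<in> wenger_edges m" for e
    using that by (auto simp: wenger_edges_def T_def U_def)
  have "card (h ` e) = 2" if "e \<in> wenger_edges m" for e
  proof -
    have "card e = 2" using that by (auto simp: wenger_edges_def)
    then show ?thesis using h(1) sub[OF that] by (metis card_image inj_on_subset)
  qed
  moreover have "h ` e \<subseteq> {..<n}" if "e \<in> wenger_edges m" for e
    using sub[OF that] h(2) by blast
  ultimately have fsg: "finite_simple_graph G"
    by (auto simp: finite_simple_graph_def G_def E_def)
  have "inj_on (\<lambda>e. h ` e) (wenger_edges m)"
  proof (rule inj_onI)
    fix e e' assume "e \<in> wenger_edges m" "e' \<in> wenger_edges m" "h ` e = h ` e'"
    then show "e = e'" using inj_on_image_eq_iff[OF h(1) sub sub] by blast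
  qed
  then have cE: "card (edges G) = (2 ^ m) ^ 4"
    by (simp add: G_def E_def card_image card_wenger_edges[OF m])
  have hT: "h (Inl P) \<noteq> h (Inr L)" "h (Inl P) = h (Inl P') \<longleftrightarrow> P = P'" "h (Inr L) = h (Inr L') \<longleftrightarrow> L = L'"
    if "P \<in> T" "P' \<in> T" "L \<in> T" "L' \<in> T" for P P' L L'
    using h(1) that by (auto simp: inj_on_eq_iff U_def)
  have edge: "\<exists>P L. P \<in> T \<and> L \<in> T \<and> incident P L \<and> (w = h (Inl P) \<and> w' = h (Inr L) \<or> w = h (Inr L) \<and> w' = h (Inl P))"
    if ww: "{w, w'} \<in> edges G" for w w'
  proof -
    obtain e where e: "e \<in> wenger_edges m" "{w, w'} = h ` e" using ww by (auto simp: G_def E_def)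
    then obtain P L where PL: "e = {Inl P, Inr L}" "P \<in> T" "L \<in> T" "incident P L"
      unfolding wenger_edges_def T_def by blast
    then have "{w, w'} = {h (Inl P), h (Inr L)}" using e(2) by simp
    then show ?thesis using PL(2-4) unfolding doubleton_eq_iff by blast
  qed
  have pt: "\<exists>L\<in>T. w' = h (Inr L) \<and> incident P L" if "{h (Inl P), w'} \<in> edges G" "P \<in> T" for P w'
  proof -
    obtain P' L where "P' \<in> T" "L \<in> T" "incident P' L"
      "h (Inl P) = h (Inl P') \<and> w' = h (Inr L) \<or> h (Inl P) = h (Inr L) \<and> w' = h (Inl P')"
      using edge[OF \<open>{h (Inl P), w'} \<in> edges G\<close>] by blast
    then show ?thesis using hT[of P P' L L] \<open>P \<in> T\<close> by auto
  qed
  have ln: "\<exists>P\<in>T. w' = h (Inl P) \<and> incident P L" if "{h (Inr L), w'} \<in> edges G" "L \<in> T" for L w'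
  proof -
    obtain P L' where "P \<in> T" "L' \<in> T" "incident P L'"
      "h (Inr L) = h (Inl P) \<and> w' = h (Inr L') \<or> h (Inr L) = h (Inr L') \<and> w' = h (Inl P)"
      using edge[OF \<open>{h (Inr L), w'} \<in> edges G\<close>] by blast
    then show ?thesis using hT[of P P L L'] \<open>L \<in> T\<close> by auto
  qed
  have hexagon: False
    if e: "{w0, w1} \<in> edges G" "{w1, w2} \<in> edges G" "{w2, w3} \<in> edges G" "{w3, w4} \<in> edges G"
      "{w4, w5} \<in> edges G" "{w5, w0} \<in> edges G" and d: "distinct [w0, w1, w2, w3, w4, w5]"
      and P: "P \<in> T" "w0 = h (Inl P)"
    for w0 w1 w2 w3 w4 w5 P
  proof -
    obtain L1 where L1: "L1 \<in> T" "w1 = h (Inr L1)" "incident P L1"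
      using pt[OF e(1)[unfolded P(2)] P(1)] by blast
    obtain P2 where P2: "P2 \<in> T" "w2 = h (Inl P2)" "incident P2 L1"
      using ln[OF e(2)[unfolded L1(2)] L1(1)] by blast
    obtain L2 where L2: "L2 \<in> T" "w3 = h (Inr L2)" "incident P2 L2"
      using pt[OF e(3)[unfolded P2(2)] P2(1)] by blast
    obtain P3 where P3: "P3 \<in> T" "w4 = h (Inl P3)" "incident P3 L2"
      using ln[OF e(4)[unfolded L2(2)] L2(1)] by blast
    obtain L3 where L3: "L3 \<in> T" "w5 = h (Inr L3)" "incident P3 L3"
      using pt[OF e(5)[unfolded P3(2)] P3(1)] by blast
    obtain P4 where P4: "P4 \<in> T" "w0 = h (Inl P4)" "incident P4 L3"
      using ln[OF e(6)[unfolded L3(2)] L3(1)] by blast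
    have "P4 = P" using P4 P hT(2)[of P4 P L1 L1] L1(1) by auto
    then show False
      using incident_no_hexagon[OF L1(3) P2(3) L2(3) P3(3) L3(3)] P4(3) d P(2) L2(2) L3(2) P2(2) P3(2)
      by auto
  qed
  have "\<not> contains_copy G (subdivision1 (add_apex (cycle_graph k)))"
  proof
    let ?F = "subdivision1 (add_apex (cycle_graph k))"
    assume "contains_copy G ?F"
    moreover have "e \<subseteq> verts ?F" if "e \<in> edges ?F" for e
      using finite_simple_graph_subdivided_wheel that by (auto simp: finite_simple_graph_def)
    ultimately obtain f where f: "inj_on f (verts ?F)" "\<And>e. e \<in> edges ?F \<Longrightarrow> f ` e \<in> edges G"
      by (rule contains_copyE) (assumption, rule that)
    have ed: "{f (Inl v), f (Inr e)} \<in> edges G" if "e \<in> edges (add_apex (cycle_graph k))" "v \<in> e" for v e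
      using f(2)[of "{Inl v, Inr e}"] that by (auto simp: subdivision1_def)
    have in_E: "spoke 0 \<in> edges (add_apex (cycle_graph k))" "spoke 1 \<in> edges (add_apex (cycle_graph k))"
      "rim k 0 \<in> edges (add_apex (cycle_graph k))"
      using k unfolding edges_wheel by auto
    have in_V: "None \<in> verts (add_apex (cycle_graph k))" "Some 0 \<in> verts (add_apex (cycle_graph k))"
      "Some 1 \<in> verts (add_apex (cycle_graph k))"
      using k unfolding verts_wheel by auto
    define w0 w1 w2 w3 w4 w5 where w: "w0 = f (Inl None)" "w1 = f (Inr (spoke 0))" "w2 = f (Inl (Some 0))"
      "w3 = f (Inr (rim k 0))" "w4 = f (Inl (Some 1))" "w5 = f (Inr (spoke 1))"
    have es: "{w0, w1} \<in> edges G" "{w1, w2} \<in> edges G" "{w2, w3} \<in> edges G" "{w3, w4} \<in> edges G"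
      "{w4, w5} \<in> edges G" "{w5, w0} \<in> edges G"
      using ed[OF in_E(1), of None] ed[OF in_E(1), of "Some 0"] ed[OF in_E(3), of "Some 0"]
        ed[OF in_E(3), of "Some 1"] ed[OF in_E(2), of "Some 1"] ed[OF in_E(2), of None] k
      unfolding w by (auto simp: spoke_def rim_def insert_commute)
    have dist: "distinct [w0, w1, w2, w3, w4, w5]"
    proof -
      let ?xs = "[Inl None :: nat option + nat option set, Inr (spoke 0), Inl (Some 0), Inr (rim k 0), Inl (Some 1), Inr (spoke 1)]"
      have d: "distinct ?xs" by (auto simp: spoke_def rim_def)
      have "set ?xs \<subseteq> verts ?F" using in_E in_V by (auto simp: subdivision1_def)
      then have "inj_on f (set ?xs)" by (rule inj_on_subset[OF f(1)])
      with d have "distinct (map f ?xs)" unfolding distinct_map by (rule conjI)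
      then show ?thesis unfolding w by simp
    qed
    obtain P L where PL: "P \<in> T" "L \<in> T" "w0 = h (Inl P) \<and> w1 = h (Inr L) \<or> w0 = h (Inr L) \<and> w1 = h (Inl P)"
      using edge[OF es(1)] by blast
    \<comment> \<open>The fact \<open>hexagon\<close> starts at a point; if the hub is mapped to a
      line, the hexagon is rotated by one vertex.\<close>
    then show False
      using hexagon[OF es dist PL(1)] hexagon[OF es(2-6,1) _ PL(1)] dist by auto
  qed
  then show ?thesis using fsg cE by (intro exI[of _ G]) (simp add: G_def)
qed

theorem theorem1p3:
  fixes k :: nat
  assumes "k \<ge> 4"
  shows "\<exists>c C :: real. 0 < c \<and> 0 < C \<and>
    (\<forall>\<^sub>F n in sequentially.
       c * real n powr (4 / 3) \<le> real (ex n (subdivision1 (add_apex (cycle_graph k)))) \<and>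
       real (ex n (subdivision1 (add_apex (cycle_graph k)))) \<le> C * real n powr (4 / 3))"
proof -
  let ?F = "subdivision1 (add_apex (cycle_graph k))"
  obtain C where C: "0 < C" "\<And>G :: nat graph. finite_simple_graph G \<Longrightarrow> \<not> contains_copy G ?F \<Longrightarrow>
      card (edges G) \<le> C * card (verts G) powr (4 / 3)"
    using card_edges_subdivided_wheel_free[OF assms, where ?'a = nat] by auto
  \<comment> \<open>The factor \<open>1 / 16\<close> comes from \<open>n < 16 * 8 ^ m\<close>: the
    graph has \<open>(2 ^ m) ^ 4 = (8 ^ m) powr (4 / 3)\<close> edges.\<close>
  define c :: real where "c = (1 / 16) powr (4 / 3)"
  have "c * real n powr (4 / 3) \<le> real (ex n ?F) \<and> real (ex n ?F) \<le> C * real n powr (4 / 3)"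
    if n: "16 \<le> n" for n
  proof -
    define J where "J = {card (edges G) | G :: nat graph.
       finite_simple_graph G \<and> card (verts G) = n \<and> \<not> contains_copy G ?F}"
    have exX: "ex n ?F = Max J" by (simp add: ex_def J_def)
    \<comment> \<open>A crude bound, only to make \<open>J\<close> finite, so that
      \<open>Max\<close> is attained and bounds all elements.\<close>
    have "x \<le> 2 ^ n" if x: "x \<in> J" for x
    proof -
      obtain G :: "nat graph" where G: "x = card (edges G)" "finite_simple_graph G" "card (verts G) = n"
        using x unfolding J_def by blast
      then have "edges G \<subseteq> Pow (verts G)" "finite (verts G)" by (auto simp: finite_simple_graph_def)
      then show ?thesis using card_mono[of "Pow (verts G)" "edges G"] G by (simp add: card_Pow)
    qed
    then have finX: "finite J" by (intro finite_subset[of J "{..2 ^ n}"]) auto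
    \<comment> \<open>\<open>8 ^ m\<close> is the largest power of \<open>8\<close> up to
      \<open>n div 2\<close>, so that \<open>2 * (2 ^ m) ^ 3\<close> vertices fit;
      \<open>16 \<le> n\<close> makes \<open>m\<close> positive.\<close>
    obtain m where m: "8 ^ m \<le> n div 2" "n div 2 < 8 ^ (m + 1)"
    proof -
      have "1 \<le> n div 2" using n by simp
      then show thesis using ex_power_ivl1[of 8 "n div 2"] that by auto
    qed
    have "0 < m"
    proof (rule ccontr)
      assume "\<not> 0 < m"
      then show False using m(2) n by simp
    qed
    have q: "((2 :: nat) ^ m) ^ 3 = 8 ^ m" by (simp add: power_mult[symmetric] mult.commute[of m] power_mult)
    have "2 * (2 ^ m) ^ 3 \<le> n" using m(1) unfolding q by simp
    then obtain G :: "nat graph" where G: "finite_simple_graph G" "card (verts G) = n" "\<not> contains_copy G ?F"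
      "card (edges G) = (2 ^ m) ^ 4"
      using exists_subdivided_wheel_free_graph[OF \<open>0 < m\<close>, of n k] assms by auto
    then have inX: "(2 ^ m) ^ 4 \<in> J" by (auto simp: J_def intro!: exI[of _ "verts G"] exI[of _ "edges G"])
    have "n < 16 * 8 ^ m" using m(2) by simp
    then have "real n \<le> real (16 * 8 ^ m)" by (simp only: of_nat_le_iff)
    then have "real n / 16 \<le> (2 ^ m) ^ 3"
      using arg_cong[OF q, of real] by simp
    then have "(real n / 16) powr (4 / 3) \<le> ((2 ^ m) ^ 3) powr (4 / 3)" by (intro powr_mono2) auto
    also have "((2 ^ m) ^ 3 :: real) powr (4 / 3) = ((2 ^ m) powr 3) powr (4 / 3)" by simp
    also have "\<dots> = (2 ^ m) powr 4" by (subst powr_powr) simp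
    also have "\<dots> = real ((2 ^ m) ^ 4)" by simp
    also have "\<dots> \<le> real (ex n ?F)" unfolding exX of_nat_le_iff using finX inX by (rule Max_ge)
    also have "(real n / 16) powr (4 / 3) = c * real n powr (4 / 3)"
      by (simp add: c_def powr_mult[symmetric])
    finally have low: "c * real n powr (4 / 3) \<le> real (ex n ?F)" .
    have "Max J \<in> J" using finX inX by (intro Max_in) auto
    then have "real (Max J) \<le> C * real n powr (4 / 3)" using C(2) by (auto simp: J_def)
    then show ?thesis using low exX by simp
  qed
  then have "\<forall>\<^sub>F n in sequentially. c * real n powr (4 / 3) \<le> real (ex n ?F) \<and> real (ex n ?F) \<le> C * real n powr (4 / 3)"
    by (auto simp: eventually_sequentially)
  moreover have "0 < c" by (simp add: c_def)
  ultimately show ?thesis using C(1) by blast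
qed

end
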